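(* Let $p(z)$ be an admissible Hilbert polynomial with Gotzmann number $r>1$. Then: \begin{enumerate} \item[(i)] $\bar\varrho_{p(z)}=\max\{\varrho_{p(z)},\varrho_{\Delta p(z)}-1\}$ and $f^{\bar\varrho_{p(z)}}_{p(z)}\in F(p(z),\bar\varrho_{p(z)})$ (if $p(z)$ is constant, so that $\Delta p(z)=0$, the term $\varrho_{\Delta p(z)}-1$ is to be omitted); \item[(ii)] for all $\varrho>\bar\varrho_{p(z)}$, \[ F(p(z),\varrho)\neq\emptyset\iff\begin{cases} f^{\varrho}_{p(z)}\in F(p(z),\varrho), & \text{if } f^{\varrho}_{p(z)} \text{ has regularity } \varrho,\\ g^{\varrho}_{p(z)}\in F(p(z),\varrho), & \text{otherwise.}\end{cases} \] \end{enumerate}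
   Context: $K$ is an algebraically closed field of characteristic $0$. A "scheme" means a closed subscheme $X$ of a projective space $\mathbb P^n_K=\operatorname{Proj} K[x_0,\ldots,x_n]$, where $n$ is not fixed; its Hilbert function is $H_X(t)=\dim_K(S/I(X))_t$ with $I(X)\subset S=K[x_0,\dots,x_n]$ its saturated defining ideal. The regularity of a function $H:\mathbb N\to\mathbb N$ eventually equal to a polynomial $p$ is $\min\{t\in\mathbb N : H(t')=p(t')\ \forall t'\ge t\}$. A polynomial is admissible if it is the Hilbert polynomial of a scheme; it can be written uniquely as $p(z)=\binom{z+k_1}{k_1}+\binom{z+k_2-1}{k_2}+\cdots+\binom{z+k_r-(r-1)}{k_r}$ with $k_1\ge\cdots\ge k_r\ge0$, and $r$ is its Gotzmann number. $\Delta p(z):=p(z)-p(z-1)$. $F(p(z),\varrho)$ is the set of Hilbert functions of schemes with Hilbert polynomial $p(z)$ whose Hilbert function has regularity $\varrho$; $\bar\varrho_{p(z)}$ is the minimal integer $\varrho$ with $F(p(z),\varrho)\neq\emptyset$. For positive integers $a,t$ the binomial expansion of $a$ in base $t$ is the unique writing $a=\binom{k(t)}{t}+\binom{k(t-1)}{t-1}+\cdots+\binom{k(j)}{j}$ with $k(t)>\cdots>k(j)\ge j\ge1$; set $(a_t)^+_+:=\binom{k(t)+1}{t+1}+\cdots+\binom{k(j)+1}{j+1}$ and $(a_t)^-_-:=\binom{k(t)-1}{t-1}+\cdots+\binom{k(j)-1}{j-1}$ (with $\binom{n}{m}=0$ if $n<m$ or $m<0$, and $\binom n0=1$ for $n\ge0$).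 For an admissible polynomial $q(z)$ with Gotzmann number $r_q$ let $\Pi_{q(z)}:=\{1\le t\le r_q : (q(t+h)_{t+h})^+_+\ge q(t+h+1)\ge1,\ \forall h\ge0\}$ (values $q(t+h)$ being required positive so that the expansion makes sense); this set is non-empty. Put $\varrho_{q(z)}:=0$ if $\min\Pi_{q(z)}=1$ and $q(0)=1$, and $\varrho_{q(z)}:=\min\Pi_{q(z)}$ otherwise. For $\varrho\ge\varrho_{p(z)}$ the functions $f^{\varrho}_{p(z)},g^{\varrho}_{p(z)}$ on $\mathbb N$ are defined by descending recursion: $f^{\varrho}_{p(z)}(t):=p(t)$ if $t\ge\varrho$, and $f^{\varrho}_{p(z)}(t):=(f^{\varrho}_{p(z)}(t+1)_{t+1})^-_-$ if $t<\varrho$; $g^{\varrho}_{p(z)}(t):=p(t)$ if $t\ge\varrho$, $g^{\varrho}_{p(z)}(\varrho-1):=p(\varrho-1)+1$, and $g^{\varrho}_{p(z)}(t):=(g^{\varrho}_{p(z)}(t+1)_{t+1})^-_-$ if $t<\varrho-1$. *)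

theory Defs
  imports
    "HOL-Library.Poly_Mapping"
    "HOL-Computational_Algebra.Polynomial"
begin

text \<open>
  All the rings \<open>K[x\<^sub>0,\<dots>,x\<^sub>n]\<close> live inside the single type of polynomials over \<open>K\<close> in
  countably many variables: a monomial is an exponent vector of type \<^typ>\<open>nat \<Rightarrow>\<^sub>0 nat\<close>, and a
  polynomial is a finitely supported map from monomials to coefficients.
\<close>

type_synonym 'a mpol = "(nat \<Rightarrow>\<^sub>0 nat) \<Rightarrow>\<^sub>0 'a"

definition smult_mpol :: "'a::field \<Rightarrow> 'a mpol \<Rightarrow> 'a mpol" where
  "smult_mpol c f = Poly_Mapping.single 0 c * f"

interpretation mpol: vector_space smult_mpol
  by unfold_locales
     (simp_all add: smult_mpol_def single_add distrib_left distrib_right mult_single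
        mult.assoc [symmetric])

definition mon_deg :: "(nat \<Rightarrow>\<^sub>0 nat) \<Rightarrow> nat" where
  "mon_deg m = (\<Sum>i\<in>Poly_Mapping.keys m. Poly_Mapping.lookup m i)"

definition poly_ring :: "nat \<Rightarrow> 'a::field mpol set" where
  "poly_ring n = {f. \<forall>m\<in>Poly_Mapping.keys f. Poly_Mapping.keys m \<subseteq> {..n}}"

definition forms :: "nat \<Rightarrow> nat \<Rightarrow> 'a::field mpol set" where
  "forms n t = {f \<in> poly_ring n. \<forall>m\<in>Poly_Mapping.keys f. mon_deg m = t}"

definition hom_comp :: "nat \<Rightarrow> 'a::field mpol \<Rightarrow> 'a mpol" where
  "hom_comp t f =
     (\<Sum>m\<in>{m \<in> Poly_Mapping.keys f. mon_deg m = t}.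
        Poly_Mapping.single m (Poly_Mapping.lookup f m))"

definition is_ideal :: "nat \<Rightarrow> 'a::field mpol set \<Rightarrow> bool" where
  "is_ideal n I \<longleftrightarrow> I \<subseteq> poly_ring n \<and> 0 \<in> I \<and> (\<forall>f\<in>I. \<forall>g\<in>I. f + g \<in> I) \<and>
     (\<forall>f\<in>I. \<forall>g\<in>poly_ring n. g * f \<in> I)"

definition is_homogeneous :: "'a::field mpol set \<Rightarrow> bool" where
  "is_homogeneous I \<longleftrightarrow> (\<forall>f\<in>I. \<forall>t. hom_comp t f \<in> I)"

text \<open>
  Saturation with respect to the irrelevant ideal \<open>\<mm> = (x\<^sub>0,\<dots>,x\<^sub>n)\<close>, i.e.
  \<open>(I : \<mm>\<^sup>\<infinity>) = I\<close>; the ideal \<open>\<mm>\<^sup>k\<close> is generated by the forms of degree \<open>k\<close>.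
\<close>

definition is_saturated :: "nat \<Rightarrow> 'a::field mpol set \<Rightarrow> bool" where
  "is_saturated n I \<longleftrightarrow>
     (\<forall>f\<in>poly_ring n. (\<exists>k. \<forall>g\<in>forms n k. g * f \<in> I) \<longrightarrow> f \<in> I)"

text \<open>
  A closed subscheme \<open>X\<close> of \<open>\<P>\<^sup>n\<close> is represented by its saturated defining ideal \<open>I(X)\<close>; this is
  the usual bijection between closed subschemes of \<open>\<P>\<^sup>n\<close> and saturated homogeneous ideals (the
  unit ideal corresponds to the empty subscheme).
\<close>

definition is_scheme :: "nat \<Rightarrow> 'a::field mpol set \<Rightarrow> bool" where
  "is_scheme n I \<longleftrightarrow> is_ideal n I \<and> is_homogeneous I \<and> is_saturated n I"

text \<open>
  The dimension of the quotient \<open>(S/I)\<^sub>t = S\<^sub>t / (I \<inter> S\<^sub>t)\<close>, where \<open>S\<^sub>t\<close> is finite-dimensional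
  (\<open>hilbert_fun_eq_card\<close> below: any basis of \<open>S\<^sub>t\<close> modulo \<open>I\<close> has this cardinality).
\<close>

definition hilbert_fun :: "nat \<Rightarrow> 'a::field mpol set \<Rightarrow> nat \<Rightarrow> nat" where
  "hilbert_fun n I t = mpol.dim (forms n t :: 'a mpol set) - mpol.dim (I \<inter> forms n t)"

context vector_space
begin

lemma card_basis_modulo:
  assumes fin: "finite F" "V \<subseteq> span F"
    and W: "subspace W" "W \<subseteq> V" and V: "subspace V"
    and B: "B \<subseteq> V" "independent B" "span B \<inter> W = {0}"
    and sp: "V \<subseteq> {b + w | b w. b \<in> span B \<and> w \<in> W}"
  shows "dim V - dim W = card B"
proof -
  obtain C where C: "C \<subseteq> W" "independent C" "W \<subseteq> span C" "card C = dim W"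
    by (rule basis_exists)
  have spC: "span C = W"
    using C W span_minimal by blast
  have finBC: "finite B" "finite C"
    using independent_span_bound[OF fin(1), of B] independent_span_bound[OF fin(1), of C]
      B C W fin by auto
  have disj: "B \<inter> C = {}"
  proof (rule ccontr)
    assume "B \<inter> C \<noteq> {}"
    then obtain x where x: "x \<in> B" "x \<in> C" by blast
    then have "x \<in> span B \<inter> W" using C span_base by blast
    then have "x = 0" using B by simp
    then show False using x B dependent_zero by blast
  qed
  have ind: "independent (B \<union> C)"
  proof (rule independent_if_scalars_zero)
    show "finite (B \<union> C)" using finBC by simp
    fix f x
    assume s: "(\<Sum>x\<in>B \<union> C. scale (f x) x) = 0" and x: "x \<in> B \<union> C"
    have e: "(\<Sum>x\<in>B. scale (f x) x) + (\<Sum>x\<in>C. scale (f x) x) = 0"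
      using s sum.union_disjoint[OF finBC disj, of "\<lambda>x. scale (f x) x"] by simp
    have b: "(\<Sum>x\<in>B. scale (f x) x) \<in> span B"
      by (intro span_sum span_scale span_base)
    have c: "(\<Sum>x\<in>C. scale (f x) x) \<in> W"
      unfolding spC [symmetric] by (intro span_sum span_scale span_base)
    have "(\<Sum>x\<in>B. scale (f x) x) = - (\<Sum>x\<in>C. scale (f x) x)"
      using e by (simp add: eq_neg_iff_add_eq_0)
    then have "(\<Sum>x\<in>B. scale (f x) x) \<in> W"
      using c W(1) subspace_neg by metis
    then have z: "(\<Sum>x\<in>B. scale (f x) x) = 0"
      using b B by blast
    then have z': "(\<Sum>x\<in>C. scale (f x) x) = 0"
      using e by simp
    show "f x = 0"
      using x z z' B(2) C(2) finBC independentD by blast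
  qed
  have "V \<subseteq> span (B \<union> C)"
  proof
    fix v assume "v \<in> V"
    then obtain b w where "v = b + w" "b \<in> span B" "w \<in> span C"
      using sp spC by blast
    then show "v \<in> span (B \<union> C)"
      by (metis span_add span_mono subsetD sup_ge1 sup_ge2)
  qed
  then have "card (B \<union> C) = dim V"
    using basis_card_eq_dim[of "B \<union> C" V] B C W ind by blast
  then show ?thesis
    using card_Un_disjoint[OF finBC disj] C(4) by simp
qed

end

lemma single_eq_smult_mpol: "Poly_Mapping.single m c = smult_mpol c (Poly_Mapping.single m 1)"
  by (simp add: smult_mpol_def mult_single)

lemma finite_monomials_degree: "finite {m. Poly_Mapping.keys m \<subseteq> {..n} \<and> mon_deg m = t}"
proof -
  have "inj_on Poly_Mapping.lookup {m :: nat \<Rightarrow>\<^sub>0 nat. Poly_Mapping.keys m \<subseteq> {..n} \<and> mon_deg m = t}"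
    by (rule inj_onI) (rule poly_mapping_eqI, rule fun_cong)
  moreover have "Poly_Mapping.lookup ` {m. Poly_Mapping.keys m \<subseteq> {..n} \<and> mon_deg m = t}
      \<subseteq> {f. \<forall>i. (i \<in> {..n} \<longrightarrow> f i \<in> {..t}) \<and> (i \<notin> {..n} \<longrightarrow> f i = 0)}"
  proof (rule image_subsetI, simp only: mem_Collect_eq, intro conjI allI impI)
    fix m :: "nat \<Rightarrow>\<^sub>0 nat" and i
    assume m: "Poly_Mapping.keys m \<subseteq> {..n} \<and> mon_deg m = t"
    show "Poly_Mapping.lookup m i \<in> {..t}"
    proof (cases "i \<in> Poly_Mapping.keys m")
      case True
      then have "Poly_Mapping.lookup m i \<le> mon_deg m"
        unfolding mon_deg_def by (simp add: member_le_sum)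
      then show ?thesis using m by simp
    next
      case False
      then show ?thesis by (simp add: in_keys_iff)
    qed
    show "Poly_Mapping.lookup m i = 0" if "i \<notin> {..n}"
      using m that by (metis in_keys_iff subsetD)
  qed
  moreover have "finite {f. \<forall>i. (i \<in> {..n} \<longrightarrow> f i \<in> {..t}) \<and> (i \<notin> {..n} \<longrightarrow> f i = (0::nat))}"
    by (rule finite_set_of_finite_funs) auto
  ultimately show ?thesis
    using finite_imageD finite_subset by blast
qed

lemma mpol_sum_monomials:
  "f = (\<Sum>m\<in>Poly_Mapping.keys f. smult_mpol (Poly_Mapping.lookup f m) (Poly_Mapping.single m 1))"
proof (rule poly_mapping_eqI)
  fix k
  show "Poly_Mapping.lookup f k = Poly_Mapping.lookup
    (\<Sum>m\<in>Poly_Mapping.keys f. smult_mpol (Poly_Mapping.lookup f m) (Poly_Mapping.single m 1)) k"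
    by (simp add: single_eq_smult_mpol [symmetric] lookup_sum lookup_single when_def in_keys_iff)
qed

lemma subspace_forms: "mpol.subspace (forms n t)"
proof (rule mpol.subspaceI)
  show "0 \<in> forms n t" by (simp add: forms_def poly_ring_def)
next
  fix f g :: "'a mpol" assume "f \<in> forms n t" "g \<in> forms n t"
  then show "f + g \<in> forms n t"
    using Poly_Mapping.keys_add[of f g] by (simp add: forms_def poly_ring_def) blast
next
  fix c and f :: "'a mpol" assume f: "f \<in> forms n t"
  have "Poly_Mapping.keys (smult_mpol c f) \<subseteq> Poly_Mapping.keys f"
    unfolding smult_mpol_def using keys_mult[of "Poly_Mapping.single 0 c" f]
    by (auto split: if_splits)
  then show "smult_mpol c f \<in> forms n t"
    using f by (auto simp: forms_def poly_ring_def)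
qed

lemma hilbert_fun_eq_card:
  fixes I :: "'a::field mpol set"
  assumes I: "is_ideal n I"
    and B: "B \<subseteq> forms n t" "mpol.independent B" "mpol.span B \<inter> I = {0}"
    and sp: "forms n t \<subseteq> {b + f | b f. b \<in> mpol.span B \<and> f \<in> I \<inter> forms n t}"
  shows "hilbert_fun n I t = card B"
  unfolding hilbert_fun_def
proof (rule mpol.card_basis_modulo)
  let ?M = "{m. Poly_Mapping.keys m \<subseteq> {..n} \<and> mon_deg m = t}"
  show "finite ((\<lambda>m. Poly_Mapping.single m 1 :: 'a mpol) ` ?M)"
    by (simp add: finite_monomials_degree)
  show "forms n t \<subseteq> mpol.span ((\<lambda>m. Poly_Mapping.single m 1 :: 'a mpol) ` ?M)"
  proof
    fix f :: "'a mpol" assume "f \<in> forms n t"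
    then show "f \<in> mpol.span ((\<lambda>m. Poly_Mapping.single m 1 :: 'a mpol) ` ?M)"
      by (subst mpol_sum_monomials[of f], intro mpol.span_sum mpol.span_scale mpol.span_base)
         (auto simp: forms_def poly_ring_def)
  qed
  have "Poly_Mapping.single 0 c \<in> poly_ring n" for c :: 'a
    by (simp add: poly_ring_def)
  then have "mpol.subspace I"
    using I by (auto simp: is_ideal_def smult_mpol_def intro!: mpol.subspaceI)
  then show "mpol.subspace (I \<inter> forms n t)"
    by (rule mpol.subspace_inter[OF _ subspace_forms])
  show "mpol.span B \<inter> (I \<inter> forms n t) = {0}"
    using B(3) mpol.subspace_0[OF subspace_forms] by blast
qed (use B sp subspace_forms in auto)

definition eventually_poly :: "(nat \<Rightarrow> nat) \<Rightarrow> rat poly \<Rightarrow> bool" where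
  "eventually_poly H p \<longleftrightarrow> (\<exists>N. \<forall>t\<ge>N. of_nat (H t) = poly p (of_nat t))"

definition regularity :: "(nat \<Rightarrow> nat) \<Rightarrow> rat poly \<Rightarrow> nat" where
  "regularity H p = (LEAST t. \<forall>t'\<ge>t. of_nat (H t') = poly p (of_nat t'))"

text \<open>In the following the argument \<open>K\<close> of type \<^typ>\<open>'a itself\<close> only fixes the ground field.\<close>

definition admissible :: "'a::field itself \<Rightarrow> rat poly \<Rightarrow> bool" where
  "admissible K p \<longleftrightarrow>
     (\<exists>n (I :: 'a mpol set). is_scheme n I \<and> eventually_poly (hilbert_fun n I) p)"

definition hilbert_funs :: "'a::field itself \<Rightarrow> rat poly \<Rightarrow> nat \<Rightarrow> (nat \<Rightarrow> nat) set" where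
  "hilbert_funs K p \<rho> =
     {hilbert_fun n I | n (I :: 'a mpol set).
        is_scheme n I \<and> eventually_poly (hilbert_fun n I) p \<and> regularity (hilbert_fun n I) p = \<rho>}"

definition min_regularity :: "'a::field itself \<Rightarrow> rat poly \<Rightarrow> nat" where
  "min_regularity K p = (LEAST \<rho>. hilbert_funs K p \<rho> \<noteq> {})"

text \<open>
  The list \<open>ks\<close> is \<open>[k\<^sub>1, \<dots>, k\<^sub>r]\<close>, indexed from \<open>0\<close>, so that its \<open>i\<close>-th entry contributes
  \<open>(z + k - i) choose k\<close>.
\<close>

definition gotzmann_rep :: "rat poly \<Rightarrow> nat list \<Rightarrow> bool" where
  "gotzmann_rep p ks \<longleftrightarrow> sorted_wrt (\<ge>) ks \<and>
     (\<forall>z. poly p z = (\<Sum>i<length ks. (z + of_nat (ks ! i) - of_nat i) gchoose (ks ! i)))"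

definition gotzmann_number :: "rat poly \<Rightarrow> nat" where
  "gotzmann_number p = (THE r. \<exists>ks. gotzmann_rep p ks \<and> length ks = r)"

definition poly_diff :: "rat poly \<Rightarrow> rat poly" where
  "poly_diff p = p - pcompose p [:-1, 1:]"

text \<open>
  \<open>is_binexp t a j k\<close> says that \<open>a = (k t choose t) + \<dots> + (k j choose j)\<close> is the binomial
  expansion of \<open>a\<close> in base \<open>t\<close>; it determines \<open>j\<close> and the values of \<open>k\<close> on \<open>{j..t}\<close>.
\<close>

definition is_binexp :: "nat \<Rightarrow> nat \<Rightarrow> nat \<Rightarrow> (nat \<Rightarrow> nat) \<Rightarrow> bool" where
  "is_binexp t a j k \<longleftrightarrow> 1 \<le> j \<and> j \<le> t \<and> strict_mono_on {j..t} k \<and> j \<le> k j \<and>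
     a = (\<Sum>i=j..t. k i choose i)"

definition binexp_up :: "nat \<Rightarrow> nat \<Rightarrow> nat" where
  "binexp_up t a = (THE b. \<exists>j k. is_binexp t a j k \<and> b = (\<Sum>i=j..t. (k i + 1) choose (i + 1)))"

definition binexp_down :: "nat \<Rightarrow> nat \<Rightarrow> nat" where
  "binexp_down t a = (THE b. \<exists>j k. is_binexp t a j k \<and> b = (\<Sum>i=j..t. (k i - 1) choose (i - 1)))"

text \<open>
  The value \<open>p(t)\<close> of an integer-valued polynomial as a natural number. Negative values become
  \<open>0\<close>; they are excluded in \<open>Pi_set\<close> and do not occur in \<open>f_fun\<close> and \<open>g_fun\<close> for
  \<open>\<rho> > rho p\<close>, nor in \<open>f_fun\<close> for \<open>\<rho> = rho p\<close>.
\<close>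

definition pval :: "rat poly \<Rightarrow> nat \<Rightarrow> nat" where
  "pval p t = nat \<lfloor>poly p (of_nat t)\<rfloor>"

definition Pi_set :: "rat poly \<Rightarrow> nat set" where
  "Pi_set q = {t. 1 \<le> t \<and> t \<le> gotzmann_number q \<and>
     (\<forall>h. pval q (t + h) \<ge> 1 \<and> binexp_up (t + h) (pval q (t + h)) \<ge> pval q (t + h + 1) \<and>
          pval q (t + h + 1) \<ge> 1)}"

definition rho :: "rat poly \<Rightarrow> nat" where
  "rho q = (if Min (Pi_set q) = 1 \<and> poly q 0 = 1 then 0 else Min (Pi_set q))"

function f_fun :: "rat poly \<Rightarrow> nat \<Rightarrow> nat \<Rightarrow> nat" where
  "f_fun p \<rho> t = (if t \<ge> \<rho> then pval p t else binexp_down (t + 1) (f_fun p \<rho> (t + 1)))"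
  by pat_completeness auto
termination by (relation "measure (\<lambda>(p, \<rho>, t). \<rho> - t)") auto

function g_fun :: "rat poly \<Rightarrow> nat \<Rightarrow> nat \<Rightarrow> nat" where
  "g_fun p \<rho> t =
     (if t \<ge> \<rho> then pval p t
      else if t + 1 = \<rho> then pval p t + 1
      else binexp_down (t + 1) (g_fun p \<rho> (t + 1)))"
  by pat_completeness auto
termination by (relation "measure (\<lambda>(p, \<rho>, t). \<rho> - t)") auto

declare f_fun.simps [simp del] g_fun.simps [simp del]

end

theory Submission
  imports Defs "HOL-Library.Multiset_Order"
begin

text \<open>
  A numerical function is the Hilbert function of a nonempty scheme iff it is nondecreasing and its
  first difference is an O-sequence. For necessity, Green's restriction theorem gives Macaulay's
  bound for every homogeneous ideal; it is applied to \<open>I + (l)\<close>, where McCoy's theorem on zero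
  divisors in a polynomial ring provides a linear form \<open>l\<close> that is a nonzerodivisor modulo the
  saturated ideal \<open>I\<close>. For sufficiency, a lexicographic order ideal in \<open>x\<^sub>1, \<dots>, x\<^sub>n\<close> with
  the prescribed first difference is extended by a free variable \<open>x\<^sub>0\<close>.

  Extending \<open>p\<close> downwards by \<open>binexp_down\<close> makes the first difference follow Green's numbers, which
  automatically satisfy Macaulay's bound, and gives the least possible values at each step. Hence
  the only constraints on \<open>\<rho>\<close> are Macaulay's bounds for \<open>p\<close> from \<open>\<rho>\<close> on and for \<open>\<Delta>p\<close> from
  \<open>\<rho> + 1\<close> on, and if any function has regularity \<open>\<rho>\<close> then so has \<open>f\<close> or the function \<open>g\<close>
  exceeding \<open>p\<close> by one at \<open>\<rho> - 1\<close>.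
\<close>

subsection \<open>Macaulay expansions\<close>

text \<open>"Generic" means: for the linear forms \<open>\<Sum>i. u^i x_i\<close> with all but
  finitely many scalars \<open>u\<close>. Coefficients of their products are polynomials in
  \<open>u\<close>, so a rank can drop only at finitely many parameters, and several generic
  conditions are met together by avoiding finite sets. A nonzerodivisor modulo a saturated ideal is
  found in the same way, one degree at a time: McCoy's theorem supplies it over \<open>K[u]\<close>,
  and specialising \<open>u\<close> replaces any recourse to associated primes.

  The function \<open>g\<close> answers a coincidence. The downward extension may meet
  \<open>p\<close> again at \<open>\<rho> - 1\<close>, and then \<open>f\<close> has smaller
  regularity. As \<open>f\<close> is minimal there, any function of regularity exactly
  \<open>\<rho>\<close> must exceed \<open>p\<close> at \<open>\<rho> - 1\<close>, and an excess of
  one is the cheapest.\<close>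

text \<open>
  The expansion \<open>a = (k(t) choose t) + \<dots> + (k(j) choose j)\<close> is encoded by the decreasing list
  \<open>[k(t) - t, \<dots>, k(j) - j]\<close>, which does not change under \<open>binexp_up\<close>.
\<close>

fun mac_val :: "nat \<Rightarrow> nat list \<Rightarrow> nat" where
  "mac_val t [] = 0"
| "mac_val t (k # ks) = ((t + k) choose k) + mac_val (t - 1) ks"

text \<open>The strictly decreasing numerators \<open>k(i)\<close> become weakly decreasing
  differences \<open>k(i) - i\<close>; the length bound says that the last base \<open>j\<close> is
  at least 1.\<close>

definition mac_list :: "nat \<Rightarrow> nat list \<Rightarrow> bool" where
  "mac_list t ks \<longleftrightarrow> sorted_wrt (\<ge>) ks \<and> length ks \<le> t"

lemma mac_list_Nil [simp]: "mac_list t []"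
  by (simp add: mac_list_def)

lemma mac_list_Cons [simp]:
  "mac_list t (k # ks) \<longleftrightarrow> 1 \<le> t \<and> (\<forall>x\<in>set ks. x \<le> k) \<and> mac_list (t - 1) ks"
  by (auto simp: mac_list_def)

lemma mac_list_mono: "mac_list t ks \<Longrightarrow> t \<le> s \<Longrightarrow> mac_list s ks"
  by (auto simp: mac_list_def)

text \<open>For expansions in one base this lexicographic order is the order of the represented
  numbers, so monotonicity of each operator becomes a recursion on lists.\<close>

fun list_less :: "nat list \<Rightarrow> nat list \<Rightarrow> bool" where
  "list_less ks [] \<longleftrightarrow> False"
| "list_less [] (l # ls) \<longleftrightarrow> True"
| "list_less (k # ks) (l # ls) \<longleftrightarrow> k < l \<or> k = l \<and> list_less ks ls"

lemma list_less_linear: "list_less ks ls \<or> ks = ls \<or> list_less ls ks"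
  by (induction ks ls rule: list_less.induct) (auto split: list.splits, metis list.exhaust list_less.simps(2))

declare binomial_Suc_Suc [simp del]

lemma choose_Suc_add: "((t + Suc k) choose Suc k) = ((t + k) choose k) + ((t - 1 + Suc k) choose Suc k)"
  if "1 \<le> t"
  using that by (cases t) (simp_all add: add.commute binomial_Suc_Suc)

text \<open>One entry more is allowed than an expansion in base \<open>t\<close> has, because
  \<open>binexp_down\<close> reads a list for base \<open>t\<close> in base \<open>t - 1\<close>;
  strictness is lost in exchange. By Pascal's rule the head and the bound for the tail add up to the
  bound with the head in place of \<open>k\<close>.\<close>

lemma mac_val_le_choose:
  assumes "sorted_wrt (\<ge>) ks" "length ks \<le> Suc t" "\<forall>x\<in>set ks. x \<le> k"
  shows "mac_val t ks \<le> (t + Suc k) choose Suc k"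
  using assms
proof (induction ks arbitrary: t k)
  case (Cons l ks)
  show ?case
  proof (cases t)
    case 0
    then have "ks = []" using Cons.prems by simp
    then show ?thesis using 0 by simp
  next
    case (Suc s)
    have "mac_val s ks \<le> (s + Suc l) choose Suc l"
      using Cons Suc by simp
    then have "mac_val t (l # ks) \<le> (t + Suc l) choose Suc l"
      using choose_Suc_add[of t l] Suc by simp
    also have "\<dots> = (t + Suc l) choose t"
      by (metis add.commute binomial_symmetric diff_add_inverse le_add1)
    also have "\<dots> \<le> (t + Suc k) choose t"
      using Cons.prems by (intro binomial_right_mono) auto
    also have "\<dots> = (t + Suc k) choose Suc k"
      by (metis add.commute binomial_symmetric diff_add_inverse le_add1)
    finally show ?thesis .
  qed
qed simp

lemma choose_mono_right: "k \<le> l \<Longrightarrow> ((t + k) choose k) \<le> ((t + l) choose l)"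
proof -
  assume "k \<le> l"
  then have "(t + k) choose t \<le> (t + l) choose t" by (intro binomial_right_mono) auto
  then show ?thesis
    by (metis add.commute binomial_symmetric diff_add_inverse le_add1)
qed

lemma mac_val_less_choose:
  assumes "mac_list t ks" "\<forall>x\<in>set ks. x \<le> k"
  shows "mac_val t ks < (t + Suc k) choose Suc k"
  using assms
proof (induction ks arbitrary: t k)
  case Nil
  then show ?case by simp
next
  case (Cons l ks)
  have "mac_val (t - 1) ks < (t - 1 + Suc l) choose Suc l"
    using Cons.prems by (intro Cons.IH) auto
  then have "mac_val t (l # ks) < (t + Suc l) choose Suc l"
    using choose_Suc_add[of t l] Cons.prems by simp
  also have "\<dots> \<le> (t + Suc k) choose Suc k"
    using Cons.prems choose_mono_right[of "Suc l" "Suc k" t] by simp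
  finally show ?case .
qed

lemma mac_val_pos: "ks \<noteq> [] \<Longrightarrow> 0 < mac_val t ks"
  by (cases ks) auto

lemma mac_val_strict_mono:
  "list_less ks ls \<Longrightarrow> mac_list t ks \<Longrightarrow> mac_list t ls \<Longrightarrow> mac_val t ks < mac_val t ls"
proof (induction ks ls arbitrary: t rule: list_less.induct)
  case (2 l ls)
  then show ?case by simp
next
  case (3 k ks l ls)
  show ?case
  proof (cases "k = l")
    case True
    then show ?thesis using 3 by auto
  next
    case False
    then have "k < l" using 3 by simp
    have "mac_val t (k # ks) < (t + Suc k) choose Suc k"
      using 3 mac_val_less_choose[of t "k # ks" k] by auto
    also have "\<dots> \<le> (t + l) choose l"
      using \<open>k < l\<close> by (intro choose_mono_right) auto
    finally show ?thesis by simp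
  qed
qed auto

lemma mac_val_less_iff:
  assumes "mac_list t ks" "mac_list t ls"
  shows "mac_val t ks < mac_val t ls \<longleftrightarrow> list_less ks ls"
  using mac_val_strict_mono[of ks ls t] mac_val_strict_mono[of ls ks t] assms
    list_less_linear[of ks ls] by force

lemma mac_val_inject:
  assumes "mac_list t ks" "mac_list t ls" "mac_val t ks = mac_val t ls"
  shows "ks = ls"
  using mac_val_less_iff[of t ks ls] mac_val_less_iff[of t ls ks] assms list_less_linear[of ks ls]
  by auto

text \<open>In base \<open>t - 1\<close> a list of length \<open>t\<close> ends with a term of base
  0, which is always 1. Distinct lists can therefore have equal values, and the order survives only
  weakly.\<close>

lemma mac_val_down_mono:
  "list_less ks ls \<Longrightarrow> mac_list t ks \<Longrightarrow> mac_list t ls \<Longrightarrow> mac_val (t - 1) ks \<le> mac_val (t - 1) ls"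
proof (induction ks ls arbitrary: t rule: list_less.induct)
  case (2 l ls)
  then show ?case by simp
next
  case (3 k ks l ls)
  show ?case
  proof (cases "k = l")
    case True
    then show ?thesis using 3(1)[of "t - 1"] 3(2-) by auto
  next
    case False
    then have "k < l" using 3 by simp
    have "sorted_wrt (\<ge>) (k # ks)" "length (k # ks) \<le> Suc (t - 1)"
      using 3(3) by (auto simp: mac_list_def)
    then have "mac_val (t - 1) (k # ks) \<le> (t - 1 + Suc k) choose Suc k"
      by (intro mac_val_le_choose) auto
    also have "\<dots> \<le> (t - 1 + l) choose l"
      using \<open>k < l\<close> by (intro choose_mono_right) auto
    finally show ?thesis by simp
  qed
qed auto

text \<open>Greedy choice: after the largest possible head the remainder is below the next binomial,
  which keeps all later entries at most equal to the head.\<close>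

lemma mac_list_exists:
  assumes "1 \<le> t \<or> a = 0"
  shows "\<exists>ks. mac_list t ks \<and> mac_val t ks = a"
  using assms
proof (induction t arbitrary: a)
  case 0
  then show ?case by (intro exI[of _ "[]"]) simp
next
  case (Suc t)
  show ?case
  proof (cases "a = 0")
    case True
    then show ?thesis by (intro exI[of _ "[]"]) simp
  next
    case False
    define P where "P k \<longleftrightarrow> ((Suc t + k) choose k) \<le> a" for k
    have "P 0" using False by (simp add: P_def)
    have bd: "k \<le> a" if "P k" for k
    proof -
      have "k < (Suc t + k) choose k"
      proof (induction k)
        case (Suc k)
        have "0 < (Suc t + k) choose (Suc k)" by (rule zero_less_binomial) simp
        moreover have "(Suc t + Suc k) choose Suc k = ((Suc t + k) choose k) + ((Suc t + k) choose Suc k)"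
          by (simp add: binomial_Suc_Suc)
        ultimately show ?case using Suc by linarith
      qed simp
      then show ?thesis using that by (simp add: P_def)
    qed
    define k where "k = (GREATEST k. P k)"
    have k: "P k" unfolding k_def by (rule GreatestI_nat[of P 0 a]) (use \<open>P 0\<close> bd in auto)
    have "\<not> P (Suc k)"
      using Greatest_le_nat[of P "Suc k" a] bd unfolding k_def[symmetric] by auto
    then have less: "a - ((Suc t + k) choose k) < (t + Suc k) choose Suc k"
      using k choose_Suc_add[of "Suc t" k] by (auto simp: P_def)
    then have "1 \<le> t \<or> a - ((Suc t + k) choose k) = 0"
      by (cases t) auto
    then obtain ks where ks: "mac_list t ks" "mac_val t ks = a - ((Suc t + k) choose k)"
      using Suc.IH by metis
    have "x \<le> k" if x: "x \<in> set ks" for x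
    proof (rule ccontr)
      assume "\<not> x \<le> k"
      then obtain l ls where l: "ks = l # ls" "Suc k \<le> l"
        using x ks(1) by (cases ks) (auto simp: not_le Suc_le_eq intro: less_le_trans)
      then have "(t + Suc k) choose Suc k \<le> mac_val t ks"
        using choose_mono_right[of "Suc k" l t] by simp
      then show False using less ks by simp
    qed
    then show ?thesis
      using ks k by (intro exI[of _ "k # ks"]) (auto simp: P_def)
  qed
qed

text \<open>Unambiguous by \<open>mac_val_inject\<close>. In base 0 only the number 0 has an
  expansion.\<close>

definition mac_seq :: "nat \<Rightarrow> nat \<Rightarrow> nat list" where
  "mac_seq t a = (SOME ks. mac_list t ks \<and> mac_val t ks = a)"

lemma mac_seq:
  assumes "1 \<le> t \<or> a = 0"
  shows "mac_list t (mac_seq t a)" "mac_val t (mac_seq t a) = a"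
  using someI_ex[OF mac_list_exists[OF assms]] by (auto simp: mac_seq_def)

lemma mac_seq_eqI: "mac_list t ks \<Longrightarrow> mac_val t ks = a \<Longrightarrow> mac_seq t a = ks"
  unfolding mac_seq_def by (rule some_equality) (use mac_val_inject in auto)

lemma mac_seq_0 [simp]: "mac_seq t 0 = []"
  by (rule mac_seq_eqI) auto

text \<open>Turns each term \<open>(k(i) choose i)\<close> into \<open>(k(i) - 1 choose i)\<close>,
  which is 0 for an entry 0. In a decreasing list the zeros stand at the end, so dropping them moves
  no other entry to a different base.\<close>

definition dec_list :: "nat list \<Rightarrow> nat list" where
  "dec_list ks = map (\<lambda>k. k - 1) (filter (\<lambda>k. 1 \<le> k) ks)"

lemma dec_list_simps [simp]:
  "dec_list [] = []"
  "dec_list (0 # ks) = dec_list ks"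
  "dec_list (Suc k # ks) = k # dec_list ks"
  by (simp_all add: dec_list_def)

lemma set_dec_list: "x \<in> set (dec_list ks) \<longleftrightarrow> Suc x \<in> set ks"
  by (force simp: dec_list_def image_iff)

lemma dec_list_zeros: "\<forall>x\<in>set ks. x = 0 \<Longrightarrow> dec_list ks = []"
  by (induction ks) auto

lemma mac_list_dec_list: "mac_list t ks \<Longrightarrow> mac_list t (dec_list ks)"
proof (induction ks arbitrary: t)
  case (Cons k ks)
  show ?case
  proof (cases k)
    case 0
    then show ?thesis using Cons.prems dec_list_zeros[of "k # ks"] by simp
  next
    case (Suc l)
    then show ?thesis using Cons by (auto simp: set_dec_list)
  qed
qed simp

section \<open>The operators of Macaulay and Green\<close>

definition mac_up :: "nat \<Rightarrow> nat \<Rightarrow> nat" where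
  "mac_up t a = mac_val (Suc t) (mac_seq t a)"

definition mac_down :: "nat \<Rightarrow> nat \<Rightarrow> nat" where
  "mac_down t a = mac_val (t - 1) (mac_seq t a)"

text \<open>Green's number, the sum of the \<open>(k(i) - 1 choose i)\<close>: it bounds the Hilbert
  function of a generic hyperplane section.\<close>

definition mac_green :: "nat \<Rightarrow> nat \<Rightarrow> nat" where
  "mac_green t a = mac_val t (dec_list (mac_seq t a))"

lemma mac_up_0 [simp]: "mac_up t 0 = 0" and mac_down_0 [simp]: "mac_down t 0 = 0"
  and mac_green_0 [simp]: "mac_green t 0 = 0"
  by (simp_all add: mac_up_def mac_down_def mac_green_def)

lemma mac_up_val: "mac_list t ks \<Longrightarrow> mac_up t (mac_val t ks) = mac_val (Suc t) ks"
  by (simp add: mac_up_def mac_seq_eqI)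

text \<open>Pascal's rule in every term. It is the source of all relations between the three
  operators and of the formula for the difference of a Gotzmann polynomial.\<close>

lemma mac_val_dec_list:
  assumes "mac_list t ks"
  shows "mac_val t ks = mac_val (t - 1) ks + mac_val t (dec_list ks)"
  using assms
proof (induction ks arbitrary: t)
  case (Cons k ks)
  show ?case
  proof (cases k)
    case 0
    then have "\<forall>x\<in>set ks. x = 0" using Cons.prems by simp
    then have "dec_list ks = []" by (rule dec_list_zeros)
    then show ?thesis using Cons 0 by simp
  next
    case (Suc l)
    obtain s where "t = Suc s" using Cons.prems by (cases t) auto
    then show ?thesis using Cons Suc by (simp add: binomial_Suc_Suc)
  qed
qed simp

lemma mac_down_add_green: "1 \<le> t \<Longrightarrow> mac_down t a + mac_green t a = a"
  using mac_val_dec_list[of t "mac_seq t a"] mac_seq[of t a]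
  by (simp add: mac_down_def mac_green_def)

text \<open>\<open>dec_list\<close> does not depend on the base, so Pascal's rule applies to the
  same list in base \<open>Suc t\<close>.\<close>

lemma mac_up_green: "1 \<le> t \<Longrightarrow> mac_up t (mac_green t a) = mac_up t a - a"
proof -
  assume t: "1 \<le> t"
  have "mac_list t (dec_list (mac_seq t a))"
    using t by (intro mac_list_dec_list mac_seq) simp
  then have "mac_up t (mac_green t a) = mac_val (Suc t) (dec_list (mac_seq t a))"
    by (simp add: mac_green_def mac_up_val)
  moreover have "mac_list (Suc t) (mac_seq t a)"
    using t by (intro mac_list_mono[OF mac_seq(1)]) simp_all
  ultimately show ?thesis
    using mac_val_dec_list[of "Suc t" "mac_seq t a"] mac_seq(2)[of t a] t
    by (simp add: mac_up_def)
qed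

lemma list_less_mac_seq_iff:
  "1 \<le> t \<Longrightarrow> list_less (mac_seq t a) (mac_seq t b) \<longleftrightarrow> a < b"
  using mac_val_less_iff[of t "mac_seq t a" "mac_seq t b"] mac_seq[of t] by simp

lemma mac_up_strict_mono: "1 \<le> t \<Longrightarrow> a < b \<Longrightarrow> mac_up t a < mac_up t b"
  unfolding mac_up_def
  by (rule mac_val_strict_mono) (auto simp: list_less_mac_seq_iff intro: mac_list_mono[OF mac_seq(1)])

lemma mac_up_mono: "1 \<le> t \<Longrightarrow> a \<le> b \<Longrightarrow> mac_up t a \<le> mac_up t b"
  using mac_up_strict_mono[of t a b] by (cases "a = b") auto

lemma mac_down_mono: "1 \<le> t \<Longrightarrow> a \<le> b \<Longrightarrow> mac_down t a \<le> mac_down t b"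
  unfolding mac_down_def
  by (cases "a = b")
     (simp, rule mac_val_down_mono, auto simp: list_less_mac_seq_iff mac_seq)

lemma list_less_dec_list:
  "list_less ks ls \<Longrightarrow> sorted_wrt (\<ge>) ks \<Longrightarrow> sorted_wrt (\<ge>) ls \<Longrightarrow>
     dec_list ks = dec_list ls \<or> list_less (dec_list ks) (dec_list ls)"
proof (induction ks ls rule: list_less.induct)
  case (2 l ls)
  show ?case by (cases "dec_list (l # ls)") auto
next
  case (3 k ks l ls)
  show ?case
  proof (cases "k = l")
    case True
    then show ?thesis using 3 by (cases k) auto
  next
    case False
    then have "k < l" using 3 by simp
    show ?thesis
    proof (cases k)
      case 0
      then have "dec_list (k # ks) = []" using 3 by (intro dec_list_zeros) auto
      then show ?thesis using \<open>k < l\<close> by (cases l) auto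
    next
      case (Suc k')
      then show ?thesis using \<open>k < l\<close> by (cases l) auto
    qed
  qed
qed auto

lemma mac_green_mono:
  assumes t: "1 \<le> t" and "a \<le> b"
  shows "mac_green t a \<le> mac_green t b"
proof (cases "a = b")
  case False
  have l: "mac_list t (mac_seq t a)" "mac_list t (mac_seq t b)"
    using t by (simp_all add: mac_seq)
  have "list_less (mac_seq t a) (mac_seq t b)"
    using t assms False by (simp add: list_less_mac_seq_iff)
  then have "dec_list (mac_seq t a) = dec_list (mac_seq t b) \<or>
      list_less (dec_list (mac_seq t a)) (dec_list (mac_seq t b))"
    using l by (intro list_less_dec_list) (auto simp: mac_list_def)
  then show ?thesis
    using l mac_list_dec_list mac_val_strict_mono unfolding mac_green_def
    by (metis less_imp_le order_refl)
qed simp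

lemma mac_down_up: "1 \<le> t \<Longrightarrow> mac_down (Suc t) (mac_up t a) = a"
proof -
  assume t: "1 \<le> t"
  have "mac_seq (Suc t) (mac_up t a) = mac_seq t a"
    by (rule mac_seq_eqI) (use t in \<open>auto simp: mac_up_def intro: mac_list_mono[OF mac_seq(1)]\<close>)
  then show ?thesis using t by (simp add: mac_down_def mac_seq)
qed

text \<open>A list of full length \<open>Suc t\<close> is no expansion in base \<open>t\<close>, as
  its last term gets base 0. Either the tail, read one base lower, reaches the next binomial and
  merges with the head into the single entry \<open>Suc k\<close>, or the tail is expanded anew and
  the induction hypothesis compares the two tails.\<close>

lemma mac_up_down_list:
  assumes "mac_list (Suc t) ks" "1 \<le> t"
  shows "mac_val (Suc t) ks \<le> mac_up t (mac_val t ks)"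
  using assms
proof (induction ks arbitrary: t)
  case (Cons k ks)
  show ?case
  proof (cases "length (k # ks) \<le> t")
    case True
    then have "mac_list t (k # ks)" using Cons.prems by (simp only: mac_list_def)
    then show ?thesis by (simp only: mac_up_val)
  next
    case False
    then have len: "length (k # ks) = Suc t" using Cons.prems by (auto simp: mac_list_def)
    obtain s where s: "t = Suc s" using Cons.prems by (cases t) auto
    have sortd: "sorted_wrt (\<ge>) (k # ks)" using Cons.prems(1) by (simp only: mac_list_def)
    then have srt: "sorted_wrt (\<ge>) ks" "\<forall>x\<in>set ks. x \<le> k" by auto
    have ub: "mac_val s ks \<le> (s + Suc k) choose Suc k"
      using srt len s by (intro mac_val_le_choose) auto
    show ?thesis
    proof (cases "mac_val s ks = (s + Suc k) choose Suc k")
      case True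
      then have "mac_val t (k # ks) = mac_val t [Suc k]"
        using choose_Suc_add[of t k] s by simp
      then have "mac_up t (mac_val t (k # ks)) = mac_val (Suc t) [Suc k]"
        using mac_up_val[of t "[Suc k]"] s by simp
      also have "\<dots> = ((Suc t + k) choose k) + ((t + Suc k) choose Suc k)"
        using choose_Suc_add[of "Suc t" k] by simp
      finally have *: "mac_up t (mac_val t (k # ks)) = ((Suc t + k) choose k) + ((t + Suc k) choose Suc k)" .
      have "mac_list t ks" using srt len by (simp add: mac_list_def)
      then have "mac_val t ks < (t + Suc k) choose Suc k"
        using srt by (intro mac_val_less_choose) auto
      then show ?thesis using * by simp
    next
      case False
      then have less: "mac_val s ks < (s + Suc k) choose Suc k" using ub by simp
      have s1: "1 \<le> s"
      proof (rule ccontr)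
        assume "\<not> 1 \<le> s"
        then have "s = 0" by simp
        then have "mac_val s ks = 0" using less by simp
        then show False using mac_val_pos[of ks s] len s by (cases ks) auto
      qed
      define ls where "ls = mac_seq s (mac_val s ks)"
      have ls: "mac_list s ls" "mac_val s ls = mac_val s ks"
        using s1 by (simp_all add: ls_def mac_seq)
      have le: "x \<le> k" if x: "x \<in> set ls" for x
      proof (rule ccontr)
        assume "\<not> x \<le> k"
        then obtain m ms where m: "ls = m # ms" "Suc k \<le> m"
          using x ls(1) by (cases ls) (auto simp: not_le Suc_le_eq intro: less_le_trans)
        then have "(s + Suc k) choose Suc k \<le> mac_val s ls"
          using choose_mono_right[of "Suc k" m s] by simp
        then show False using less ls by simp
      qed
      have ml: "mac_list t (k # ls)" using ls le s by simp
      have "mac_val t (k # ks) = mac_val t (k # ls)" using ls s by simp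
      then have "mac_up t (mac_val t (k # ks)) = mac_val (Suc t) (k # ls)"
        using mac_up_val[OF ml] by (simp only:)
      also have "\<dots> = ((Suc t + k) choose k) + mac_up s (mac_val s ks)"
        using ls s mac_up_val[of s ls] by simp
      also have "\<dots> \<ge> ((Suc t + k) choose k) + mac_val (Suc s) ks"
        using Cons.IH[of s] Cons.prems s s1 by simp
      finally show ?thesis using s by simp
    qed
  qed
qed simp

text \<open>A Galois connection: \<open>mac_down\<close> of a value is the least preceding value
  compatible with Macaulay's bound. This is what makes descending extensions minimal.\<close>

lemma mac_down_le_iff:
  assumes "1 \<le> t"
  shows "mac_down (Suc t) a \<le> x \<longleftrightarrow> a \<le> mac_up t x"
proof
  assume x: "mac_down (Suc t) a \<le> x"
  have "a \<le> mac_up t (mac_down (Suc t) a)"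
    using mac_up_down_list[of t "mac_seq (Suc t) a"] mac_seq[of "Suc t" a] assms
    by (simp add: mac_down_def)
  then show "a \<le> mac_up t x"
    using mac_up_mono[OF assms x] by simp
next
  assume "a \<le> mac_up t x"
  then have "mac_down (Suc t) a \<le> mac_down (Suc t) (mac_up t x)"
    by (intro mac_down_mono) auto
  then show "mac_down (Suc t) a \<le> x"
    using mac_down_up[OF assms] by simp
qed

text \<open>The hypothesis on \<open>e\<close> is what the exact sequences in Green's argument yield.\<close>

lemma green_recursion:
  assumes "2 \<le> d" "e \<le> c" and le: "e \<le> mac_green (d - 1) (c - e) + mac_green d e"
  shows "e \<le> mac_green d c"
proof (rule ccontr)
  assume "\<not> e \<le> mac_green d c"
  then have gt: "Suc (mac_green d c) \<le> e" by simp
  define s where "s = d - 1"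
  have s: "1 \<le> s" "d = Suc s" using assms(1) by (auto simp: s_def)
  have c: "mac_down d c + mac_green d c = c"
    using s by (intro mac_down_add_green) simp
  have e: "mac_down d e + mac_green d e = e"
    using s by (intro mac_down_add_green) simp
  \<comment> \<open>One below the Galois threshold: \<open>c \<le> mac_up s y\<close> just fails,
    while \<open>c - e \<le> y\<close> because \<open>e\<close> exceeds Green's number of
    \<open>c\<close>.\<close>
  define y where "y = mac_down d c - 1"
  have dpos: "0 < mac_down d c" using gt c assms(2) by linarith
  have y: "c - e \<le> y" using gt c assms(2) by (simp add: y_def)
  have "\<not> mac_down d c \<le> y" using dpos by (simp add: y_def)
  then have "\<not> c \<le> mac_up s y" using mac_down_le_iff[OF s(1), of c y] s by simp
  \<comment> \<open>The left side is \<open>mac_up s y - y\<close>, at most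
    \<open>c - 1 - y\<close>, which is \<open>mac_green d c\<close>.\<close>
  then have "mac_up s (mac_green s y) \<le> mac_green d c"
    using mac_up_green[OF s(1), of y] c dpos by (simp add: y_def)
  then have "\<not> e \<le> mac_up s (mac_green s y)" using gt by simp
  then have "\<not> mac_down d e \<le> mac_green s y"
    using mac_down_le_iff[OF s(1), of e "mac_green s y"] s by simp
  moreover have "mac_green s (c - e) \<le> mac_green s y"
    using y s by (intro mac_green_mono)
  ultimately show False using le e s_def by simp
qed

section \<open>Translation between lists and binomial expansions\<close>

lemma strict_mono_on_ge_diff:
  fixes k :: "nat \<Rightarrow> nat"
  assumes "strict_mono_on {j..t} k" "j \<le> k j" "i \<in> {j..t}"
  shows "i \<le> k i"
proof -
  have "j \<le> i" "i \<le> t" using assms(3) by auto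
  then show ?thesis
  proof (induction i rule: dec_induct)
    case (step i)
    then have "k i < k (Suc i)" using assms(1) by (auto simp: strict_mono_on_def)
    then show ?case using step by simp
  qed (use assms in auto)
qed

text \<open>The shift \<open>c\<close> takes the values \<open>0\<close>, \<open>1\<close>, \<open>2\<close> for \<open>binexp_down\<close>, the number itself, and \<open>binexp_up\<close>.\<close>

lemma mac_list_of_binexp:
  assumes "1 \<le> j" "j \<le> t" "strict_mono_on {j..t} k" "j \<le> k j"
  shows "mac_list t (map (\<lambda>i. k i - i) (rev [j..<Suc t]))"
    and "mac_val (t + c - 1) (map (\<lambda>i. k i - i) (rev [j..<Suc t])) =
         (\<Sum>i=j..t. (k i + c - 1) choose (i + c - 1))"
proof -
  have sub: "strict_mono_on {j..s} k" if "s \<le> t" for s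
    using assms(3) that by (auto simp: strict_mono_on_def)
  have ch: "((i + c - 1) + (K - i)) choose (K - i) = (K + c - 1) choose (i + c - 1)"
    if "1 \<le> i" "i \<le> K" for i K
    using that binomial_symmetric[of "K - i" "K + c - 1"] by (simp add: algebra_simps)
  have "\<And>i. j \<le> i \<Longrightarrow> i \<le> t \<Longrightarrow> i \<le> k i"
    using strict_mono_on_ge_diff[OF assms(3,4)] by auto
  note ge = this
  have *: "s \<le> t \<Longrightarrow> mac_list s (map (\<lambda>i. k i - i) (rev [j..<Suc s])) \<and>
        (\<forall>x\<in>set (map (\<lambda>i. k i - i) (rev [j..<Suc s])). x \<le> k s - s) \<and>
        mac_val (s + c - 1) (map (\<lambda>i. k i - i) (rev [j..<Suc s])) =
         (\<Sum>i=j..s. (k i + c - 1) choose (i + c - 1))" if "j \<le> s" for s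
    using that
  proof (induction s rule: dec_induct)
    case base
    have "[j..<Suc j] = [j]" by simp
    then show ?case using assms(1) ge[of j] assms(2) ch[of j "k j"] by simp
  next
    case (step s)
    have up: "[j..<Suc (Suc s)] = [j..<Suc s] @ [Suc s]"
      using step by simp
    have "k s < k (Suc s)" using step assms(3) by (auto simp: strict_mono_on_def)
    then have le: "k s - s \<le> k (Suc s) - Suc s" using ge[of s] step by simp
    have IH: "mac_list s (map (\<lambda>i. k i - i) (rev [j..<Suc s]))"
        "\<forall>x\<in>set (map (\<lambda>i. k i - i) (rev [j..<Suc s])). x \<le> k s - s"
        "mac_val (s + c - 1) (map (\<lambda>i. k i - i) (rev [j..<Suc s])) =
         (\<Sum>i=j..s. (k i + c - 1) choose (i + c - 1))"
      using step.IH[OF Suc_leD[OF step.prems]] by blast+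
    have l: "map (\<lambda>i. k i - i) (rev [j..<Suc (Suc s)]) =
       (k (Suc s) - Suc s) # map (\<lambda>i. k i - i) (rev [j..<Suc s])"
      unfolding up by simp
    have 2: "\<forall>x\<in>set (map (\<lambda>i. k i - i) (rev [j..<Suc s])). x \<le> k (Suc s) - Suc s"
      using IH(2) le by (meson le_trans)
    have 3: "(\<Sum>i=j..Suc s. (k i + c - 1) choose (i + c - 1)) =
        (k (Suc s) + c - 1 choose (Suc s + c - 1)) + (\<Sum>i=j..s. (k i + c - 1) choose (i + c - 1))"
      using step.hyps by (simp add: sum.nat_ivl_Suc')
    have 4: "(Suc s + c - 1) + (k (Suc s) - Suc s) choose (k (Suc s) - Suc s) =
        k (Suc s) + c - 1 choose (Suc s + c - 1)"
      using ch[of "Suc s" "k (Suc s)"] ge[of "Suc s"] step by simp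
    have 5: "Suc s + c - 1 - 1 = s + c - 1" using step.hyps assms(1) by simp
    show ?case
      unfolding l 3 mac_val.simps 4 5 IH(3) mac_list_Cons
      using IH(1) 2 by simp
  qed
  show "mac_list t (map (\<lambda>i. k i - i) (rev [j..<Suc t]))"
    "mac_val (t + c - 1) (map (\<lambda>i. k i - i) (rev [j..<Suc t])) =
         (\<Sum>i=j..t. (k i + c - 1) choose (i + c - 1))"
    using *[OF assms(2)] by auto
qed

lemma is_binexp_mac_seq:
  assumes "is_binexp t a j k"
  shows "mac_up t a = (\<Sum>i=j..t. (k i + 1) choose (i + 1))"
    and "mac_down t a = (\<Sum>i=j..t. (k i - 1) choose (i - 1))"
proof -
  let ?ks = "map (\<lambda>i. k i - i) (rev [j..<Suc t])"
  have h: "1 \<le> j" "j \<le> t" "strict_mono_on {j..t} k" "j \<le> k j"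
    "a = (\<Sum>i=j..t. k i choose i)"
    using assms by (auto simp: is_binexp_def)
  note m = mac_list_of_binexp[OF h(1-4)]
  have "mac_seq t a = ?ks"
    using m(1) m(2)[of 1] h(5) by (intro mac_seq_eqI) simp_all
  then show "mac_up t a = (\<Sum>i=j..t. (k i + 1) choose (i + 1))"
    "mac_down t a = (\<Sum>i=j..t. (k i - 1) choose (i - 1))"
    using m(2)[of 2] m(2)[of 0] by (simp_all add: mac_up_def mac_down_def)
qed

lemma is_binexp_exists:
  assumes "1 \<le> a" "1 \<le> t"
  shows "\<exists>j k. is_binexp t a j k"
proof -
  define ks where "ks = mac_seq t a"
  have ks: "mac_list t ks" "mac_val t ks = a" "ks \<noteq> []"
    using mac_seq[of t a] assms by (auto simp: ks_def)
  then have srt: "sorted_wrt (\<ge>) ks" and len: "length ks \<le> t" "1 \<le> length ks"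
    by (auto simp: mac_list_def Suc_le_eq)
  \<comment> \<open>The entry at position \<open>n\<close> belongs to base \<open>t - n\<close>,
    which determines both the last base \<open>j\<close> and the numerators.\<close>
  define j where "j = t - length ks + 1"
  define k where "k i = ks ! (t - i) + i" for i
  have j: "1 \<le> j" "j \<le> t" using len by (auto simp: j_def)
  have sm: "strict_mono_on {j..t} k"
  proof (rule strict_mono_onI)
    fix r s assume rs: "r \<in> {j..t}" "s \<in> {j..t}" "r < s"
    then have "ks ! (t - r) \<le> ks ! (t - s)"
      using sorted_wrt_nth_less[OF srt, of "t - s" "t - r"] by (auto simp: j_def)
    then show "k r < k s" using rs by (simp add: k_def)
  qed
  have len': "Suc t - j = length ks" using len by (simp add: j_def)
  have "map (\<lambda>i. k i - i) (rev [j..<Suc t]) = ks"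
  proof (rule nth_equalityI)
    show "length (map (\<lambda>i. k i - i) (rev [j..<Suc t])) = length ks"
      using len' by (simp del: upt_Suc)
    fix i assume "i < length (map (\<lambda>i. k i - i) (rev [j..<Suc t]))"
    then have i: "i < length ks" using len' by (simp del: upt_Suc)
    then have "rev [j..<Suc t] ! i = t - i"
      using len len' by (simp add: rev_nth j_def del: upt_Suc)
    then show "map (\<lambda>i. k i - i) (rev [j..<Suc t]) ! i = ks ! i"
      using i len len' by (simp add: k_def del: upt_Suc)
  qed
  then have "a = (\<Sum>i=j..t. k i choose i)"
    using mac_list_of_binexp(2)[OF j sm, of 1] ks by (simp add: k_def)
  then show ?thesis
    using j sm by (intro exI[of _ j] exI[of _ k]) (auto simp: is_binexp_def k_def)
qed

lemma binexp_up_eq: "1 \<le> a \<Longrightarrow> 1 \<le> t \<Longrightarrow> binexp_up t a = mac_up t a"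
proof -
  assume "1 \<le> a" "1 \<le> t"
  then obtain j k where "is_binexp t a j k" using is_binexp_exists by blast
  then show ?thesis
    unfolding binexp_up_def by (intro the_equality) (metis is_binexp_mac_seq(1))+
qed

lemma binexp_down_eq: "1 \<le> a \<Longrightarrow> 1 \<le> t \<Longrightarrow> binexp_down t a = mac_down t a"
proof -
  assume "1 \<le> a" "1 \<le> t"
  then obtain j k where "is_binexp t a j k" using is_binexp_exists by blast
  then show ?thesis
    unfolding binexp_down_def by (intro the_equality) (metis is_binexp_mac_seq(2))+
qed

subsection \<open>Gotzmann representations\<close>

lemma poly_eq_if_eventually:
  fixes p q :: "rat poly"
  assumes "\<And>t. N \<le> t \<Longrightarrow> poly p (of_nat t) = poly q (of_nat t)"
  shows "p = q"
proof (rule ccontr)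
  assume "p \<noteq> q"
  then have "finite {x. poly (p - q) x = 0}" by (intro poly_roots_finite) simp
  moreover have "of_nat ` {N..} \<subseteq> {x. poly (p - q) x = 0}" using assms by auto
  ultimately have "finite ((of_nat :: nat \<Rightarrow> rat) ` {N..})" by (rule finite_subset[rotated])
  then have "finite {N..}" by (rule finite_imageD) (simp add: inj_on_def)
  then show False by (simp add: infinite_Ici)
qed

lemma gbinomial_poly_exists: "\<exists>q :: rat poly. \<forall>z. poly q z = (z + c) gchoose k"
proof
  show "\<forall>z. poly (smult (1 / fact k) (\<Prod>i=0..<k. [:c - of_nat i, 1:])) z = (z + c) gchoose k"
    by (simp add: gbinomial_prod_rev poly_prod algebra_simps)
qed

lemma gotzmann_sum_nat:
  "length ks \<le> t \<Longrightarrow>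
    (\<Sum>i<length ks. ((of_nat t :: rat) + of_nat (ks ! i) - of_nat i) gchoose (ks ! i)) = of_nat (mac_val t ks)"
proof (induction ks arbitrary: t)
  case (Cons k ks)
  obtain s where s: "t = Suc s" using Cons.prems by (cases t) auto
  have "(\<Sum>i<length (k # ks). ((of_nat t :: rat) + of_nat ((k # ks) ! i) - of_nat i) gchoose ((k # ks) ! i))
      = (((of_nat t :: rat) + of_nat k) gchoose k) +
        (\<Sum>i<length ks. ((of_nat s :: rat) + of_nat (ks ! i) - of_nat i) gchoose (ks ! i))"
    unfolding s by (simp add: sum.lessThan_Suc_shift algebra_simps del: sum.lessThan_Suc)
  also have "\<dots> = of_nat ((t + k) choose k) + of_nat (mac_val s ks)"
    using Cons.IH[of s] Cons.prems s by (simp add: binomial_gbinomial add.assoc)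
  finally show ?case using s by simp
qed simp

lemma gotzmann_rep_poly:
  "gotzmann_rep p ks \<Longrightarrow> length ks \<le> t \<Longrightarrow> poly p (of_nat t) = of_nat (mac_val t ks)"
  by (simp add: gotzmann_rep_def gotzmann_sum_nat)

text \<open>The representation is demanded at every rational \<open>z\<close>. Both sides are
  polynomials in \<open>z\<close>, so their values at large integers decide.\<close>

lemma gotzmann_repI:
  assumes srt: "sorted_wrt (\<ge>) ks"
    and ev: "\<And>t. N \<le> t \<Longrightarrow> poly p (of_nat t) = of_nat (mac_val t ks)"
  shows "gotzmann_rep p ks"
proof -
  have "\<exists>q :: rat poly. \<forall>z. poly q z = (z + (of_nat (ks ! i) - of_nat i)) gchoose (ks ! i)" for i
    by (rule gbinomial_poly_exists)
  then obtain q :: "nat \<Rightarrow> rat poly"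
    where q: "\<And>i z. poly (q i) z = (z + (of_nat (ks ! i) - of_nat i)) gchoose (ks ! i)"
    by metis
  have "p = (\<Sum>i<length ks. q i)"
  proof (rule poly_eq_if_eventually[of "max N (length ks)"])
    fix t assume "max N (length ks) \<le> t"
    then show "poly p (of_nat t) = poly (\<Sum>i<length ks. q i) (of_nat t)"
      using ev[of t] gotzmann_sum_nat[of ks t] by (simp add: poly_sum q add_diff_eq)
  qed
  then show ?thesis
    using srt by (simp add: gotzmann_rep_def poly_sum q add_diff_eq)
qed

text \<open>At any integer beyond both lengths the two lists are expansions of the same
  number.\<close>

lemma gotzmann_rep_unique:
  assumes "gotzmann_rep p ks" "gotzmann_rep p ls"
  shows "ks = ls"
proof -
  define t where "t = max (length ks) (length ls)"
  have "(of_nat (mac_val t ks) :: rat) = of_nat (mac_val t ls)"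
    using gotzmann_rep_poly[OF assms(1), of t] gotzmann_rep_poly[OF assms(2), of t]
    by (simp add: t_def)
  then show ?thesis
    using assms by (intro mac_val_inject[of t]) (auto simp: mac_list_def t_def gotzmann_rep_def)
qed

lemma gotzmann_number_eq: "gotzmann_rep p ks \<Longrightarrow> gotzmann_number p = length ks"
  unfolding gotzmann_number_def by (rule the_equality) (auto dest: gotzmann_rep_unique)

text \<open>Lexicographic order on lists of unbounded length is not well-founded in general. On
  decreasing lists it embeds into the multiset order: the first differing entry of the larger list
  exceeds everything that remains in the smaller one.\<close>

lemma mset_less_if_list_less:
  "list_less ks ls \<Longrightarrow> sorted_wrt (\<ge>) ks \<Longrightarrow> sorted_wrt (\<ge>) ls \<Longrightarrow> mset ks < mset ls"
proof (induction ks ls rule: list_less.induct)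
  case (2 l ls)
  then show ?case by simp
next
  case (3 k ks l ls)
  show ?case
  proof (cases "k = l")
    case True
    then show ?thesis using 3 by simp
  next
    case False
    then show ?thesis
      using 3 by (intro ex_gt_imp_less_multiset) (auto intro!: exI[of _ l] intro: le_less_trans)
  qed
qed auto

text \<open>
  Macaulay's bound makes the multisets of the expansions descend, so they stabilise since the
  multiset order is well-founded.
\<close>

lemma gotzmann_rep_exists:
  assumes up: "\<And>t. 1 \<le> t \<Longrightarrow> f (Suc t) \<le> mac_up t (f t)"
    and ev: "\<And>t. N \<le> t \<Longrightarrow> poly p (of_nat t) = of_nat (f t)"
  shows "\<exists>ks. gotzmann_rep p ks"
proof -
  define Q where "Q M \<longleftrightarrow> (\<exists>t\<ge>1. M = mset (mac_seq t (f t)))" for M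
  have "Q (mset (mac_seq 1 (f 1)))" by (auto simp: Q_def)
  then have "Q (LEAST M. Q M)" by (rule LeastI)
  then obtain s where s: "1 \<le> s" "(LEAST M. Q M) = mset (mac_seq s (f s))" by (auto simp: Q_def)
  define ks where "ks = mac_seq s (f s)"
  have srt: "sorted_wrt (\<ge>) ks" using mac_seq(1)[of s "f s"] s by (simp add: ks_def mac_list_def)
  have st: "mac_list t ks \<and> mac_val t ks = f t" if "s \<le> t" for t
    using that
  proof (induction t rule: dec_induct)
    case base
    then show ?case using s by (simp add: ks_def mac_seq)
  next
    case (step t)
    have t: "1 \<le> t" using s step by simp
    have l: "mac_list (Suc t) ks" using step by (auto intro: mac_list_mono[of t])
    let ?ls = "mac_seq (Suc t) (f (Suc t))"
    have ls: "mac_list (Suc t) ?ls" "mac_val (Suc t) ?ls = f (Suc t)" by (auto simp: mac_seq)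
    have "f (Suc t) \<le> mac_val (Suc t) ks"
      using up[OF t] step mac_up_val[of t ks] by simp
    \<comment> \<open>Macaulay's bound gives one inequality; a strict drop would produce a multiset
      below the least one.\<close>
    moreover have "\<not> f (Suc t) < mac_val (Suc t) ks"
    proof
      assume "f (Suc t) < mac_val (Suc t) ks"
      then have "list_less ?ls ks"
        using mac_val_less_iff[OF ls(1) l] ls(2) by simp
      then have "mset ?ls < (LEAST M. Q M)"
        using srt ls s unfolding ks_def[symmetric]
        by (auto intro!: mset_less_if_list_less simp: mac_list_def)
      moreover have "Q (mset ?ls)" by (auto simp: Q_def)
      ultimately show False using not_less_Least by blast
    qed
    ultimately show ?case using l by simp
  qed
  have "gotzmann_rep p ks"
    by (rule gotzmann_repI[of _ "max N s"]) (use srt ev st in auto)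
  then show ?thesis by blast
qed

text \<open>By Pascal's rule at large integers, taking differences lowers each \<open>k\<close> by
  one and deletes the constant summands.\<close>

lemma gotzmann_rep_poly_diff:
  assumes "gotzmann_rep p ks"
  shows "gotzmann_rep (poly_diff p) (dec_list ks)"
proof (rule gotzmann_repI[of _ "Suc (length ks)"])
  have srt: "sorted_wrt (\<ge>) ks" using assms by (simp add: gotzmann_rep_def)
  then show "sorted_wrt (\<ge>) (dec_list ks)"
    using mac_list_dec_list[of "length ks" ks] by (simp add: mac_list_def)
  fix t assume t: "Suc (length ks) \<le> t"
  have 1: "(-1 + of_nat t :: rat) = of_nat (t - 1)" using t by (simp add: of_nat_diff)
  have "mac_list t ks" using srt t by (simp add: mac_list_def)
  then have "mac_val t ks = mac_val (t - 1) ks + mac_val t (dec_list ks)"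
    by (rule mac_val_dec_list)
  moreover have "poly (poly_diff p) (of_nat t) = of_nat (mac_val t ks) - of_nat (mac_val (t - 1) ks)"
    using gotzmann_rep_poly[OF assms, of t] gotzmann_rep_poly[OF assms, of "t - 1"] t 1
    by (simp add: poly_diff_def poly_pcompose)
  ultimately show "poly (poly_diff p) (of_nat t) = of_nat (mac_val t (dec_list ks))"
    by simp
qed

subsection \<open>Dimensions in a vector space\<close>

text \<open>The space of all polynomials is infinite-dimensional, so finiteness has to be tracked
  for each subset whose dimension is compared.\<close>

definition (in vector_space) fin_dim :: "'b set \<Rightarrow> bool" where
  "fin_dim V \<longleftrightarrow> (\<exists>F. finite F \<and> V \<subseteq> span F)"

context vector_space
begin

lemma fin_dim_subset: "fin_dim V \<Longrightarrow> W \<subseteq> V \<Longrightarrow> fin_dim W"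
  unfolding fin_dim_def by blast

lemma fin_dim_independent:
  fixes V B :: "'b set"
  assumes "fin_dim V" "B \<subseteq> V" "independent B"
  shows "finite B" "card B \<le> dim V"
proof -
  obtain C where C: "C \<subseteq> V" "independent C" "V \<subseteq> span C" "card C = dim V"
    by (rule basis_exists)
  obtain F where F: "finite F" "V \<subseteq> span F"
    using assms(1) by (auto simp: fin_dim_def)
  have "finite C"
    using independent_span_bound[OF F(1) C(2)] C(1) F(2) by auto
  then show "finite B" "card B \<le> dim V"
    using independent_span_bound[of C B] C assms by auto
qed

lemma dim_subset_fin_dim:
  assumes "fin_dim V" "W \<subseteq> V"
  shows "dim W \<le> dim V"
proof -
  obtain C where "C \<subseteq> W" "independent C" "card C = dim W"
    by (rule basis_exists)
  then show ?thesis using fin_dim_independent[OF assms(1), of C] assms(2) by auto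
qed

text \<open>The vectors that extend a basis of \<open>W\<close> to one of \<open>V\<close>. The
  conclusion has the form of the hypotheses of \<open>card_basis_modulo\<close>.\<close>

lemma complement_exists:
  assumes "subspace W" "W \<subseteq> V" "subspace V"
  obtains B where "B \<subseteq> V" "independent B" "span B \<inter> W = {0}"
    "V \<subseteq> {b + w | b w. b \<in> span B \<and> w \<in> W}"
proof -
  obtain C where C: "C \<subseteq> W" "independent C" "W \<subseteq> span C" "card C = dim W"
    by (rule basis_exists)
  have spC: "span C = W" using C assms(1) span_minimal by blast
  obtain D where D: "C \<subseteq> D" "D \<subseteq> V" "independent D" "V \<subseteq> span D"
    using maximal_independent_subset_extend[of C V] C assms(2) by blast
  define B where "B = D - C"
  have "x = 0" if xB: "x \<in> span B" and xC: "x \<in> span C" for x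
  proof -
    obtain T r where T: "finite T" "T \<subseteq> B" "x = (\<Sum>a\<in>T. r a *s a)"
      using xB unfolding span_explicit by blast
    obtain U s where U: "finite U" "U \<subseteq> C" "x = (\<Sum>a\<in>U. s a *s a)"
      using xC unfolding span_explicit by blast
    have disj: "T \<inter> U = {}" using T U by (auto simp: B_def)
    define q where "q a = (if a \<in> T then r a else - s a)" for a
    have "(\<Sum>a\<in>T \<union> U. q a *s a) = (\<Sum>a\<in>T. q a *s a) + (\<Sum>a\<in>U. q a *s a)"
      using T U disj by (intro sum.union_disjoint)
    also have "(\<Sum>a\<in>T. q a *s a) = x" using T by (simp add: q_def)
    also have "(\<Sum>a\<in>U. q a *s a) = (\<Sum>a\<in>U. - (s a *s a))"
      using disj by (intro sum.cong) (auto simp: q_def)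
    also have "\<dots> = - x" using U by (simp add: sum_negf)
    finally have z: "(\<Sum>a\<in>T \<union> U. q a *s a) = 0" by simp
    have "q a = 0" if "a \<in> T" for a
      by (rule independentD[OF D(3) _ _ z]) (use T U D that in \<open>auto simp: B_def\<close>)
    then have "r a = 0" if "a \<in> T" for a using that by (simp add: q_def)
    then show "x = 0" using T by simp
  qed
  then have 1: "span B \<inter> W = {0}" using spC span_zero by auto
  have "D = B \<union> C" using D by (auto simp: B_def)
  then have 2: "V \<subseteq> {b + w | b w. b \<in> span B \<and> w \<in> W}"
    using D(4) spC by (auto simp: span_Un)
  have "B \<subseteq> V" "independent B"
    using D independent_mono by (auto simp: B_def)
  then show ?thesis using that 1 2 by blast
qed

lemma subspace_eq_if_dim_le:
  assumes "fin_dim V" "subspace V" "subspace W" "W \<subseteq> V" "dim V \<le> dim W"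
  shows "V = W"
proof -
  obtain B where B: "B \<subseteq> V" "independent B" "span B \<inter> W = {0}"
    "V \<subseteq> {b + w | b w. b \<in> span B \<and> w \<in> W}"
    by (rule complement_exists[OF assms(3,4,2)])
  obtain F where F: "finite F" "V \<subseteq> span F"
    using assms(1) by (auto simp: fin_dim_def)
  have "card B = 0"
    using card_basis_modulo[OF F assms(3,4,2) B] assms(5) by simp
  then have "B = {}" using fin_dim_independent[OF assms(1) B(1,2)] by simp
  then show ?thesis using B(4) assms(4) by auto
qed

text \<open>\<open>f\<close> induces an isomorphism from \<open>S\<close> modulo the preimage of
  \<open>J\<close> onto \<open>(J + f S)\<close> modulo \<open>J\<close>; a basis of a complement of
  the preimage is carried to one of a complement of \<open>J\<close>.\<close>

lemma dim_add_image:
  assumes lin: "Vector_Spaces.linear scale scale f"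
    and S: "fin_dim S" "subspace S" and T: "fin_dim T" "subspace T" "f ` S \<subseteq> T"
    and J: "subspace J" "J \<subseteq> T"
  shows "dim {j + f x | j x. j \<in> J \<and> x \<in> S} - dim J = dim S - dim {x \<in> S. f x \<in> J}"
    (is "dim ?V - _ = _ - dim ?J'")
proof -
  interpret f: Vector_Spaces.linear scale scale f by (rule lin)
  have subJ': "subspace ?J'"
    using S J by (auto simp: subspace_def f.add f.scale f.zero)
  obtain B where B: "B \<subseteq> S" "independent B" "span B \<inter> ?J' = {0}"
    "S \<subseteq> {b + w | b w. b \<in> span B \<and> w \<in> ?J'}"
    by (rule complement_exists[OF subJ' _ S(2)]) auto
  obtain F where F: "finite F" "S \<subseteq> span F" using S(1) by (auto simp: fin_dim_def)
  obtain G where G: "finite G" "T \<subseteq> span G" using T(1) by (auto simp: fin_dim_def)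
  have finB: "finite B" using fin_dim_independent[OF S(1) B(1,2)] by simp
  have spB: "span B \<subseteq> S" using B(1) S(2) span_minimal by blast
  have z: "x = 0" if "x \<in> span B" "f x \<in> J" for x
    using that spB B(3) by auto
  have inj: "inj_on f B"
  proof (rule inj_onI)
    fix x y assume xy: "x \<in> B" "y \<in> B" "f x = f y"
    then have "x - y = 0"
      using subspace_0[OF J(1)] by (intro z) (auto simp: f.diff span_base span_diff)
    then show "x = y" by simp
  qed
  have subV: "subspace ?V"
  proof -
    have "subspace (f ` S)" using S(2) by (rule f.subspace_image)
    then have "subspace {x + y | x y. x \<in> J \<and> y \<in> f ` S}" using J(1) subspace_sums by blast
    moreover have "{x + y | x y. x \<in> J \<and> y \<in> f ` S} = ?V" by blast
    ultimately show ?thesis by simp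
  qed
  have VT: "?V \<subseteq> T" using J T by (auto intro!: subspace_add)
  have "dim ?V - dim J = card (f ` B)"
  proof (rule card_basis_modulo)
    show "finite G" "?V \<subseteq> span G" using G VT by auto
    show "subspace J" "subspace ?V" by (fact J(1), fact subV)
    show "J \<subseteq> ?V"
    proof
      fix x assume "x \<in> J"
      then have "x = x + f 0 \<and> x \<in> J \<and> 0 \<in> S" using subspace_0[OF S(2)] by (simp add: f.zero)
      then show "x \<in> ?V" by (intro CollectI exI)
    qed
    show "f ` B \<subseteq> ?V"
    proof
      fix y assume "y \<in> f ` B"
      then obtain x where "y = f x" "x \<in> B" by blast
      then have "y = 0 + f x \<and> 0 \<in> J \<and> x \<in> S" using B(1) subspace_0[OF J(1)] by auto
      then show "y \<in> ?V" by (intro CollectI exI)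
    qed
    show "independent (f ` B)"
    proof (rule independent_if_scalars_zero)
      fix g y assume g: "(\<Sum>x\<in>f ` B. g x *s x) = 0" "y \<in> f ` B"
      have "f (\<Sum>b\<in>B. g (f b) *s b) = (\<Sum>x\<in>f ` B. g x *s x)"
        using inj by (simp add: f.sum f.scale sum.reindex)
      then have "f (\<Sum>b\<in>B. g (f b) *s b) \<in> J" using g subspace_0[OF J(1)] by simp
      then have "(\<Sum>b\<in>B. g (f b) *s b) = 0"
        by (rule z[rotated]) (intro span_sum span_scale span_base)
      from independentD[OF B(2) finB subset_refl this] show "g y = 0" using g(2) by auto
    qed (use finB in auto)
    show "span (f ` B) \<inter> J = {0}"
    proof -
      have "y = 0" if y: "y \<in> span (f ` B)" "y \<in> J" for y
      proof -
        obtain x where "x \<in> span B" "y = f x" using y(1) by (auto simp: f.span_image)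
        then show ?thesis using z[of x] y(2) f.zero by simp
      qed
      then show ?thesis using subspace_0[OF J(1)] span_zero by auto
    qed
    show "?V \<subseteq> {b + w | b w. b \<in> span (f ` B) \<and> w \<in> J}"
    proof
      fix v assume "v \<in> ?V"
      then obtain j x where v: "v = j + f x" "j \<in> J" "x \<in> S" by blast
      obtain b w where "x = b + w" "b \<in> span B" "f w \<in> J" using B(4) v(3) by blast
      then have "v = f b + (f w + j)" "f b \<in> span (f ` B)" "f w + j \<in> J"
        using v subspace_add[OF J(1)] by (simp_all add: f.add f.span_image algebra_simps)
      then show "v \<in> {b + w | b w. b \<in> span (f ` B) \<and> w \<in> J}" by blast
    qed
  qed
  moreover have "dim S - dim ?J' = card B"
    by (rule card_basis_modulo[OF F subJ' _ S(2) B]) auto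
  ultimately show ?thesis using card_image[OF inj] by simp
qed

text \<open>Indexed families are used because specialised vectors might coincide; a coincidence
  would be a relation with coefficients 1 and -1.\<close>

lemma card_le_dim_family:
  assumes V: "fin_dim V" and A: "finite A" "\<And>a. a \<in> A \<Longrightarrow> w a \<in> V"
    and ind: "\<And>c. (\<Sum>a\<in>A. c a *s w a) = 0 \<Longrightarrow> \<forall>a\<in>A. c a = 0"
  shows "card A \<le> dim V"
proof -
  have inj: "inj_on w A"
  proof (rule inj_onI, rule ccontr)
    fix a b assume ab: "a \<in> A" "b \<in> A" "w a = w b" "a \<noteq> b"
    let ?c = "\<lambda>x. if x = a then 1 else if x = b then -1 else (0 :: 'a)"
    have "(\<Sum>x\<in>A. ?c x *s w x) = (\<Sum>x\<in>{a, b}. ?c x *s w x)"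
      using A ab by (intro sum.mono_neutral_right) auto
    also have "\<dots> = 0" using ab by simp
    finally have "\<forall>x\<in>A. ?c x = 0" by (rule ind[of ?c])
    then show False using ab by auto
  qed
  have "independent (w ` A)"
  proof (rule independent_if_scalars_zero)
    fix g y assume g: "(\<Sum>x\<in>w ` A. g x *s x) = 0" "y \<in> w ` A"
    then have "(\<Sum>a\<in>A. g (w a) *s w a) = 0" using inj by (simp add: sum.reindex)
    from ind[OF this] show "g y = 0" using g(2) by auto
  qed (use A in auto)
  then show ?thesis
    using fin_dim_independent[OF V, of "w ` A"] A card_image[OF inj] by auto
qed

end

subsection \<open>Specialising polynomial families\<close>

text \<open>Induction on the number of vectors: away from the roots of the pivot, a nontrivial
  relation between specialised vectors restricts to one between the reduced vectors. Each
  elimination thus adds only finitely many exceptional parameters.\<close>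

lemma poly_relation_specialise:
  fixes v :: "'i \<Rightarrow> 'm \<Rightarrow> 'a::field poly"
  assumes "finite A"
    and "\<And>c. (\<And>m. (\<Sum>a\<in>A. c a * v a m) = 0) \<Longrightarrow> \<forall>a\<in>A. c a = 0"
  shows "finite {u. \<exists>c. (\<forall>m. (\<Sum>a\<in>A. c a * poly (v a m) u) = 0) \<and> \<not> (\<forall>a\<in>A. c a = 0)}"
  using assms
proof (induction A arbitrary: v rule: finite_induct)
  case (insert b A)
  have "\<exists>m. v b m \<noteq> 0"
  proof (rule ccontr)
    assume *: "\<nexists>m. v b m \<noteq> 0"
    have "\<forall>a\<in>insert b A. (if a = b then 1 else 0 :: 'a poly) = 0"
      by (rule insert.prems) (use * insert.hyps in \<open>auto intro!: sum.neutral\<close>)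
    then show False by simp
  qed
  then obtain m0 where m0: "v b m0 \<noteq> 0" by blast
  text \<open>One step of Gaussian elimination with the pivot \<open>v b m0\<close>.\<close>
  define w where "w a m = v b m0 * v a m - v a m0 * v b m" for a m
  have "\<forall>a\<in>A. c a = 0" if c: "\<And>m. (\<Sum>a\<in>A. c a * w a m) = 0" for c
  proof -
    \<comment> \<open>Lifts a relation between the reduced vectors: the coefficient of
      \<open>b\<close> collects the multiples of row \<open>b\<close> that were subtracted.\<close>
    define c' where "c' a = (if a = b then - (\<Sum>a\<in>A. c a * v a m0) else v b m0 * c a)" for a
    have "\<forall>a\<in>insert b A. c' a = 0"
    proof (rule insert.prems)
      fix m
      have "(\<Sum>a\<in>insert b A. c' a * v a m) = - (\<Sum>a\<in>A. c a * v a m0) * v b m + (\<Sum>a\<in>A. c' a * v a m)"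
        using insert.hyps by (simp add: c'_def)
      also have "(\<Sum>a\<in>A. c' a * v a m) = (\<Sum>a\<in>A. v b m0 * c a * v a m)"
        using insert.hyps by (intro sum.cong) (auto simp: c'_def)
      also have "- (\<Sum>a\<in>A. c a * v a m0) * v b m + \<dots> = (\<Sum>a\<in>A. c a * w a m)"
        by (simp add: w_def sum_distrib_left sum_distrib_right sum_subtractf algebra_simps)
      finally show "(\<Sum>a\<in>insert b A. c' a * v a m) = 0" using c by simp
    qed
    then show ?thesis using m0 insert.hyps by (auto simp: c'_def split: if_splits)
  qed
  then have fin: "finite {u. \<exists>c. (\<forall>m. (\<Sum>a\<in>A. c a * poly (w a m) u) = 0) \<and> \<not> (\<forall>a\<in>A. c a = 0)}"
    by (rule insert.IH)
  have "{u. \<exists>c. (\<forall>m. (\<Sum>a\<in>insert b A. c a * poly (v a m) u) = 0) \<and> \<not> (\<forall>a\<in>insert b A. c a = 0)}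
     \<subseteq> {u. poly (v b m0) u = 0} \<union>
       {u. \<exists>c. (\<forall>m. (\<Sum>a\<in>A. c a * poly (w a m) u) = 0) \<and> \<not> (\<forall>a\<in>A. c a = 0)}"
  proof
    fix u assume "u \<in> {u. \<exists>c. (\<forall>m. (\<Sum>a\<in>insert b A. c a * poly (v a m) u) = 0) \<and>
      \<not> (\<forall>a\<in>insert b A. c a = 0)}"
    then obtain c where c: "\<And>m. (\<Sum>a\<in>insert b A. c a * poly (v a m) u) = 0"
      "\<not> (\<forall>a\<in>insert b A. c a = 0)" by blast
    have e: "(\<Sum>a\<in>A. c a * poly (v a m) u) = - (c b * poly (v b m) u)" for m
      using c(1)[of m] insert.hyps by (simp add: eq_neg_iff_add_eq_0 add.commute)
    have "\<not> (\<forall>a\<in>A. c a = 0)" if "poly (v b m0) u \<noteq> 0"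
    proof
      assume *: "\<forall>a\<in>A. c a = 0"
      then have "c b = 0" using e[of m0] that by simp
      then show False using c(2) * by simp
    qed
    moreover have "(\<Sum>a\<in>A. c a * poly (w a m) u) = 0" for m
    proof -
      have "(\<Sum>a\<in>A. c a * poly (w a m) u) = poly (v b m0) u * (\<Sum>a\<in>A. c a * poly (v a m) u)
          - (\<Sum>a\<in>A. c a * poly (v a m0) u) * poly (v b m) u"
        by (simp add: w_def sum_distrib_left sum_distrib_right sum_subtractf algebra_simps)
      then show ?thesis by (simp add: e)
    qed
    ultimately show "u \<in> {u. poly (v b m0) u = 0} \<union>
       {u. \<exists>c. (\<forall>m. (\<Sum>a\<in>A. c a * poly (w a m) u) = 0) \<and> \<not> (\<forall>a\<in>A. c a = 0)}"
      by blast
  qed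
  then show ?case using fin poly_roots_finite[OF m0] finite_subset by blast
qed simp

text \<open>Descent on the degree: at \<open>u0\<close> all coefficients of a relation vanish, so
  \<open>u - u0\<close> can be divided out of all of them.\<close>

lemma no_poly_relation_if_specialised:
  fixes v :: "'i \<Rightarrow> 'm \<Rightarrow> 'a::field poly"
  assumes u0: "\<And>c. (\<And>m. (\<Sum>a\<in>A. c a * poly (v a m) u0) = 0) \<Longrightarrow> \<forall>a\<in>A. c a = 0"
    and c: "\<And>m. (\<Sum>a\<in>A. c a * v a m) = 0"
  shows "\<forall>a\<in>A. c a = 0"
proof
  fix b assume b: "b \<in> A"
  from c show "c b = 0"
  proof (induction "degree (c b)" arbitrary: c rule: less_induct)
    case less
    have "\<forall>a\<in>A. poly (c a) u0 = 0"
    proof (rule u0)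
      fix m
      have "poly (\<Sum>a\<in>A. c a * v a m) u0 = 0" using less.prems by simp
      then show "(\<Sum>a\<in>A. poly (c a) u0 * poly (v a m) u0) = 0" by (simp add: poly_sum)
    qed
    then have "\<forall>a\<in>A. \<exists>d. c a = [:-u0, 1:] * d" unfolding poly_eq_0_iff_dvd dvd_def .
    then obtain d where d: "\<And>a. a \<in> A \<Longrightarrow> c a = [:-u0, 1:] * d a" unfolding bchoice_iff by blast
    have *: "(\<Sum>a\<in>A. d a * v a m) = 0" for m
    proof -
      have "[:-u0, 1:] * (\<Sum>a\<in>A. d a * v a m) = (\<Sum>a\<in>A. c a * v a m)"
        unfolding sum_distrib_left by (intro sum.cong) (simp_all only: d mult.assoc)
      then have "[:-u0, 1:] * (\<Sum>a\<in>A. d a * v a m) = 0" by (simp only: less.prems)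
      then show ?thesis unfolding mult_eq_0_iff by simp
    qed
    show ?case
    proof (rule ccontr)
      assume nz: "c b \<noteq> 0"
      then have "d b \<noteq> 0" using d[OF b] by auto
      then have "degree (d b) < degree (c b)"
        using d[OF b] by (simp add: degree_mult_eq del: mult_pCons_left)
      then have "d b = 0" using less.hyps * by blast
      then show False using \<open>d b \<noteq> 0\<close> by simp
    qed
  qed
qed

text \<open>Semicontinuity of the rank along a line: independence at one parameter lifts to
  independence over \<open>K[u]\<close> and descends to almost all parameters.\<close>

lemma independent_specialise:
  fixes v :: "'i \<Rightarrow> 'm \<Rightarrow> 'a::field poly"
  assumes "finite A"
    and "\<And>c. (\<And>m. (\<Sum>a\<in>A. c a * poly (v a m) u0) = 0) \<Longrightarrow> \<forall>a\<in>A. c a = 0"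
  shows "finite {u. \<exists>c. (\<forall>m. (\<Sum>a\<in>A. c a * poly (v a m) u) = 0) \<and> \<not> (\<forall>a\<in>A. c a = 0)}"
proof (rule poly_relation_specialise[OF assms(1)])
  fix c assume "\<And>m. (\<Sum>a\<in>A. c a * v a m) = 0"
  with assms(2) show "\<forall>a\<in>A. c a = 0" by (rule no_poly_relation_if_specialised)
qed

section \<open>Separating a vector from a subspace\<close>

context vector_space
begin

lemma separating_linear_map:
  assumes "subspace W" "w \<notin> W"
  obtains g where "Vector_Spaces.linear scale scale g" "\<And>x. x \<in> W \<Longrightarrow> g x = 0" "g w \<noteq> 0"
proof -
  interpret vs: vector_space_pair scale scale ..
  obtain C where C: "C \<subseteq> W" "independent C" "W \<subseteq> span C" "card C = dim W"
    by (rule basis_exists)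
  have spC: "span C = W" using C assms(1) span_minimal by blast
  have "independent (insert w C)"
    using C assms spC by (intro independent_insertI) auto
  from vs.linear_independent_extend[OF this, of "\<lambda>x. if x = w then w else 0"]
  obtain g where g: "Vector_Spaces.linear scale scale g" "\<forall>x\<in>insert w C. g x = (if x = w then w else 0)"
    by blast
  have "w \<noteq> 0" using assms subspace_0 by auto
  have "w \<notin> C" using assms C by auto
  have "g x = 0" if "x \<in> W" for x
  proof (rule vs.linear_eq_0_on_span[OF g(1)])
    show "x \<in> span C" using that C by auto
    show "g y = 0" if "y \<in> C" for y using g(2) that \<open>w \<notin> C\<close> by auto
  qed
  then show ?thesis using g \<open>w \<noteq> 0\<close> that by auto
qed

end

subsection \<open>Graded ideals\<close>

lemma lookup_smult_mpol [simp]: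
  "Poly_Mapping.lookup (smult_mpol c f) m = c * Poly_Mapping.lookup f m"
  unfolding smult_mpol_def mult_map_scale_conv_mult [symmetric]
  by (simp add: Poly_Mapping.map.rep_eq when_def)

lemma smult_mpol_mult_left: "smult_mpol c f * g = smult_mpol c (f * g)"
  and smult_mpol_mult_right: "f * smult_mpol c g = smult_mpol c (f * g)"
  by (simp_all add: smult_mpol_def ac_simps)

lemma linear_mult_mpol: "Vector_Spaces.linear smult_mpol smult_mpol ((*) l)"
  by unfold_locales (simp_all add: algebra_simps smult_mpol_mult_right)

definition var :: "nat \<Rightarrow> 'a::field mpol" where
  "var i = Poly_Mapping.single (Poly_Mapping.single i 1) 1"

lemma mon_deg_superset:
  "finite A \<Longrightarrow> Poly_Mapping.keys m \<subseteq> A \<Longrightarrow> mon_deg m = (\<Sum>i\<in>A. Poly_Mapping.lookup m i)"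
  unfolding mon_deg_def by (intro sum.mono_neutral_left) (auto simp: in_keys_iff)

lemma mon_deg_add: "mon_deg (m + m') = mon_deg m + mon_deg m'"
proof -
  let ?A = "Poly_Mapping.keys m \<union> Poly_Mapping.keys m'"
  have "mon_deg x = (\<Sum>i\<in>?A. Poly_Mapping.lookup x i)" if "x \<in> {m, m', m + m'}" for x
    using that Poly_Mapping.keys_add[of m m'] by (intro mon_deg_superset) auto
  then show ?thesis by (simp add: lookup_add sum.distrib)
qed

lemma mon_deg_single [simp]: "mon_deg (Poly_Mapping.single i c) = c"
  by (simp add: mon_deg_def)

lemma mon_deg_0 [simp]: "mon_deg 0 = 0"
  by (simp add: mon_deg_def)

lemma forms_mult: "f \<in> forms n d \<Longrightarrow> g \<in> forms n e \<Longrightarrow> f * g \<in> forms n (d + e)"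
proof -
  assume f: "f \<in> forms n d" and g: "g \<in> forms n e"
  have "Poly_Mapping.keys m \<subseteq> {..n} \<and> mon_deg m = d + e" if m: "m \<in> Poly_Mapping.keys (f * g)" for m
  proof -
    obtain a b where ab: "m = a + b" "a \<in> Poly_Mapping.keys f" "b \<in> Poly_Mapping.keys g"
      using m keys_mult[of f g] by blast
    then have "Poly_Mapping.keys a \<subseteq> {..n}" "mon_deg a = d" "Poly_Mapping.keys b \<subseteq> {..n}" "mon_deg b = e"
      using f g by (auto simp: forms_def poly_ring_def)
    then show ?thesis using Poly_Mapping.keys_add[of a b] ab(1) by (auto simp: mon_deg_add)
  qed
  then show ?thesis by (auto simp: forms_def poly_ring_def)
qed

lemma var_forms: "i \<le> n \<Longrightarrow> var i \<in> forms n 1"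
  by (simp add: var_def forms_def poly_ring_def)

lemma var_mult_forms: "i \<le> n \<Longrightarrow> f \<in> forms n d \<Longrightarrow> var i * f \<in> forms n (Suc d)"
  using forms_mult[OF var_forms, of i n f d] by simp

lemma fin_dim_forms: "mpol.fin_dim (forms n d)"
proof -
  let ?M = "{m. Poly_Mapping.keys m \<subseteq> {..n} \<and> mon_deg m = d}"
  have "forms n d \<subseteq> mpol.span ((\<lambda>m. Poly_Mapping.single m 1 :: 'a mpol) ` ?M)"
  proof
    fix f :: "'a mpol" assume "f \<in> forms n d"
    then show "f \<in> mpol.span ((\<lambda>m. Poly_Mapping.single m 1 :: 'a mpol) ` ?M)"
      by (subst mpol_sum_monomials[of f], intro mpol.span_sum mpol.span_scale mpol.span_base)
         (auto simp: forms_def poly_ring_def)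
  qed
  then show ?thesis
    unfolding mpol.fin_dim_def using finite_monomials_degree by blast
qed

text \<open>Each monomial of positive degree is a variable times a monomial, so a subspace need only
  be tested on multiples of the variables.\<close>

lemma forms_Suc_subset:
  assumes W: "mpol.subspace W" and var: "\<And>i g. i \<le> n \<Longrightarrow> g \<in> forms n d \<Longrightarrow> var i * g \<in> W"
  shows "forms n (Suc d) \<subseteq> W"
proof
  fix f :: "'a mpol" assume f: "f \<in> forms n (Suc d)"
  have "Poly_Mapping.single m 1 \<in> W" if m: "m \<in> Poly_Mapping.keys f" for m
  proof -
    have km: "Poly_Mapping.keys m \<subseteq> {..n}" "mon_deg m = Suc d"
      using f m by (auto simp: forms_def poly_ring_def)
    then have "m \<noteq> 0" by auto
    then obtain i where i: "i \<in> Poly_Mapping.keys m" by (meson keys_eq_empty ex_in_conv)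
    define m' where "m' = m - Poly_Mapping.single i 1"
    have m': "m = Poly_Mapping.single i 1 + m'"
      unfolding m'_def using i
      by (intro poly_mapping_eqI) (auto simp: lookup_add lookup_minus lookup_single when_def in_keys_iff)
    have "Poly_Mapping.keys m' \<subseteq> Poly_Mapping.keys m"
      unfolding m'_def by (auto simp: in_keys_iff lookup_minus)
    moreover have "mon_deg m' = d" using km(2) unfolding m' mon_deg_add by simp
    ultimately have "Poly_Mapping.single m' 1 \<in> (forms n d :: 'a mpol set)"
      using km by (auto simp: forms_def poly_ring_def)
    then have "var i * Poly_Mapping.single m' 1 \<in> W" using i km by (intro var) auto
    then show ?thesis by (simp add: var_def mult_single m' add.commute)
  qed
  then show "f \<in> W"
    by (subst mpol_sum_monomials[of f]) (intro mpol.subspace_sum[OF W] mpol.subspace_scale[OF W])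
qed

text \<open>Stands for a homogeneous ideal, given by its graded pieces. Saturation is not part of
  the notion, because adjoining a linear form destroys it in general.\<close>

definition graded :: "nat \<Rightarrow> (nat \<Rightarrow> 'a::field mpol set) \<Rightarrow> bool" where
  "graded n J \<longleftrightarrow> (\<forall>d. mpol.subspace (J d) \<and> J d \<subseteq> forms n d \<and>
     (\<forall>f\<in>J d. \<forall>i\<le>n. var i * f \<in> J (Suc d)))"

lemma gradedD:
  assumes "graded n J"
  shows "mpol.subspace (J d)" "J d \<subseteq> forms n d" "f \<in> J d \<Longrightarrow> i \<le> n \<Longrightarrow> var i * f \<in> J (Suc d)"
  using assms by (auto simp: graded_def)

lemma fin_dim_graded: "graded n J \<Longrightarrow> mpol.fin_dim (J d)"
  by (rule mpol.fin_dim_subset[OF fin_dim_forms gradedD(2)])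

text \<open>The Hilbert function of the quotient by \<open>J\<close>.\<close>

definition cod :: "nat \<Rightarrow> (nat \<Rightarrow> 'a::field mpol set) \<Rightarrow> nat \<Rightarrow> nat" where
  "cod n J d = mpol.dim (forms n d :: 'a mpol set) - mpol.dim (J d)"

text \<open>The graded pieces of the ideals \<open>J + (l)\<close> and \<open>(J : l)\<close> for a linear form \<open>l\<close>.\<close>

definition adjoin :: "nat \<Rightarrow> 'a::field mpol \<Rightarrow> (nat \<Rightarrow> 'a mpol set) \<Rightarrow> nat \<Rightarrow> 'a mpol set" where
  "adjoin n l J d = (case d of 0 \<Rightarrow> J 0
     | Suc e \<Rightarrow> {f + l * g | f g. f \<in> J (Suc e) \<and> g \<in> forms n e})"

definition colon :: "nat \<Rightarrow> 'a::field mpol \<Rightarrow> (nat \<Rightarrow> 'a mpol set) \<Rightarrow> nat \<Rightarrow> 'a mpol set" where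
  "colon n l J d = {f \<in> forms n d. l * f \<in> J (Suc d)}"

lemma adjoin_Suc: "adjoin n l J (Suc d) = {f + l * g | f g. f \<in> J (Suc d) \<and> g \<in> forms n d}"
  by (simp add: adjoin_def)

lemma linear_form_mult: "l \<in> forms n 1 \<Longrightarrow> f \<in> forms n d \<Longrightarrow> l * f \<in> forms n (Suc d)"
  using forms_mult[of l n 1 f d] by simp

lemma subset_adjoin: "J d \<subseteq> adjoin n l J d"
proof (cases d)
  case (Suc e)
  have "f = f + l * 0" for f by simp
  then show ?thesis
    unfolding Suc adjoin_Suc using mpol.subspace_0[OF subspace_forms] by blast
qed (simp add: adjoin_def)

lemma graded_colon:
  assumes "graded n J" "l \<in> forms n 1"
  shows "graded n (colon n l J)"
proof -
  have "mpol.subspace (colon n l J d)" for d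
    unfolding colon_def using gradedD(1)[OF assms(1), of "Suc d"] subspace_forms[of n d]
    by (auto simp: mpol.subspace_def distrib_left smult_mpol_mult_right)
  moreover have "var i * f \<in> colon n l J (Suc d)" if "f \<in> colon n l J d" "i \<le> n" for i f d
    using that gradedD(3)[OF assms(1), of "l * f" "Suc d" i]
    by (auto simp: colon_def var_mult_forms mult.left_commute)
  ultimately show ?thesis by (auto simp: graded_def colon_def)
qed

lemma graded_adjoin:
  assumes "graded n J" "l \<in> forms n 1"
  shows "graded n (adjoin n l J)"
proof -
  have sub: "mpol.subspace (adjoin n l J d)" for d
  proof (cases d)
    case (Suc e)
    interpret l: Vector_Spaces.linear smult_mpol smult_mpol "(*) l" by (rule linear_mult_mpol)
    have "mpol.subspace ((*) l ` forms n e)" by (rule l.subspace_image[OF subspace_forms])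
    then have "mpol.subspace {x + y | x y. x \<in> J (Suc e) \<and> y \<in> (*) l ` forms n e}"
      by (rule mpol.subspace_sums[OF gradedD(1)[OF assms(1)]])
    moreover have "{x + y | x y. x \<in> J (Suc e) \<and> y \<in> (*) l ` forms n e} = adjoin n l J d"
      unfolding Suc adjoin_Suc by blast
    ultimately show ?thesis by simp
  qed (simp add: adjoin_def gradedD[OF assms(1)])
  have fo: "adjoin n l J d \<subseteq> forms n d" for d
  proof (cases d)
    case (Suc e)
    show ?thesis
      unfolding Suc adjoin_Suc
      using gradedD(2)[OF assms(1), of "Suc e"] linear_form_mult[OF assms(2)]
      by (auto intro!: mpol.subspace_add[OF subspace_forms])
  qed (simp add: adjoin_def gradedD[OF assms(1)])
  have "var i * f \<in> adjoin n l J (Suc d)" if f: "f \<in> adjoin n l J d" and i: "i \<le> n" for i f d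
  proof (cases d)
    case 0
    then have "var i * f \<in> J (Suc d)" using f i gradedD(3)[OF assms(1)] by (simp add: adjoin_def)
    then show ?thesis using subset_adjoin by blast
  next
    case (Suc e)
    then obtain g h where gh: "f = g + l * h" "g \<in> J d" "h \<in> forms n e"
      using f by (auto simp: adjoin_Suc)
    then have "var i * f = var i * g + l * (var i * h)" "var i * g \<in> J (Suc d)" "var i * h \<in> forms n d"
      using i gradedD(3)[OF assms(1)] var_mult_forms Suc by (auto simp: algebra_simps)
    then show ?thesis unfolding adjoin_Suc by blast
  qed
  then show ?thesis using sub fo by (simp add: graded_def)
qed

lemma dim_graded_mono:
  assumes "graded n J'" "J d \<subseteq> J' d"
  shows "mpol.dim (J d) \<le> mpol.dim (J' d)"
  using gradedD(2)[OF assms(1), of d] assms(2)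
  by (intro mpol.dim_subset_fin_dim mpol.fin_dim_subset[OF fin_dim_forms])

lemma cod_antimono:
  "graded n J' \<Longrightarrow> J d \<subseteq> J' d \<Longrightarrow> cod n J' d \<le> cod n J d"
  unfolding cod_def using dim_graded_mono[of n J' J d] by simp

lemma cod_adjoin_le:
  assumes "graded n J" "l \<in> forms n 1"
  shows "cod n (adjoin n l J) d \<le> cod n J d"
  by (rule cod_antimono[OF graded_adjoin[OF assms]]) (rule subset_adjoin)

lemma dim_graded_le: "graded n J \<Longrightarrow> mpol.dim (J d) \<le> mpol.dim (forms n d :: 'a mpol set)"
  for J :: "nat \<Rightarrow> 'a::field mpol set"
  by (intro mpol.dim_subset_fin_dim fin_dim_forms gradedD)

text \<open>The exact sequence \<open>0 -> S/(J:l) -> S/J -> S/(J + (l)) -> 0\<close>, whose first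
  map is multiplication by \<open>l\<close> and raises the degree by one.\<close>

lemma cod_exact:
  assumes J: "graded n J" and l: "l \<in> forms n 1"
  shows "cod n J (Suc d) = cod n (colon n l J) d + cod n (adjoin n l J) (Suc d)"
proof -
  have "mpol.dim (adjoin n l J (Suc d)) - mpol.dim (J (Suc d)) =
      mpol.dim (forms n d :: 'a mpol set) - mpol.dim (colon n l J d)"
    unfolding adjoin_Suc colon_def
    by (rule mpol.dim_add_image[OF linear_mult_mpol fin_dim_forms subspace_forms fin_dim_forms
          subspace_forms _ gradedD(1,2)[OF J]])
       (use linear_form_mult[OF l] in auto)
  moreover have "mpol.dim (J (Suc d)) \<le> mpol.dim (adjoin n l J (Suc d))"
    by (rule dim_graded_mono[OF graded_adjoin[OF J l] subset_adjoin])
  moreover have "mpol.dim (adjoin n l J (Suc d)) \<le> mpol.dim (forms n (Suc d) :: 'a mpol set)"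
    by (rule dim_graded_le[OF graded_adjoin[OF J l]])
  ultimately show ?thesis unfolding cod_def by simp
qed

subsection \<open>Generic linear forms\<close>

text \<open>One-parameter families of linear forms are generic enough for every purpose below.\<close>

definition lform :: "nat \<Rightarrow> 'a::field \<Rightarrow> 'a mpol" where
  "lform n u = (\<Sum>i\<le>n. smult_mpol (u ^ i) (var i))"

lemma lform_forms: "lform n u \<in> forms n 1"
  unfolding lform_def
  by (intro mpol.subspace_sum[OF subspace_forms] mpol.subspace_scale[OF subspace_forms] var_forms) simp

definition lform_poly :: "nat \<Rightarrow> 'a::field mpol \<Rightarrow> (nat \<Rightarrow>\<^sub>0 nat) \<Rightarrow> 'a poly" where
  "lform_poly n g m = (\<Sum>i\<le>n. monom (Poly_Mapping.lookup (var i * g) m) i)"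

lemma lookup_lform_mult: "Poly_Mapping.lookup (lform n u * g) m = poly (lform_poly n g m) u"
proof -
  have "Poly_Mapping.lookup (lform n u * g) m = (\<Sum>i\<le>n. u ^ i * Poly_Mapping.lookup (var i * g) m)"
    by (simp add: lform_def sum_distrib_right smult_mpol_mult_left lookup_sum)
  also have "\<dots> = poly (lform_poly n g m) u"
    unfolding lform_poly_def poly_sum poly_monom by (intro sum.cong) (simp_all add: mult.commute)
  finally show ?thesis .
qed

lemma mpol_sum_eq_0_iff:
  "(\<Sum>a\<in>A. smult_mpol (c a) (w a)) = 0 \<longleftrightarrow> (\<forall>m. (\<Sum>a\<in>A. c a * Poly_Mapping.lookup (w a) m) = 0)"
  by (auto simp: poly_mapping_eq_iff fun_eq_iff lookup_sum)

text \<open>A basis at \<open>u0\<close> is written with \<open>lform n u0\<close> and moved along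
  with the parameter. It stays independent for almost all \<open>u\<close>, so the dimension cannot
  drop.\<close>

lemma generic_cod_le:
  fixes J :: "nat \<Rightarrow> 'a::field mpol set"
  assumes J: "graded n J"
  shows "finite {u. cod n (adjoin n (lform n u0) J) (Suc d) < cod n (adjoin n (lform n u) J) (Suc d)}"
proof -
  let ?V = "\<lambda>u. adjoin n (lform n u) J (Suc d)"
  have gr: "graded n (adjoin n (lform n u) J)" for u
    by (rule graded_adjoin[OF J lform_forms])
  obtain B where B: "B \<subseteq> ?V u0" "mpol.independent B" "card B = mpol.dim (?V u0)"
    by (rule mpol.basis_exists[of "?V u0"])
  have fV: "mpol.fin_dim (?V u)" for u
    by (rule fin_dim_graded[OF gr])
  have finB: "finite B" using mpol.fin_dim_independent[OF fV B(1,2)] by simp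
  have "\<forall>b\<in>B. \<exists>f g. b = f + lform n u0 * g \<and> f \<in> J (Suc d) \<and> g \<in> forms n d"
    using B(1) by (auto simp: adjoin_Suc)
  then obtain f g where fg: "\<And>b. b \<in> B \<Longrightarrow> b = f b + lform n u0 * g b"
    "\<And>b. b \<in> B \<Longrightarrow> f b \<in> J (Suc d)" "\<And>b. b \<in> B \<Longrightarrow> g b \<in> forms n d"
    by metis
  define w where "w u b = f b + lform n u * g b" for u b
  define v where "v b m = [:Poly_Mapping.lookup (f b) m:] + lform_poly n (g b) m" for b m
  have v: "poly (v b m) u = Poly_Mapping.lookup (w u b) m" for b m u
    by (simp add: v_def w_def lookup_add lookup_lform_mult)
  have fin: "finite {u. \<exists>c. (\<forall>m. (\<Sum>b\<in>B. c b * poly (v b m) u) = 0) \<and> \<not> (\<forall>b\<in>B. c b = 0)}"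
  proof (rule independent_specialise[OF finB, of v u0])
    fix c assume c: "\<And>m. (\<Sum>b\<in>B. c b * poly (v b m) u0) = 0"
    have "(\<Sum>b\<in>B. smult_mpol (c b) (w u0 b)) = 0"
      using c by (simp add: mpol_sum_eq_0_iff v)
    moreover have "(\<Sum>b\<in>B. smult_mpol (c b) (w u0 b)) = (\<Sum>b\<in>B. smult_mpol (c b) b)"
      using fg(1) by (intro sum.cong) (simp_all add: w_def)
    ultimately show "\<forall>b\<in>B. c b = 0"
      using mpol.independentD[OF B(2) finB subset_refl, of c] by auto
  qed
  have le: "cod n (adjoin n (lform n u) J) (Suc d) \<le> cod n (adjoin n (lform n u0) J) (Suc d)"
    if u: "u \<notin> {u. \<exists>c. (\<forall>m. (\<Sum>b\<in>B. c b * poly (v b m) u) = 0) \<and> \<not> (\<forall>b\<in>B. c b = 0)}" for u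
  proof -
    have "card B \<le> mpol.dim (?V u)"
    proof (rule mpol.card_le_dim_family[where w = "w u"])
      show "w u b \<in> ?V u" if "b \<in> B" for b
        using fg(2,3)[OF that] by (auto simp: w_def adjoin_Suc)
      show "\<forall>b\<in>B. c b = 0" if "(\<Sum>b\<in>B. smult_mpol (c b) (w u b)) = 0" for c
        using u that by (auto simp: mpol_sum_eq_0_iff v)
    qed (use fV finB in auto)
    then show ?thesis using B(3) by (simp add: cod_def)
  qed
  have "{u. cod n (adjoin n (lform n u0) J) (Suc d) < cod n (adjoin n (lform n u) J) (Suc d)}
      \<subseteq> {u. \<exists>c. (\<forall>m. (\<Sum>b\<in>B. c b * poly (v b m) u) = 0) \<and> \<not> (\<forall>b\<in>B. c b = 0)}"
  proof (intro subsetI, rule ccontr)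
    fix u assume "u \<in> {u. cod n (adjoin n (lform n u0) J) (Suc d) < cod n (adjoin n (lform n u) J) (Suc d)}"
      "u \<notin> {u. \<exists>c. (\<forall>m. (\<Sum>b\<in>B. c b * poly (v b m) u) = 0) \<and> \<not> (\<forall>b\<in>B. c b = 0)}"
    with le[of u] show False by (simp only: mem_Collect_eq) linarith
  qed
  then show ?thesis using fin by (rule finite_subset)
qed

text \<open>Semicontinuity, started at a parameter where the codimension is least.\<close>

lemma generic_cod:
  fixes J :: "nat \<Rightarrow> 'a::field mpol set"
  assumes "graded n J"
  obtains e where "\<And>u. e \<le> cod n (adjoin n (lform n u) J) (Suc d)"
    "finite {u. cod n (adjoin n (lform n u) J) (Suc d) \<noteq> e}"
proof -
  obtain u0 where u0: "\<And>u. cod n (adjoin n (lform n u0) J) (Suc d) \<le> cod n (adjoin n (lform n u) J) (Suc d)"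
    using ex_has_least_nat[of "\<lambda>_. True" "0 :: 'a" "\<lambda>u. cod n (adjoin n (lform n u) J) (Suc d)"] by auto
  have "{u. cod n (adjoin n (lform n u) J) (Suc d) \<noteq> cod n (adjoin n (lform n u0) J) (Suc d)} =
     {u. cod n (adjoin n (lform n u0) J) (Suc d) < cod n (adjoin n (lform n u) J) (Suc d)}"
    using u0 by (auto simp: less_le)
  then show ?thesis using that[OF u0] generic_cod_le[OF assms, of u0 d] by simp
qed

text \<open>A linear map that kills \<open>W\<close> but not \<open>w i\<close> would turn the
  family into polynomials in \<open>u\<close> vanishing everywhere, although one of them has a
  nonzero coefficient.\<close>

lemma coeff_in_subspace_if_family:
  fixes w :: "nat \<Rightarrow> 'a::field mpol"
  assumes inf: "infinite (UNIV :: 'a set)" and W: "mpol.subspace W"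
    and fam: "\<And>u. (\<Sum>i\<le>n. smult_mpol (u ^ i) (w i)) \<in> W" and i: "i \<le> n"
  shows "w i \<in> W"
proof (rule ccontr)
  assume "w i \<notin> W"
  then obtain g where g: "Vector_Spaces.linear smult_mpol smult_mpol g" "\<And>x. x \<in> W \<Longrightarrow> g x = 0" "g (w i) \<noteq> 0"
    using mpol.separating_linear_map[OF W] by metis
  interpret g: Vector_Spaces.linear smult_mpol smult_mpol g by (rule g(1))
  have "Poly_Mapping.lookup (g (w i)) m = 0" for m
  proof -
    define q where "q = (\<Sum>j\<le>n. monom (Poly_Mapping.lookup (g (w j)) m) j)"
    have "poly q u = 0" for u
    proof -
      have "poly q u = Poly_Mapping.lookup (g (\<Sum>i\<le>n. smult_mpol (u ^ i) (w i))) m"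
        by (simp add: q_def g.sum g.scale lookup_sum poly_sum poly_monom mult.commute)
      then show ?thesis using g(2)[OF fam] by simp
    qed
    then have "{x. poly q x = 0} = UNIV" by auto
    then have "q = 0" using poly_roots_finite[of q] inf by auto
    moreover have "coeff q i = Poly_Mapping.lookup (g (w i)) m"
      using i by (simp add: q_def coeff_sum)
    ultimately show ?thesis by simp
  qed
  then show False using g(3) by (simp add: poly_mapping_eq_iff fun_eq_iff)
qed

text \<open>If every form of the family maps degree \<open>d\<close> into \<open>J\<close>, then so
  does every variable, and \<open>J\<close> is everything in degree \<open>Suc d\<close>. The strict
  drop drives the induction in Green's theorem.\<close>

lemma generic_cod_less:
  fixes J :: "nat \<Rightarrow> 'a::field mpol set"
  assumes inf: "infinite (UNIV :: 'a set)" and J: "graded n J" and pos: "0 < cod n J (Suc d)"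
  shows "\<exists>u. cod n (adjoin n (lform n u) J) (Suc d) < cod n J (Suc d)"
proof (rule ccontr)
  assume no: "\<nexists>u. cod n (adjoin n (lform n u) J) (Suc d) < cod n J (Suc d)"
  have gr: "graded n (adjoin n (lform n u) J)" for u
    by (rule graded_adjoin[OF J lform_forms])
  have eq: "adjoin n (lform n u) J (Suc d) = J (Suc d)" for u
  proof (rule mpol.subspace_eq_if_dim_le)
    show "mpol.fin_dim (adjoin n (lform n u) J (Suc d))"
      by (rule fin_dim_graded[OF gr])
    show "mpol.dim (adjoin n (lform n u) J (Suc d)) \<le> mpol.dim (J (Suc d))"
    proof -
      have "\<not> cod n (adjoin n (lform n u) J) (Suc d) < cod n J (Suc d)" using no by blast
      then show ?thesis using pos unfolding cod_def by linarith
    qed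
  qed (rule gradedD(1)[OF gr] gradedD(1)[OF J] subset_adjoin)+
  have "forms n (Suc d) \<subseteq> J (Suc d)"
  proof (rule forms_Suc_subset[OF gradedD(1)[OF J]])
    fix i and g :: "'a mpol" assume i: "i \<le> n" and g: "g \<in> forms n d"
    show "var i * g \<in> J (Suc d)"
    proof (rule coeff_in_subspace_if_family[OF inf gradedD(1)[OF J] _ i])
      fix u
      have "0 + lform n u * g \<in> adjoin n (lform n u) J (Suc d)"
        unfolding adjoin_Suc using g mpol.subspace_0[OF gradedD(1)[OF J]] by blast
      then show "(\<Sum>i\<le>n. smult_mpol (u ^ i) (var i * g)) \<in> J (Suc d)"
        unfolding eq by (simp add: lform_def sum_distrib_right smult_mpol_mult_left)
    qed
  qed
  then have "forms n (Suc d) = J (Suc d)" using gradedD(2)[OF J] by blast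
  then show False using pos by (simp add: cod_def)
qed

subsection \<open>The theorems of Green and Macaulay\<close>

lemma cofinite_ex:
  assumes "infinite (UNIV :: 'a set)" "finite {u :: 'a. \<not> P u}"
  shows "\<exists>u. P u"
proof (rule ccontr)
  assume "\<nexists>u. P u"
  then have "{u. \<not> P u} = UNIV" by auto
  then show False using assms by simp
qed

lemma mac_green_1: "mac_green 1 c = c - 1"
proof (cases c)
  case (Suc k)
  have "mac_seq 1 c = [k]" by (rule mac_seq_eqI) (simp_all add: Suc)
  then have "mac_down 1 c = 1" by (simp add: mac_down_def)
  then show ?thesis using mac_down_add_green[of 1 c] by simp
qed simp

text \<open>
  Green's argument: for generic \<open>l\<close>, \<open>l'\<close> the exact sequence of multiplication by \<open>l'\<close> on
  \<open>S/(J,l)\<close> is compared with the bounds for \<open>(J : l')\<close> in degree \<open>d - 1\<close> and for \<open>(J, l')\<close>.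
\<close>

theorem green_restriction:
  fixes J :: "nat \<Rightarrow> 'a::field mpol set"
  assumes inf: "infinite (UNIV :: 'a set)" and "graded n J" "1 \<le> d"
  shows "finite {u. \<not> cod n (adjoin n (lform n u) J) d \<le> mac_green d (cod n J d)}"
  using assms(2,3)
\<comment> \<open>In the lexicographic order, \<open>adjoin\<close> lowers the codimension in the
  same degree, and \<open>colon\<close> lowers the degree.\<close>
proof (induction "(d, cod n J d)" arbitrary: d J rule: wf_induct_rule[OF wf_lex_prod[OF wf_less_than wf_less_than]])
  case (1 d J)
  note IH = 1(1) and J = 1(2)
  define c where "c = cod n J d"
  obtain s where s: "d = Suc s" using 1(3) by (cases d) auto
  obtain e where e: "\<And>u. e \<le> cod n (adjoin n (lform n u) J) d"
    "finite {u. cod n (adjoin n (lform n u) J) d \<noteq> e}"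
    using generic_cod[OF J, of s] s by metis
  have gr: "graded n (adjoin n (lform n u) J)" for u
    by (rule graded_adjoin[OF J lform_forms])
  have "e \<le> mac_green d c"
  proof (cases "c = 0")
    case True
    then show ?thesis
      using e(1)[of 0] cod_adjoin_le[OF J lform_forms, of 0 d] by (simp add: c_def)
  next
    case False
    then have ec: "e < c"
      using generic_cod_less[OF inf J, of s] e(1) unfolding c_def s by (metis le_less_trans neq0_conv)
    show ?thesis
    proof (cases "d = 1")
      case True
      then show ?thesis using ec mac_green_1[of c] by simp
    next
      case False
      then have d2: "2 \<le> d" "1 \<le> s" using s by auto
      \<comment> \<open>\<open>u'\<close> is fixed before \<open>u\<close>, since the exceptional
        sets for \<open>u\<close> come from ideals built with \<open>u'\<close>.\<close>
      obtain u' where u': "cod n (adjoin n (lform n u') J) d = e"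
        using cofinite_ex[OF inf, of "\<lambda>u. cod n (adjoin n (lform n u) J) d = e"] e(2) by auto
      define l' where "l' = lform n u'"
      have l': "l' \<in> forms n 1" unfolding l'_def by (rule lform_forms)
      have cl: "cod n (colon n l' J) s = c - e"
        using cod_exact[OF J l', of s] u' by (simp add: c_def s l'_def)
      have f1: "finite {u. \<not> cod n (adjoin n (lform n u) (adjoin n l' J)) d \<le> mac_green d e}"
        using IH[of d "adjoin n l' J"] u' ec 1(3) gr by (simp add: c_def l'_def)
      have f2: "finite {u. \<not> cod n (adjoin n (lform n u) (colon n l' J)) s \<le> mac_green s (c - e)}"
        using IH[of s "colon n l' J"] graded_colon[OF J l'] cl d2 s by simp
      have "finite ({u. cod n (adjoin n (lform n u) J) d \<noteq> e} \<union>
          {u. \<not> cod n (adjoin n (lform n u) (adjoin n l' J)) d \<le> mac_green d e} \<union>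
          {u. \<not> cod n (adjoin n (lform n u) (colon n l' J)) s \<le> mac_green s (c - e)})"
        using e(2) f1 f2 by simp
      then have "finite {u. \<not> (cod n (adjoin n (lform n u) J) d = e \<and>
          cod n (adjoin n (lform n u) (adjoin n l' J)) d \<le> mac_green d e \<and>
          cod n (adjoin n (lform n u) (colon n l' J)) s \<le> mac_green s (c - e))}"
        by (rule finite_subset[rotated]) auto
      from cofinite_ex[OF inf this] obtain u where u: "cod n (adjoin n (lform n u) J) d = e"
          "cod n (adjoin n (lform n u) (adjoin n l' J)) d \<le> mac_green d e"
          "cod n (adjoin n (lform n u) (colon n l' J)) s \<le> mac_green s (c - e)"
        by blast
      define l where "l = lform n u"
      have l: "l \<in> forms n 1" unfolding l_def by (rule lform_forms)
      \<comment> \<open>Inclusions suffice here and below: codimension reverses them, and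
        \<open>e\<close> is to be bounded from above.\<close>
      have sub1: "adjoin n l (colon n l' J) s \<subseteq> colon n l' (adjoin n l J) s"
      proof
        fix f assume f: "f \<in> adjoin n l (colon n l' J) s"
        obtain r where r: "s = Suc r" using d2 by (cases s) auto
        obtain g h where gh: "f = g + l * h" "g \<in> colon n l' J s" "h \<in> forms n r"
          using f unfolding r adjoin_Suc by blast
        have "l' * f = l' * g + l * (l' * h)" using gh by (simp add: algebra_simps)
        moreover have "l' * h \<in> forms n s" using linear_form_mult[OF l'] gh r by simp
        ultimately have "l' * f \<in> adjoin n l J (Suc s)"
          using gh(2) unfolding adjoin_Suc colon_def by blast
        moreover have "f \<in> forms n s"
          using f gradedD(2)[OF graded_adjoin[OF graded_colon[OF J l'] l]] by blast
        ultimately show "f \<in> colon n l' (adjoin n l J) s" by (simp add: colon_def)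
      qed
      have sub2: "adjoin n l (adjoin n l' J) d \<subseteq> adjoin n l' (adjoin n l J) d"
      proof
        fix f assume "f \<in> adjoin n l (adjoin n l' J) d"
        then obtain g h h' where gh: "f = (g + l' * h') + l * h" "g \<in> J d" "h \<in> forms n s" "h' \<in> forms n s"
          unfolding s adjoin_Suc by blast
        then have "f = (g + l * h) + l' * h'" by (simp add: algebra_simps)
        then show "f \<in> adjoin n l' (adjoin n l J) d" using gh(2-) unfolding s adjoin_Suc by blast
      qed
      have "e = cod n (colon n l' (adjoin n l J)) s + cod n (adjoin n l' (adjoin n l J)) d"
        using cod_exact[OF graded_adjoin[OF J l] l', of s] u(1) by (simp add: s l_def)
      also have "\<dots> \<le> cod n (adjoin n l (colon n l' J)) s + cod n (adjoin n l (adjoin n l' J)) d"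
        by (intro add_mono cod_antimono graded_colon graded_adjoin J l l' sub1 sub2)
      also have "\<dots> \<le> mac_green s (c - e) + mac_green d e"
        using u by (simp add: l_def)
      finally have "e \<le> mac_green (d - 1) (c - e) + mac_green d e" by (simp add: s)
      then show ?thesis using green_recursion[OF d2(1), of e c] ec by simp
    qed
  qed
  then show ?case
    using e(2) by (elim finite_subset[rotated]) (auto simp: c_def)
qed

text \<open>Since \<open>J\<close> lies in \<open>(J : l)\<close>, the exact sequence bounds the
  increase of the Hilbert function by Green's number of the later value. What remains of that value
  is its \<open>mac_down\<close>, and the Galois connection applies.\<close>

theorem macaulay_bound:
  fixes J :: "nat \<Rightarrow> 'a::field mpol set"
  assumes inf: "infinite (UNIV :: 'a set)" and J: "graded n J" and t: "1 \<le> t"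
  shows "cod n J (Suc t) \<le> mac_up t (cod n J t)"
proof -
  obtain u where u: "cod n (adjoin n (lform n u) J) (Suc t) \<le> mac_green (Suc t) (cod n J (Suc t))"
    using cofinite_ex[OF inf green_restriction[OF inf J, of "Suc t"]] by auto
  have "J t \<subseteq> colon n (lform n u) J t"
  proof
    fix f assume f: "f \<in> J t"
    have "lform n u * f = (\<Sum>i\<le>n. smult_mpol (u ^ i) (var i * f))"
      by (simp add: lform_def sum_distrib_right smult_mpol_mult_left)
    also have "\<dots> \<in> J (Suc t)"
      by (intro mpol.subspace_sum mpol.subspace_scale gradedD[OF J] f) simp
    finally show "f \<in> colon n (lform n u) J t" using f gradedD(2)[OF J] by (auto simp: colon_def)
  qed
  then have "cod n (colon n (lform n u) J) t \<le> cod n J t"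
    by (rule cod_antimono[OF graded_colon[OF J lform_forms]])
  then have "cod n J (Suc t) \<le> cod n J t + mac_green (Suc t) (cod n J (Suc t))"
    using cod_exact[OF J lform_forms, of t u] u by simp
  then have "mac_down (Suc t) (cod n J (Suc t)) \<le> cod n J t"
    using mac_down_add_green[of "Suc t" "cod n J (Suc t)"] by simp
  then show ?thesis using mac_down_le_iff[OF t] by simp
qed

subsection \<open>Saturated ideals\<close>

lemma poly_ring_mult: "f \<in> poly_ring n \<Longrightarrow> g \<in> poly_ring n \<Longrightarrow> f * g \<in> poly_ring n"
proof -
  assume f: "f \<in> poly_ring n" and g: "g \<in> poly_ring n"
  have "Poly_Mapping.keys m \<subseteq> {..n}" if m: "m \<in> Poly_Mapping.keys (f * g)" for m
  proof -
    obtain a b where "m = a + b" "a \<in> Poly_Mapping.keys f" "b \<in> Poly_Mapping.keys g"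
      using m keys_mult[of f g] by blast
    then show ?thesis using f g Poly_Mapping.keys_add[of a b] by (fastforce simp: poly_ring_def)
  qed
  then show ?thesis by (auto simp: poly_ring_def)
qed

lemma forms_poly_ring: "f \<in> forms n d \<Longrightarrow> f \<in> poly_ring n"
  by (simp add: forms_def)

lemma var_poly_ring: "i \<le> n \<Longrightarrow> var i \<in> poly_ring n"
  by (rule forms_poly_ring[OF var_forms])

lemma ideal_mult_left: "is_ideal n I \<Longrightarrow> f \<in> I \<Longrightarrow> g \<in> poly_ring n \<Longrightarrow> g * f \<in> I"
  and ideal_subset: "is_ideal n I \<Longrightarrow> I \<subseteq> poly_ring n"
  by (auto simp: is_ideal_def)

lemma subspace_ideal:
  assumes "is_ideal n (I :: 'a::field mpol set)"
  shows "mpol.subspace I"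
proof -
  have "Poly_Mapping.single 0 c \<in> poly_ring n" for c :: 'a
    by (simp add: poly_ring_def)
  then show ?thesis
    using assms by (auto simp: is_ideal_def smult_mpol_def intro!: mpol.subspaceI)
qed

lemma graded_ideal:
  assumes I: "is_ideal n I"
  shows "graded n (\<lambda>d. I \<inter> forms n d)"
  unfolding graded_def
  using mpol.subspace_inter[OF subspace_ideal[OF I] subspace_forms]
    ideal_mult_left[OF I] var_poly_ring var_mult_forms by blast

lemma cod_ideal: "cod n (\<lambda>d. I \<inter> forms n d) d = hilbert_fun n I d"
  by (simp add: cod_def hilbert_fun_def)

lemma saturated_var:
  fixes I :: "'a::field mpol set"
  assumes I: "is_ideal n I" "is_saturated n I" and f: "f \<in> poly_ring n"
    and var: "\<And>i. i \<le> n \<Longrightarrow> var i * f \<in> I"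
  shows "f \<in> I"
proof -
  have sub: "mpol.subspace {g. g * f \<in> I}"
    using subspace_ideal[OF I(1)] by (auto simp: mpol.subspace_def distrib_right smult_mpol_mult_left)
  have "forms n (Suc 0) \<subseteq> {g. g * f \<in> I}"
  proof (rule forms_Suc_subset[OF sub])
    fix i and g :: "'a mpol" assume "i \<le> n" "g \<in> forms n 0"
    then have "g * (var i * f) \<in> I"
      by (intro ideal_mult_left[OF I(1) var] forms_poly_ring[of g n 0])
    then show "var i * g \<in> {g. g * f \<in> I}" by (simp add: ac_simps)
  qed
  then show ?thesis using I(2) f unfolding is_saturated_def by blast
qed

text \<open>
  McCoy's theorem for the polynomial \<open>var 0 + var 1 u + \<dots> + var n u^n\<close> over \<open>S/I\<close>: multiplying a
  cofactor of least degree by the last variable not killing it lowers the degree.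
\<close>

lemma mccoy:
  fixes I :: "'a::field mpol set"
  assumes I: "is_ideal n I" "is_saturated n I"
    and "\<And>k. f k \<in> poly_ring n" "\<And>k. d < k \<Longrightarrow> f k = 0"
    and "\<And>s. (\<Sum>i\<le>n. if i \<le> s then var i * f (s - i) else 0) \<in> I"
  shows "f k \<in> I"
  using assms(3-)
proof (induction d arbitrary: f k rule: less_induct)
  case (less d)
  note sub = subspace_ideal[OF I(1)]
  have *: "i \<le> n \<Longrightarrow> \<forall>k. var i * f k \<in> I" for i
  proof (induction "n - i" arbitrary: i rule: less_induct)
    case inner: less
    have above: "var j * f k \<in> I" if "i < j" "j \<le> n" for j k
      using inner.hyps[of j] that by simp
    \<comment> \<open>The coefficient at \<open>u^(i + d)\<close>. Apart from
      \<open>var i * f d\<close>, terms with \<open>j < i\<close> involve \<open>f\<close> beyond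
      degree \<open>d\<close>, and those with \<open>j > i\<close> are in \<open>I\<close> by the
      inner induction.\<close>
    have eq: "(\<Sum>j\<le>n. if j \<le> i + d then var j * f (i + d - j) else 0) =
        var i * f d + (\<Sum>j\<in>{..n} - {i}. if j \<le> i + d then var j * f (i + d - j) else 0)"
      using inner.prems by (subst sum.remove[of _ i]) auto
    have "(\<Sum>j\<in>{..n} - {i}. if j \<le> i + d then var j * f (i + d - j) else 0) \<in> I"
    proof (rule mpol.subspace_sum[OF sub])
      fix j assume "j \<in> {..n} - {i}"
      then consider "j < i" | "i < j" "j \<le> n" by force
      then show "(if j \<le> i + d then var j * f (i + d - j) else 0) \<in> I"
        using above less.prems(2)[of "i + d - j"] mpol.subspace_0[OF sub] by cases auto
    qed
    from mpol.subspace_diff[OF sub less.prems(3)[of "i + d"] this]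
    have top: "var i * f d \<in> I" unfolding eq by simp
    show ?case
    proof (cases d)
      case 0
      then have "var i * f k \<in> I" for k
        using top less.prems(2)[of k] mpol.subspace_0[OF sub] by (cases k) auto
      then show ?thesis by simp
    next
      case (Suc d')
      \<comment> \<open>\<open>var i\<close> times the cofactor, without its top coefficient. That
        coefficient lies in \<open>I\<close>, so the relation modulo \<open>I\<close> persists with
        smaller degree.\<close>
      define g where "g k = (if k = d then 0 else var i * f k)" for k
      have gI: "g k \<in> I" for k
      proof (rule less.IH[of d'])
        show "d' < d" using Suc by simp
        show "g k \<in> poly_ring n" for k
          using poly_ring_mult[OF var_poly_ring[OF inner.prems] less.prems(1)]
          by (auto simp: g_def) (simp add: poly_ring_def)
        show "g k = 0" if "d' < k" for k
          using that less.prems(2)[of k] Suc by (auto simp: g_def)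
        fix s
        have "(\<Sum>j\<le>n. if j \<le> s then var j * g (s - j) else 0) =
          var i * (\<Sum>j\<le>n. if j \<le> s then var j * f (s - j) else 0) -
          (\<Sum>j\<le>n. if j \<le> s \<and> s - j = d then var j * (var i * f d) else 0)"
          unfolding sum_distrib_left sum_subtractf [symmetric]
          by (intro sum.cong) (auto simp: g_def ac_simps)
        also have "\<dots> \<in> I"
        proof (rule mpol.subspace_diff[OF sub])
          show "var i * (\<Sum>j\<le>n. if j \<le> s then var j * f (s - j) else 0) \<in> I"
            by (rule ideal_mult_left[OF I(1) less.prems(3) var_poly_ring[OF inner.prems]])
          show "(\<Sum>j\<le>n. if j \<le> s \<and> s - j = d then var j * (var i * f d) else 0) \<in> I"
            using ideal_mult_left[OF I(1) top var_poly_ring] mpol.subspace_0[OF sub]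
            by (intro mpol.subspace_sum[OF sub]) auto
        qed
        finally show "(\<Sum>j\<le>n. if j \<le> s then var j * g (s - j) else 0) \<in> I" .
      qed
      have "var i * f k \<in> I" for k
        using top gI[of k] by (cases "k = d") (auto simp: g_def)
      then show ?thesis by simp
    qed
  qed
  show ?case
    using * by (intro saturated_var[OF I less.prems(1)]) auto
qed

lemma coeff_mult_lform_poly:
  "coeff (c * lform_poly n b m) s =
     (\<Sum>i\<le>n. if i \<le> s then coeff c (s - i) * Poly_Mapping.lookup (var i * b) m else 0)"
proof -
  have "c * lform_poly n b m = (\<Sum>i\<le>n. monom (Poly_Mapping.lookup (var i * b) m) i * c)"
    unfolding lform_poly_def sum_distrib_left by (rule sum.cong) (rule refl, rule mult.commute)
  then show ?thesis
    by (simp only: coeff_sum coeff_monom_mult) (auto intro!: sum.cong)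
qed

text \<open>With a basis \<open>E\<close> of \<open>I\<close> in degree \<open>Suc d\<close> and a
  basis \<open>B\<close> of a complement of \<open>I\<close> in degree \<open>d\<close>, failure in
  degree \<open>d\<close> means a nontrivial relation between \<open>E\<close> and the products of
  \<open>B\<close> with the form. McCoy's theorem excludes such a relation over \<open>K[u]\<close>,
  and specialising leaves finitely many exceptions.\<close>

lemma generic_nonzerodivisor:
  fixes I :: "'a::field mpol set"
  assumes I: "is_ideal n I" "is_saturated n I"
  shows "finite {u. \<exists>f\<in>forms n d. f \<notin> I \<and> lform n u * f \<in> I}"
proof -
  note sub = subspace_ideal[OF I(1)]
  have subI: "mpol.subspace (I \<inter> forms n k)" for k
    by (rule mpol.subspace_inter[OF sub subspace_forms])
  obtain E where E: "E \<subseteq> I \<inter> forms n (Suc d)" "mpol.independent E"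
      "I \<inter> forms n (Suc d) \<subseteq> mpol.span E" "card E = mpol.dim (I \<inter> forms n (Suc d))"
    by (rule mpol.basis_exists[of "I \<inter> forms n (Suc d)"])
  obtain B where B: "B \<subseteq> forms n d" "mpol.independent B" "mpol.span B \<inter> (I \<inter> forms n d) = {0}"
      "forms n d \<subseteq> {b + w | b w. b \<in> mpol.span B \<and> w \<in> I \<inter> forms n d}"
    by (rule mpol.complement_exists[OF subI[of d] _ subspace_forms]) auto
  have finE: "finite E"
    by (rule mpol.fin_dim_independent[OF fin_dim_forms[of n "Suc d"] _ E(2)]) (use E in auto)
  have finB: "finite B"
    by (rule mpol.fin_dim_independent[OF fin_dim_forms[of n d] B(1,2)])
  have spB: "mpol.span B \<subseteq> forms n d" using B(1) subspace_forms by (rule mpol.span_minimal)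
  define v :: "'a mpol + 'a mpol \<Rightarrow> (nat \<Rightarrow>\<^sub>0 nat) \<Rightarrow> 'a poly" where
    "v a m = (case a of Inl e \<Rightarrow> [:Poly_Mapping.lookup e m:] | Inr b \<Rightarrow> lform_poly n b m)" for a m
  let ?A = "E <+> B"
  let ?bad = "{u. \<exists>c. (\<forall>m. (\<Sum>a\<in>?A. c a * poly (v a m) u) = 0) \<and> \<not> (\<forall>a\<in>?A. c a = 0)}"
  have "finite ?bad"
  proof (rule poly_relation_specialise)
    show "finite ?A" using finE finB by simp
    fix c :: "'a mpol + 'a mpol \<Rightarrow> 'a poly"
    assume c: "\<And>m. (\<Sum>a\<in>?A. c a * v a m) = 0"
    define f where "f k = (\<Sum>b\<in>B. smult_mpol (coeff (c (Inr b)) k) b)" for k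
    define h where "h s = (\<Sum>e\<in>E. smult_mpol (coeff (c (Inl e)) s) e)" for s
    have fB: "f k \<in> mpol.span B" for k
      unfolding f_def by (intro mpol.span_sum mpol.span_scale mpol.span_base)
    have hI: "h s \<in> I" for s
      unfolding h_def using E(1) by (intro mpol.subspace_sum[OF sub] mpol.subspace_scale[OF sub]) auto
    have rel: "(\<Sum>i\<le>n. if i \<le> s then var i * f (s - i) else 0) = - h s" for s
    proof (rule poly_mapping_eqI)
      fix m
      have "0 = coeff (\<Sum>a\<in>?A. c a * v a m) s" using c by simp
      also have "\<dots> = (\<Sum>e\<in>E. coeff (c (Inl e) * [:Poly_Mapping.lookup e m:]) s) +
          (\<Sum>b\<in>B. coeff (c (Inr b) * lform_poly n b m) s)"
        using finE finB by (simp add: sum.Plus v_def coeff_sum)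
      also have "(\<Sum>e\<in>E. coeff (c (Inl e) * [:Poly_Mapping.lookup e m:]) s) = Poly_Mapping.lookup (h s) m"
        by (simp add: h_def lookup_sum mult.commute)
      also have "(\<Sum>b\<in>B. coeff (c (Inr b) * lform_poly n b m) s) =
          (\<Sum>i\<le>n. \<Sum>b\<in>B. if i \<le> s then coeff (c (Inr b)) (s - i) * Poly_Mapping.lookup (var i * b) m else 0)"
        unfolding coeff_mult_lform_poly by (rule sum.swap)
      also have "\<dots> = (\<Sum>i\<le>n. Poly_Mapping.lookup (if i \<le> s then var i * f (s - i) else 0) m)"
        by (intro sum.cong) (auto simp: f_def sum_distrib_left smult_mpol_mult_right lookup_sum)
      also have "\<dots> = Poly_Mapping.lookup (\<Sum>i\<le>n. if i \<le> s then var i * f (s - i) else 0) m"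
        by (simp add: lookup_sum)
      finally show "Poly_Mapping.lookup (\<Sum>i\<le>n. if i \<le> s then var i * f (s - i) else 0) m =
          Poly_Mapping.lookup (- h s) m"
        by (simp add: eq_neg_iff_add_eq_0 add.commute)
    qed
    define D where "D = (\<Sum>b\<in>B. degree (c (Inr b)))"
    have fz: "f k = 0" if "D < k" for k
    proof -
      have "degree (c (Inr b)) < k" if "b \<in> B" for b
        using \<open>D < k\<close> member_le_sum[of b B "\<lambda>b. degree (c (Inr b))"] finB that by (simp add: D_def)
      then show ?thesis by (simp add: f_def coeff_eq_0)
    qed
    have "f k \<in> I" for k
    proof (rule mccoy[OF I _ fz])
      show "f k \<in> poly_ring n" for k using fB[of k] spB by (auto intro: forms_poly_ring)
      show "(\<Sum>i\<le>n. if i \<le> s then var i * f (s - i) else 0) \<in> I" for s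
        unfolding rel using mpol.subspace_neg[OF sub hI] .
    qed
    then have "f k = 0" for k using fB[of k] spB B(3) by auto
    then have cB: "coeff (c (Inr b)) k = 0" if "b \<in> B" for b k
      using mpol.independentD[OF B(2) finB subset_refl _ that, of "\<lambda>b. coeff (c (Inr b)) k"]
      by (simp add: f_def)
    then have "f k = 0" for k by (simp add: f_def)
    then have "h s = 0" for s using rel[of s] by (simp cong: if_cong)
    then have cE: "coeff (c (Inl e)) k = 0" if "e \<in> E" for e k
      using mpol.independentD[OF E(2) finE subset_refl _ that, of "\<lambda>e. coeff (c (Inl e)) k"]
      by (simp add: h_def)
    show "\<forall>a\<in>?A. c a = 0" using cB cE by (auto simp: poly_eq_iff)
  qed
  moreover have "{u. \<exists>f\<in>forms n d. f \<notin> I \<and> lform n u * f \<in> I} \<subseteq> ?bad"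
  proof
    fix u assume "u \<in> {u. \<exists>f\<in>forms n d. f \<notin> I \<and> lform n u * f \<in> I}"
    then obtain f where f: "f \<in> forms n d" "f \<notin> I" "lform n u * f \<in> I" by blast
    \<comment> \<open>The component \<open>b\<close> in the complement is nonzero because
      \<open>f\<close> is not in \<open>I\<close>, and multiplication by the form sends it into
      \<open>I\<close> as well.\<close>
    obtain b w where bw: "f = b + w" "b \<in> mpol.span B" "w \<in> I \<inter> forms n d" using B(4) f(1) by blast
    have "lform n u * w \<in> I"
      using bw(3) forms_poly_ring[OF lform_forms] by (intro ideal_mult_left[OF I(1)]) auto
    then have "lform n u * f - lform n u * w \<in> I" using f(3) mpol.subspace_diff[OF sub] by blast
    moreover have "lform n u * f - lform n u * w = lform n u * b" by (simp add: bw(1) algebra_simps)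
    ultimately have lb: "lform n u * b \<in> I" by simp
    have "lform n u * b \<in> forms n (Suc d)"
      by (rule linear_form_mult[OF lform_forms subsetD[OF spB bw(2)]])
    then have "lform n u * b \<in> mpol.span E" using E(3) lb by blast
    then obtain s where s: "lform n u * b = (\<Sum>e\<in>E. smult_mpol (s e) e)"
      unfolding mpol.span_finite[OF finE] by blast
    obtain r where r: "b = (\<Sum>x\<in>B. smult_mpol (r x) x)"
      using bw(2) unfolding mpol.span_finite[OF finB] by blast
    define c where "c a = (case a of Inl e \<Rightarrow> - s e | Inr x \<Rightarrow> r x)" for a
    have "(\<Sum>a\<in>?A. c a * poly (v a m) u) = 0" for m
    proof -
      have "(\<Sum>a\<in>?A. c a * poly (v a m) u) =
          - (\<Sum>e\<in>E. s e * Poly_Mapping.lookup e m) + (\<Sum>x\<in>B. r x * Poly_Mapping.lookup (lform n u * x) m)"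
        using finE finB by (simp add: sum.Plus c_def v_def sum_negf lookup_lform_mult)
      also have "(\<Sum>x\<in>B. r x * Poly_Mapping.lookup (lform n u * x) m) = Poly_Mapping.lookup (lform n u * b) m"
        by (simp add: r sum_distrib_left smult_mpol_mult_right lookup_sum)
      also have "\<dots> = (\<Sum>e\<in>E. s e * Poly_Mapping.lookup e m)"
        by (simp add: s lookup_sum)
      finally show ?thesis by simp
    qed
    moreover have "\<not> (\<forall>a\<in>?A. c a = 0)"
    proof
      assume "\<forall>a\<in>?A. c a = 0"
      then have "r x = 0" if "x \<in> B" for x using that by (auto simp: c_def dest!: bspec[of _ _ "Inr x"])
      then have "b = 0" by (simp add: r)
      then show False using bw f by simp
    qed
    ultimately show "u \<in> ?bad" by blast
  qed
  ultimately show ?thesis by (rule finite_subset[rotated])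
qed

text \<open>
  O-sequences in the sense of Macaulay; there is no condition at \<open>t = 0\<close>, where no expansion exists.
\<close>

definition o_seq :: "(nat \<Rightarrow> nat) \<Rightarrow> bool" where
  "o_seq h \<longleftrightarrow> h 0 = 1 \<and> (\<forall>t\<ge>1. h (Suc t) \<le> mac_up t (h t))"

text \<open>Subtraction is truncated, so summation recovers the function only if it is
  nondecreasing; hence \<open>mono\<close> accompanies this notion.\<close>

definition first_diff :: "(nat \<Rightarrow> nat) \<Rightarrow> nat \<Rightarrow> nat" where
  "first_diff H t = (case t of 0 \<Rightarrow> H 0 | Suc s \<Rightarrow> H (Suc s) - H s)"

lemma first_diff_simps [simp]:
  "first_diff H 0 = H 0" "first_diff H (Suc t) = H (Suc t) - H t"
  by (simp_all add: first_diff_def)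

text \<open>For a nonzerodivisor \<open>l\<close> the first difference is the Hilbert function of
  \<open>S/(I + (l))\<close>. That ideal may fail to be saturated, but Macaulay's bound holds for
  every graded ideal.\<close>

lemma scheme_mono_macaulay:
  fixes I :: "'a::field mpol set"
  assumes inf: "infinite (UNIV :: 'a set)" and I: "is_scheme n I"
  shows "hilbert_fun n I t \<le> hilbert_fun n I (Suc t)"
    and "1 \<le> t \<Longrightarrow> hilbert_fun n I (Suc t) \<le> mac_up t (hilbert_fun n I t)"
    and "1 \<le> t \<Longrightarrow> hilbert_fun n I (Suc t) - hilbert_fun n I t
      \<le> mac_up t (hilbert_fun n I t - hilbert_fun n I (t - 1))"
proof -
  have id: "is_ideal n I" and sat: "is_saturated n I" using I by (auto simp: is_scheme_def)
  let ?J = "\<lambda>d. I \<inter> forms n d"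
  have J: "graded n ?J" by (rule graded_ideal[OF id])
  have ex: "hilbert_fun n I (Suc d) = hilbert_fun n I d + cod n (adjoin n (lform n u) ?J) (Suc d)"
    if "u \<notin> {u. \<exists>f\<in>forms n d. f \<notin> I \<and> lform n u * f \<in> I}" for u d
  proof -
    have "colon n (lform n u) ?J d = ?J d"
      using that linear_form_mult[OF lform_forms] ideal_mult_left[OF id _ forms_poly_ring[OF lform_forms]]
      by (auto simp: colon_def)
    then have "cod n (colon n (lform n u) ?J) d = hilbert_fun n I d"
      by (simp add: cod_def hilbert_fun_def)
    then show ?thesis using cod_exact[OF J lform_forms, of d u] by (simp add: cod_ideal)
  qed
  obtain u where "u \<notin> {u. \<exists>f\<in>forms n t. f \<notin> I \<and> lform n u * f \<in> I}"
    using ex_new_if_finite[OF inf generic_nonzerodivisor[OF id sat]] by blast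
  then show "hilbert_fun n I t \<le> hilbert_fun n I (Suc t)" using ex by simp
  show "hilbert_fun n I (Suc t) \<le> mac_up t (hilbert_fun n I t)" if "1 \<le> t"
    using macaulay_bound[OF inf J that] by (simp add: cod_ideal)
  assume t: "1 \<le> t"
  obtain s where s: "t = Suc s" using t by (cases t) auto
  \<comment> \<open>Two consecutive differences must come from the same quotient, so one form has to
    work in degrees \<open>s\<close> and \<open>t\<close>.\<close>
  have "finite ({u. \<exists>f\<in>forms n t. f \<notin> I \<and> lform n u * f \<in> I} \<union>
      {u. \<exists>f\<in>forms n s. f \<notin> I \<and> lform n u * f \<in> I})"
    using generic_nonzerodivisor[OF id sat] by simp
  from ex_new_if_finite[OF inf this] obtain u where
    u: "u \<notin> {u. \<exists>f\<in>forms n t. f \<notin> I \<and> lform n u * f \<in> I}"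
       "u \<notin> {u. \<exists>f\<in>forms n s. f \<notin> I \<and> lform n u * f \<in> I}" by blast
  show "hilbert_fun n I (Suc t) - hilbert_fun n I t
      \<le> mac_up t (hilbert_fun n I t - hilbert_fun n I (t - 1))"
    using macaulay_bound[OF inf graded_adjoin[OF J lform_forms] t, of u] ex[OF u(1)] ex[OF u(2)] s by simp
qed

lemma hilbert_fun_0:
  fixes I :: "'a::field mpol set"
  assumes I: "is_ideal n I"
  shows "1 \<notin> I \<Longrightarrow> hilbert_fun n I 0 = 1" and "1 \<in> I \<Longrightarrow> hilbert_fun n I t = 0"
proof -
  assume "1 \<in> I"
  then have "I = poly_ring n"
    using ideal_subset[OF I] ideal_mult_left[OF I, of 1] by auto
  then have "I \<inter> forms n t = forms n t" by (auto simp: forms_def)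
  then show "hilbert_fun n I t = 0" by (simp add: hilbert_fun_def)
next
  assume 1: "1 \<notin> I"
  have one: "(1 :: 'a mpol) \<in> forms n 0" by (simp add: forms_def poly_ring_def)
  have f0: "f \<in> mpol.span {1}" if f: "f \<in> forms n 0" for f :: "'a mpol"
  proof -
    have "m = 0" if m: "m \<in> Poly_Mapping.keys f" for m
    proof (rule ccontr)
      assume "m \<noteq> 0"
      then obtain i where "i \<in> Poly_Mapping.keys m" by (meson keys_eq_empty ex_in_conv)
      then have "0 < mon_deg m" by (auto simp: mon_deg_def in_keys_iff intro!: sum_pos2[of _ i])
      then show False using f m by (auto simp: forms_def)
    qed
    then have "f = smult_mpol (Poly_Mapping.lookup f 0) 1"
      by (intro poly_mapping_eqI) (auto simp: lookup_one when_def in_keys_iff)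
    then show ?thesis by (metis mpol.span_base mpol.span_scale insertI1)
  qed
  have z: "mpol.span {1} \<inter> I = {0}"
  proof -
    have "f = 0" if f: "f \<in> mpol.span {1}" "f \<in> I" for f
    proof (rule ccontr)
      assume "f \<noteq> 0"
      obtain c where c: "f = smult_mpol c 1"
        using f(1) by (auto simp: mpol.span_singleton)
      then have "c \<noteq> 0" using \<open>f \<noteq> 0\<close> by auto
      then have "1 = smult_mpol (inverse c) f" by (simp add: c)
      then show False using 1 mpol.subspace_scale[OF subspace_ideal[OF I] f(2)] by metis
    qed
    then show ?thesis using mpol.span_zero mpol.subspace_0[OF subspace_ideal[OF I]] by auto
  qed
  have "hilbert_fun n I 0 = card {1 :: 'a mpol}"
  proof (rule hilbert_fun_eq_card[OF I _ _ z])
    show "forms n 0 \<subseteq> {b + f | b f. b \<in> mpol.span {1 :: 'a mpol} \<and> f \<in> I \<inter> forms n 0}"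
    proof
      fix f :: "'a mpol" assume "f \<in> forms n 0"
      then have "f = f + 0 \<and> f \<in> mpol.span {1} \<and> 0 \<in> I \<inter> forms n 0"
        using f0 mpol.subspace_0[OF subspace_ideal[OF I]] mpol.subspace_0[OF subspace_forms] by auto
      then show "f \<in> {b + f | b f. b \<in> mpol.span {1 :: 'a mpol} \<and> f \<in> I \<inter> forms n 0}"
        by (intro CollectI exI)
    qed
  qed (use one in auto)
  then show "hilbert_fun n I 0 = 1" by simp
qed

lemma scheme_o_seq:
  fixes I :: "'a::field mpol set"
  assumes inf: "infinite (UNIV :: 'a set)" and I: "is_scheme n I" "1 \<notin> I"
  shows "mono (hilbert_fun n I)" "o_seq (hilbert_fun n I)" "o_seq (first_diff (hilbert_fun n I))"
proof -
  have H0: "hilbert_fun n I 0 = 1" using hilbert_fun_0(1) I by (auto simp: is_scheme_def)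
  note H = scheme_mono_macaulay[OF inf I(1)]
  show "mono (hilbert_fun n I)" using H(1) by (simp add: mono_iff_le_Suc)
  show "o_seq (hilbert_fun n I)" using H(2) H0 by (auto simp: o_seq_def)
  show "o_seq (first_diff (hilbert_fun n I))"
    unfolding o_seq_def
  proof (intro conjI allI impI)
    fix t :: nat assume t: "1 \<le> t"
    then obtain s where "t = Suc s" by (cases t) auto
    then show "first_diff (hilbert_fun n I) (Suc t) \<le> mac_up t (first_diff (hilbert_fun n I) t)"
      using H(3)[OF t] by simp
  qed (simp add: H0)
qed

subsection \<open>Lexicographic segments\<close>

abbreviation pvar :: "nat \<Rightarrow> nat \<Rightarrow>\<^sub>0 nat" where
  "pvar i \<equiv> Poly_Mapping.single i (Suc 0)"

text \<open>The variable \<open>x_0\<close> is left out; it is reserved as the nonzerodivisor of the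
  scheme to be built.\<close>

definition mons :: "nat \<Rightarrow> nat \<Rightarrow> (nat \<Rightarrow>\<^sub>0 nat) set" where
  "mons n t = {m. Poly_Mapping.keys m \<subseteq> {1..n} \<and> mon_deg m = t}"

lemma keys_pvar_add: "Poly_Mapping.keys (pvar i + m) = insert i (Poly_Mapping.keys m)"
  by (auto simp: in_keys_iff lookup_add lookup_single when_def split: if_splits)

lemma pvar_add_diff: "i \<in> Poly_Mapping.keys m \<Longrightarrow> pvar i + (m - pvar i) = m"
  by (intro poly_mapping_eqI) (auto simp: lookup_add lookup_minus lookup_single when_def in_keys_iff)

lemma mon_deg_diff_pvar: "i \<in> Poly_Mapping.keys m \<Longrightarrow> mon_deg m = Suc (mon_deg (m - pvar i))"
  using mon_deg_add[of "pvar i" "m - pvar i"] pvar_add_diff[of i m] by simp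

lemma keys_diff_pvar_subset: "Poly_Mapping.keys (m - pvar i) \<subseteq> Poly_Mapping.keys m"
  by (auto simp: in_keys_iff lookup_minus)

lemma pvar_add_diff_other:
  "i \<noteq> j \<Longrightarrow> i \<in> Poly_Mapping.keys m \<Longrightarrow> (pvar j + m) - pvar i = pvar j + (m - pvar i)"
  by (intro poly_mapping_eqI) (auto simp: lookup_add lookup_minus lookup_single when_def in_keys_iff)

lemma mon_deg_eq_0_iff: "mon_deg m = 0 \<longleftrightarrow> m = 0"
proof
  assume *: "mon_deg m = 0"
  have "Poly_Mapping.keys m = {}"
  proof (rule ccontr)
    assume "Poly_Mapping.keys m \<noteq> {}"
    then obtain i where "i \<in> Poly_Mapping.keys m" by blast
    then show False using mon_deg_diff_pvar[of i m] * by simp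
  qed
  then show "m = 0" by simp
qed simp

lemma finite_mons: "finite (mons n t)"
  by (rule finite_subset[OF _ finite_monomials_degree[of n t]]) (auto simp: mons_def)

lemma mons_0: "mons n 0 = {0}"
  by (auto simp: mons_def mon_deg_eq_0_iff)

lemma mons_mono: "n \<le> n' \<Longrightarrow> mons n t \<subseteq> mons n' t"
  by (auto simp: mons_def)

lemma mons_Suc_Suc: "mons (Suc n) (Suc t) = mons n (Suc t) \<union> (+) (pvar (Suc n)) ` mons (Suc n) t"
proof (intro equalityI subsetI)
  fix m assume m: "m \<in> mons (Suc n) (Suc t)"
  show "m \<in> mons n (Suc t) \<union> (+) (pvar (Suc n)) ` mons (Suc n) t"
  proof (cases "Suc n \<in> Poly_Mapping.keys m")
    case True
    have "m - pvar (Suc n) \<in> mons (Suc n) t"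
      using m keys_diff_pvar_subset[of m "Suc n"] mon_deg_diff_pvar[OF True] by (auto simp: mons_def)
    then show ?thesis using pvar_add_diff[OF True] by (metis UnI2 imageI)
  next
    case False
    then have "Poly_Mapping.keys m \<subseteq> {1..n}" using m by (force simp: mons_def le_Suc_eq)
    then show ?thesis using m by (simp add: mons_def)
  qed
next
  fix m assume "m \<in> mons n (Suc t) \<union> (+) (pvar (Suc n)) ` mons (Suc n) t"
  then show "m \<in> mons (Suc n) (Suc t)"
    by (auto simp: mons_def keys_pvar_add mon_deg_add)
qed

lemma not_in_mons: "n < i \<Longrightarrow> pvar i + m \<notin> mons n t"
  by (auto simp: mons_def keys_pvar_add)

lemma card_mons_Suc_Suc:
  "card (mons (Suc n) (Suc t)) = card (mons n (Suc t)) + card (mons (Suc n) t)"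
proof -
  have "mons n (Suc t) \<inter> (+) (pvar (Suc n)) ` mons (Suc n) t = {}"
    using not_in_mons[of n "Suc n"] by auto
  then have "card (mons (Suc n) (Suc t)) = card (mons n (Suc t)) + card ((+) (pvar (Suc n)) ` mons (Suc n) t)"
    unfolding mons_Suc_Suc by (intro card_Un_disjoint) (simp_all add: finite_mons)
  then show ?thesis by (simp add: card_image)
qed

lemma card_mons: "card (mons (Suc k) t) = (t + k) choose k"
proof (induction k arbitrary: t)
  case 0
  have "mons 0 (Suc t) = {}" for t by (auto simp: mons_def)
  then show ?case by (induction t) (simp_all add: mons_0 card_mons_Suc_Suc)
next
  case (Suc k)
  note IH = Suc.IH
  show ?case
  proof (induction t)
    case (Suc t)
    then show ?case
      using IH[of "Suc t"] choose_Suc_add[of "Suc t" k] by (simp add: card_mons_Suc_Suc)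
  qed (simp add: mons_0)
qed

text \<open>The smallest monomials for the lexicographic order in which later variables are larger:
  those in the first \<open>k + 1\<close> variables, counted by \<open>(t + k choose k)\<close>, and
  then multiples of the next variable \<open>x_(k+2)\<close>.\<close>

fun seg :: "nat \<Rightarrow> nat list \<Rightarrow> (nat \<Rightarrow>\<^sub>0 nat) set" where
  "seg t [] = {}"
| "seg t (k # ks) = mons (Suc k) t \<union> (+) (pvar (k + 2)) ` seg (t - 1) ks"

lemma seg_subset_mons:
  "mac_list t ks \<Longrightarrow> \<forall>x\<in>set ks. x \<le> k \<Longrightarrow> seg t ks \<subseteq> mons (k + 2) t"
proof (induction ks arbitrary: t k)
  case (Cons l ks)
  obtain s where s: "t = Suc s" using Cons.prems by (cases t) auto
  have "seg s ks \<subseteq> mons (l + 2) s" using Cons s by simp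
  then have "(+) (pvar (l + 2)) ` seg s ks \<subseteq> mons (l + 2) t"
    unfolding s using mons_Suc_Suc[of "l + 1" s] by auto
  moreover have "mons (Suc l) t \<subseteq> mons (k + 2) t" "mons (l + 2) t \<subseteq> mons (k + 2) t"
    using Cons.prems by (intro mons_mono; simp)+
  ultimately show ?case using s by auto
qed simp

lemma finite_seg: "finite (seg t ks)"
  by (induction t ks rule: seg.induct) (auto simp: finite_mons)

lemma card_seg: "card (seg t ks) = mac_val t ks"
proof (induction t ks rule: seg.induct)
  case (2 t k ks)
  have "mons (Suc k) t \<inter> (+) (pvar (k + 2)) ` seg (t - 1) ks = {}"
    using not_in_mons[of "Suc k" "k + 2"] by auto
  then have "card (seg t (k # ks)) = card (mons (Suc k) t) + card ((+) (pvar (k + 2)) ` seg (t - 1) ks)"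
    unfolding seg.simps by (intro card_Un_disjoint) (simp_all add: finite_mons finite_seg)
  then show ?case using 2 by (simp add: card_mons card_image)
qed simp

lemma seg_mono: "list_less ks ls \<Longrightarrow> mac_list t ks \<Longrightarrow> mac_list t ls \<Longrightarrow> seg t ks \<subseteq> seg t ls"
proof (induction ks ls arbitrary: t rule: list_less.induct)
  case (3 k ks l ls)
  show ?case
  proof (cases "k = l")
    case True
    then show ?thesis using 3 by auto
  next
    case False
    then have "k < l" using 3 by simp
    have "seg t (k # ks) \<subseteq> mons (k + 2) t"
      using 3 by (intro seg_subset_mons) auto
    also have "\<dots> \<subseteq> mons (Suc l) t" using \<open>k < l\<close> by (intro mons_mono) simp
    finally show ?thesis by auto
  qed
qed auto

text \<open>Reading one list in two consecutive degrees is the case of equality in Macaulay's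
  bound.\<close>

lemma seg_shadow:
  "mac_list t ks \<Longrightarrow> m \<in> seg (Suc t) ks \<Longrightarrow> i \<in> Poly_Mapping.keys m \<Longrightarrow> m - pvar i \<in> seg t ks"
proof (induction ks arbitrary: t m i)
  case (Cons k ks)
  obtain s where s: "t = Suc s" using Cons.prems by (cases t) auto
  have ks: "mac_list s ks" "\<forall>x\<in>set ks. x \<le> k" using Cons.prems s by auto
  consider "m \<in> mons (Suc k) (Suc t)" | m' where "m = pvar (k + 2) + m'" "m' \<in> seg t ks"
    using Cons.prems(2) by auto
  then show ?case
  proof cases
    case 1
    then have "m - pvar i \<in> mons (Suc k) t"
      using keys_diff_pvar_subset[of m i] mon_deg_diff_pvar[OF Cons.prems(3)] by (auto simp: mons_def)
    then show ?thesis by simp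
  next
    case (2 m')
    have IH: "m' - pvar j \<in> seg s ks" if "j \<in> Poly_Mapping.keys m'" for j
      using Cons.IH[OF ks(1) _ that] 2 s by simp
    have "mac_list t ks" using mac_list_mono[OF ks(1)] s by simp
    then have m': "m' \<in> mons (k + 2) t"
      using seg_subset_mons[of t ks k] ks(2) 2(2) by blast
    show ?thesis
    proof (cases "i = k + 2")
      case True
      then have eq: "m - pvar i = m'" using 2 by simp
      \<comment> \<open>\<open>m'\<close> is known to lie in the tail segment in degree
        \<open>t\<close>, whereas that segment enters \<open>seg t (k # ks)\<close> in degree
        \<open>s\<close>. Whether \<open>m'\<close> still contains \<open>x_(k+2)\<close> decides
        which half receives it.\<close>
      show ?thesis
      proof (cases "k + 2 \<in> Poly_Mapping.keys m'")
        case True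
        then have "m' = pvar (k + 2) + (m' - pvar (k + 2))" by (simp only: pvar_add_diff)
        then have "m' \<in> (+) (pvar (k + 2)) ` seg s ks" using IH[OF True] by (rule image_eqI)
        then show ?thesis using eq s by simp
      next
        case False
        then have "m' \<in> mons (Suc k) t" using m' by (force simp: mons_def le_Suc_eq)
        then show ?thesis using eq by simp
      qed
    next
      case False
      then have i: "i \<in> Poly_Mapping.keys m'" using Cons.prems(3) 2 by (simp add: keys_pvar_add)
      then have "m - pvar i = pvar (k + 2) + (m' - pvar i)"
        unfolding 2 using False by (intro pvar_add_diff_other) auto
      then show ?thesis using IH[OF i] s by auto
    qed
  qed
qed simp

subsection \<open>Schemes with prescribed Hilbert function\<close>

text \<open>Dehomogenisation of a monomial, setting \<open>x_0\<close> to 1.\<close>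

definition strip0 :: "(nat \<Rightarrow>\<^sub>0 nat) \<Rightarrow> (nat \<Rightarrow>\<^sub>0 nat)" where
  "strip0 m = m - Poly_Mapping.single 0 (Poly_Mapping.lookup m 0)"

lemma lookup_strip0: "Poly_Mapping.lookup (strip0 m) i = (if i = 0 then 0 else Poly_Mapping.lookup m i)"
  by (simp add: strip0_def lookup_minus lookup_single when_def)

lemma strip0_add: "strip0 (m + m') = strip0 m + strip0 m'"
  by (intro poly_mapping_eqI) (simp add: lookup_strip0 lookup_add)

lemma strip0_single: "strip0 (Poly_Mapping.single 0 k) = 0"
  by (intro poly_mapping_eqI) (simp add: lookup_strip0 lookup_single when_def)

lemma strip0_decomp: "m = strip0 m + Poly_Mapping.single 0 (Poly_Mapping.lookup m 0)"
  by (intro poly_mapping_eqI) (simp add: lookup_strip0 lookup_add lookup_single when_def)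

lemma strip0_id: "0 \<notin> Poly_Mapping.keys m \<Longrightarrow> strip0 m = m"
  by (intro poly_mapping_eqI) (auto simp: lookup_strip0 in_keys_iff)

lemma keys_add_nat: "Poly_Mapping.keys (m + m') = Poly_Mapping.keys m \<union> Poly_Mapping.keys m'"
  for m m' :: "nat \<Rightarrow>\<^sub>0 nat"
  by (auto simp: in_keys_iff lookup_add)

lemma lookup_single_mult:
  fixes f :: "'a::field mpol"
  shows "Poly_Mapping.lookup (Poly_Mapping.single a 1 * f) (a + m) = Poly_Mapping.lookup f m"
proof -
  have "Poly_Mapping.single a 1 * f =
      (\<Sum>k\<in>Poly_Mapping.keys f. Poly_Mapping.single (a + k) (Poly_Mapping.lookup f k))"
    by (subst mpol_sum_monomials[of f])
       (simp add: sum_distrib_left single_eq_smult_mpol[symmetric] mult_single)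
  then show ?thesis
    by (simp add: lookup_sum lookup_single when_def in_keys_iff)
qed

lemma order_ideal_divisor:
  assumes N: "\<And>m i. m \<in> N \<Longrightarrow> i \<in> Poly_Mapping.keys m \<Longrightarrow> m - pvar i \<in> N"
    and "m + m' \<in> N"
  shows "m' \<in> N"
  using assms(2)
proof (induction "mon_deg m" arbitrary: m)
  case 0
  then show ?case using mon_deg_eq_0_iff[of m] by simp
next
  case (Suc d)
  then have "m \<noteq> 0" by auto
  then obtain i where i: "i \<in> Poly_Mapping.keys m" by (meson keys_eq_empty ex_in_conv)
  have "(m + m') - pvar i = (m - pvar i) + m'"
    using i by (intro poly_mapping_eqI) (auto simp: lookup_add lookup_minus lookup_single when_def in_keys_iff)
  moreover have "(m + m') - pvar i \<in> N" using N Suc.prems i by (simp add: keys_add_nat)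
  ultimately show ?case using Suc.hyps mon_deg_diff_pvar[OF i] by simp
qed

text \<open>
  The ideal spanned by the monomials outside the order ideal \<open>N\<close> in \<open>x\<^sub>1, \<dots>, x\<^sub>n\<close>, extended to
  \<open>K[x\<^sub>0, \<dots>, x\<^sub>n]\<close>; it is saturated because \<open>x\<^sub>0\<close> is a nonzerodivisor modulo it.
\<close>

definition mon_ideal :: "nat \<Rightarrow> (nat \<Rightarrow>\<^sub>0 nat) set \<Rightarrow> 'a::field mpol set" where
  "mon_ideal n N = {f \<in> poly_ring n. \<forall>m\<in>Poly_Mapping.keys f. strip0 m \<notin> N}"

lemma is_scheme_mon_ideal:
  assumes N: "\<And>m i. m \<in> N \<Longrightarrow> i \<in> Poly_Mapping.keys m \<Longrightarrow> m - pvar i \<in> N"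
  shows "is_scheme n (mon_ideal n N :: 'a::field mpol set)"
proof -
  let ?I = "mon_ideal n N :: 'a mpol set"
  have "f + g \<in> ?I" if "f \<in> ?I" "g \<in> ?I" for f g
    using that Poly_Mapping.keys_add[of f g] unfolding mon_ideal_def poly_ring_def by blast
  moreover have "g * f \<in> ?I" if f: "f \<in> ?I" and g: "g \<in> poly_ring n" for f g
  proof -
    have "strip0 m \<notin> N" if m: "m \<in> Poly_Mapping.keys (g * f)" for m
    proof
      assume mN: "strip0 m \<in> N"
      obtain a b where "m = a + b" "b \<in> Poly_Mapping.keys f" using m keys_mult[of g f] by blast
      then show False
        using f order_ideal_divisor[OF N, of "strip0 a" "strip0 b"] mN by (auto simp: strip0_add mon_ideal_def)
    qed
    then show ?thesis using poly_ring_mult[OF g] f by (simp add: mon_ideal_def)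
  qed
  moreover have "?I \<subseteq> poly_ring n" "0 \<in> ?I" by (auto simp: mon_ideal_def poly_ring_def)
  ultimately have 1: "is_ideal n ?I"
    unfolding is_ideal_def by blast
  have "Poly_Mapping.keys (hom_comp t f) \<subseteq> Poly_Mapping.keys f" for t and f :: "'a mpol"
    unfolding hom_comp_def
    by (rule order_trans[OF Poly_Mapping.keys_sum]) (auto split: if_splits)
  then have 2: "is_homogeneous ?I"
    unfolding is_homogeneous_def mon_ideal_def poly_ring_def by blast
  have "f \<in> ?I" if f: "f \<in> poly_ring n" and k: "\<forall>g\<in>forms n k. g * f \<in> ?I" for f k
  proof -
    let ?x = "Poly_Mapping.single (Poly_Mapping.single 0 k) 1 :: 'a mpol"
    have "?x \<in> forms n k" by (simp add: forms_def poly_ring_def)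
    then have xf: "?x * f \<in> ?I" using k by blast
    have "strip0 m \<notin> N" if "m \<in> Poly_Mapping.keys f" for m
    proof -
      have "Poly_Mapping.single 0 k + m \<in> Poly_Mapping.keys (?x * f)"
        using that by (simp add: in_keys_iff lookup_single_mult)
      then show ?thesis using xf by (auto simp: mon_ideal_def strip0_add strip0_single)
    qed
    then show ?thesis using f by (simp add: mon_ideal_def)
  qed
  then have "is_saturated n ?I" unfolding is_saturated_def by blast
  then show ?thesis using 1 2 by (simp add: is_scheme_def)
qed

text \<open>The standard monomials of degree \<open>t\<close> are the products of a power of
  \<open>x_0\<close> with an element of \<open>N\<close> of degree at most \<open>t\<close>; adding
  a free variable sums the Hilbert function.\<close>

lemma hilbert_fun_mon_ideal:
  assumes N: "\<And>m i. m \<in> N \<Longrightarrow> i \<in> Poly_Mapping.keys m \<Longrightarrow> m - pvar i \<in> N"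
    and keys: "\<And>m. m \<in> N \<Longrightarrow> Poly_Mapping.keys m \<subseteq> {1..n}"
  shows "hilbert_fun n (mon_ideal n N :: 'a::field mpol set) t = (\<Sum>s\<le>t. card {m \<in> N. mon_deg m = s})"
proof -
  let ?I = "mon_ideal n N :: 'a mpol set"
  let ?mon = "\<lambda>m. Poly_Mapping.single m (1 :: 'a)"
  define M where "M = {m. Poly_Mapping.keys m \<subseteq> {..n} \<and> mon_deg m = t \<and> strip0 m \<in> N}"
  define B where "B = ?mon ` M"
  have id: "is_ideal n ?I" using is_scheme_mon_ideal[OF N, where 'a = 'a] by (simp add: is_scheme_def)
  have finM: "finite M"
    by (rule finite_subset[OF _ finite_monomials_degree[of n t]]) (auto simp: M_def)
  have inj: "inj_on ?mon A" for A
    by (rule inj_onI) (metis lookup_single_eq lookup_single_not_eq zero_neq_one)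
  have Bf: "B \<subseteq> forms n t" by (auto simp: B_def M_def forms_def poly_ring_def)
  have ind: "mpol.independent B"
  proof (rule mpol.independent_if_scalars_zero)
    show "finite B" using finM by (simp add: B_def)
    fix g x assume g: "(\<Sum>x\<in>B. smult_mpol (g x) x) = 0" and x: "x \<in> B"
    obtain m where m: "m \<in> M" "x = ?mon m" using x by (auto simp: B_def)
    have "(\<Sum>m\<in>M. smult_mpol (g (?mon m)) (?mon m)) = 0"
      using g unfolding B_def sum.reindex[OF inj] by simp
    then have "0 = Poly_Mapping.lookup (\<Sum>m\<in>M. smult_mpol (g (?mon m)) (?mon m)) m"
      by (simp only: lookup_zero)
    also have "\<dots> = g x"
      using m finM by (simp add: lookup_sum lookup_single when_def if_distrib[of "(*) _"] cong: if_cong)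
    finally show "g x = 0" by simp
  qed
  have spB: "Poly_Mapping.keys f \<subseteq> M" if "f \<in> mpol.span B" for f
  proof -
    have "mpol.subspace {f :: 'a mpol. Poly_Mapping.keys f \<subseteq> M}"
    proof (rule mpol.subspaceI)
      fix f g :: "'a mpol"
      assume "f \<in> {f. Poly_Mapping.keys f \<subseteq> M}" "g \<in> {f. Poly_Mapping.keys f \<subseteq> M}"
      then show "f + g \<in> {f. Poly_Mapping.keys f \<subseteq> M}"
        using Poly_Mapping.keys_add[of f g] by blast
    qed (auto simp: in_keys_iff)
    moreover have "B \<subseteq> {f. Poly_Mapping.keys f \<subseteq> M}" by (auto simp: B_def)
    ultimately show ?thesis using that mpol.span_minimal by blast
  qed
  have BI: "mpol.span B \<inter> ?I = {0}"
  proof -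
    have "f = 0" if "f \<in> mpol.span B" "f \<in> ?I" for f
    proof -
      have "Poly_Mapping.keys f = {}" using spB[OF that(1)] that(2) unfolding mon_ideal_def M_def by blast
      then show ?thesis by simp
    qed
    then show ?thesis using mpol.span_zero mpol.subspace_0[OF subspace_ideal[OF id]] by auto
  qed
  have "hilbert_fun n ?I t = card B"
  proof (rule hilbert_fun_eq_card[OF id Bf ind BI], rule subsetI)
    fix f :: "'a mpol" assume f: "f \<in> forms n t"
    let ?s = "\<lambda>A. \<Sum>m\<in>A. smult_mpol (Poly_Mapping.lookup f m) (?mon m)"
    let ?K = "Poly_Mapping.keys f"
    have "f = ?s ?K" by (rule mpol_sum_monomials)
    also have "\<dots> = ?s (?K \<inter> M) + ?s (?K - M)"
      by (subst sum.union_disjoint[symmetric]) (auto simp: Int_Diff_Un)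
    finally have eq: "f = ?s (?K \<inter> M) + ?s (?K - M)" .
    have b: "?s (?K \<inter> M) \<in> mpol.span B"
      by (intro mpol.span_sum mpol.span_scale mpol.span_base) (auto simp: B_def)
    have "?mon m \<in> ?I \<inter> forms n t" if "m \<in> ?K - M" for m
      using that f by (auto simp: mon_ideal_def M_def forms_def poly_ring_def)
    then have "?s (?K - M) \<in> ?I \<inter> forms n t"
      using mpol.subspace_inter[OF subspace_ideal[OF id] subspace_forms]
      by (intro mpol.subspace_sum mpol.subspace_scale) auto
    then show "f \<in> {b + f | b f. b \<in> mpol.span B \<and> f \<in> ?I \<inter> forms n t}"
      using eq b by blast
  qed
  also have "card B = card M" unfolding B_def by (rule card_image[OF inj])
  also have "M = (\<Union>s\<in>{..t}. (\<lambda>m. m + Poly_Mapping.single 0 (t - s)) ` {m \<in> N. mon_deg m = s})"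
  proof (intro equalityI subsetI)
    fix m assume m: "m \<in> M"
    define s where "s = mon_deg (strip0 m)"
    have "mon_deg m = s + Poly_Mapping.lookup m 0"
      unfolding s_def using mon_deg_add[of "strip0 m" "Poly_Mapping.single 0 (Poly_Mapping.lookup m 0)"]
        strip0_decomp[of m] by simp
    then have "s \<le> t" "Poly_Mapping.lookup m 0 = t - s" using m by (auto simp: M_def)
    then show "m \<in> (\<Union>s\<in>{..t}. (\<lambda>m. m + Poly_Mapping.single 0 (t - s)) ` {m \<in> N. mon_deg m = s})"
      using strip0_decomp[of m] m by (auto simp: M_def s_def intro!: bexI[of _ s] image_eqI[of _ _ "strip0 m"])
  next
    fix m assume "m \<in> (\<Union>s\<in>{..t}. (\<lambda>m. m + Poly_Mapping.single 0 (t - s)) ` {m \<in> N. mon_deg m = s})"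
    then obtain s m' where s: "s \<le> t" and m: "m = m' + Poly_Mapping.single 0 (t - s)" "m' \<in> N" "mon_deg m' = s"
      by auto
    have "0 \<notin> Poly_Mapping.keys m'" using keys[OF m(2)] by auto
    then have "strip0 m = m'" by (simp add: m(1) strip0_add strip0_single strip0_id)
    moreover have "Poly_Mapping.keys m \<subseteq> {..n}"
      using keys[OF m(2)] unfolding m(1) keys_add_nat by (auto split: if_splits)
    ultimately show "m \<in> M" using m s by (simp add: M_def mon_deg_add)
  qed
  also have "card \<dots> = (\<Sum>s\<le>t. card ((\<lambda>m. m + Poly_Mapping.single 0 (t - s)) ` {m \<in> N. mon_deg m = s}))"
  proof (rule card_UN_disjoint)
    have "{m \<in> N. mon_deg m = s} \<subseteq> {m. Poly_Mapping.keys m \<subseteq> {..n} \<and> mon_deg m = s}" for s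
      using keys by force
    then have "finite {m \<in> N. mon_deg m = s}" for s
      using finite_monomials_degree finite_subset by blast
    then show "\<forall>s\<in>{..t}. finite ((\<lambda>m. m + Poly_Mapping.single 0 (t - s)) ` {m \<in> N. mon_deg m = s})"
      by simp
    show "\<forall>s\<in>{..t}. \<forall>s'\<in>{..t}. s \<noteq> s' \<longrightarrow>
        (\<lambda>m. m + Poly_Mapping.single 0 (t - s)) ` {m \<in> N. mon_deg m = s} \<inter>
        (\<lambda>m. m + Poly_Mapping.single 0 (t - s')) ` {m \<in> N. mon_deg m = s'} = {}"
    proof (intro ballI impI, rule ccontr)
      fix s s' assume s: "s \<in> {..t}" "s' \<in> {..t}" "s \<noteq> s'"
        "(\<lambda>m. m + Poly_Mapping.single 0 (t - s)) ` {m \<in> N. mon_deg m = s} \<inter>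
        (\<lambda>m. m + Poly_Mapping.single 0 (t - s')) ` {m \<in> N. mon_deg m = s'} \<noteq> {}"
      then obtain m m' where m: "m \<in> N" "m' \<in> N"
        "m + Poly_Mapping.single 0 (t - s) = m' + Poly_Mapping.single 0 (t - s')" by auto
      have "Poly_Mapping.lookup m 0 = 0" "Poly_Mapping.lookup m' 0 = 0"
        using keys[OF m(1)] keys[OF m(2)] by (auto simp: in_keys_iff subset_iff)
      then have "t - s = t - s'"
        using arg_cong[OF m(3), of "\<lambda>x. Poly_Mapping.lookup x 0"] by (simp add: lookup_add)
      then show False using s by simp
    qed
  qed simp
  also have "\<dots> = (\<Sum>s\<le>t. card {m \<in> N. mon_deg m = s})"
    by (intro sum.cong refl card_image) (simp add: inj_on_def)
  finally show ?thesis .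
qed

text \<open>Macaulay's bound says that the list for degree \<open>Suc t\<close> does not exceed the
  one for degree \<open>t\<close>. Hence its segment lies in the segment of the latter list, to
  which \<open>seg_shadow\<close> applies.\<close>

lemma o_seq_order_ideal:
  assumes h: "o_seq h"
  obtains N where "\<And>m i. m \<in> N \<Longrightarrow> i \<in> Poly_Mapping.keys m \<Longrightarrow> m - pvar i \<in> N"
    "\<And>m. m \<in> N \<Longrightarrow> Poly_Mapping.keys m \<subseteq> {1..h 1}"
    "\<And>t. card {m \<in> N. mon_deg m = t} = h t"
proof -
  \<comment> \<open>Degree 0 is set separately, as the number 1 has no expansion in base 0.\<close>
  define S where "S t = (if t = 0 then {0} else seg t (mac_seq t (h t)))" for t
  have ml: "mac_list t (mac_seq t (h t))" "mac_val t (mac_seq t (h t)) = h t" if "1 \<le> t" for t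
    using that by (simp_all add: mac_seq)
  have deg: "mon_deg m = t" if m: "m \<in> S t" for m t
  proof (cases "t = 0")
    case False
    then have "1 \<le> t" by simp
    moreover obtain k where "\<forall>x\<in>set (mac_seq t (h t)). x \<le> k"
      using finite_nat_set_iff_bounded_le[of "set (mac_seq t (h t))"] by auto
    ultimately have "S t \<subseteq> mons (k + 2) t"
      using seg_subset_mons[OF ml(1)] by (simp add: S_def)
    then show ?thesis using m by (auto simp: mons_def)
  qed (use m in \<open>simp add: S_def\<close>)
  have cardS: "card (S t) = h t" for t
    using h ml(2)[of t] by (cases "t = 0") (simp_all add: S_def card_seg o_seq_def)
  have shadow: "m - pvar i \<in> S t" if m: "m \<in> S (Suc t)" and i: "i \<in> Poly_Mapping.keys m" for m i t
  proof (cases "t = 0")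
    case True
    then have "mon_deg (m - pvar i) = 0" using deg[OF m] mon_deg_diff_pvar[OF i] by simp
    then show ?thesis using True by (simp add: S_def mon_deg_eq_0_iff)
  next
    case False
    then have t: "1 \<le> t" by simp
    let ?ks = "mac_seq t (h t)" and ?ls = "mac_seq (Suc t) (h (Suc t))"
    have ks: "mac_list (Suc t) ?ks" using ml(1)[OF t] by (rule mac_list_mono) simp
    have "h (Suc t) \<le> mac_up t (h t)" using h t by (simp add: o_seq_def)
    then have "\<not> list_less ?ks ?ls"
      using mac_val_less_iff[OF ks ml(1)[of "Suc t"]] ml(2)[of "Suc t"] by (simp add: mac_up_def)
    then have "seg (Suc t) ?ls \<subseteq> seg (Suc t) ?ks"
      using list_less_linear[of ?ks ?ls] seg_mono[OF _ ml(1)[of "Suc t"] ks] by auto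
    then have "m \<in> seg (Suc t) ?ks" using m by (auto simp: S_def)
    then show ?thesis using seg_shadow[OF ml(1)[OF t] _ i] False by (simp add: S_def)
  qed
  \<comment> \<open>Degree 1 fixes the number of variables. In higher degree each variable of a
    monomial survives division by a suitable variable, which leads to the degree below.\<close>
  have keysS: "S t \<subseteq> mons (h 1) t" for t
  proof (induction t)
    case 0
    then show ?case by (simp add: S_def mons_0)
  next
    case (Suc t)
    show ?case
    proof (cases "t = 0")
      case True
      show ?thesis
      proof (cases "h 1")
        case (Suc k)
        have "mac_seq 1 (Suc k) = [k]" by (rule mac_seq_eqI) simp_all
        then show ?thesis using True Suc by (simp add: S_def)
      qed (simp add: S_def True)
    next
      case False
      show ?thesis
      proof
        fix m assume m: "m \<in> S (Suc t)"
        have "i \<in> {1..h 1}" if i: "i \<in> Poly_Mapping.keys m" for i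
        proof -
          have "mon_deg (m - pvar i) = t" using deg[OF m] mon_deg_diff_pvar[OF i] by simp
          then have "m - pvar i \<noteq> 0" using False by auto
          then obtain j where j: "j \<in> Poly_Mapping.keys (m - pvar i)" by (meson keys_eq_empty ex_in_conv)
          then have ij: "i \<in> Poly_Mapping.keys (m - pvar j)" "j \<in> Poly_Mapping.keys m"
            using i by (auto simp: in_keys_iff lookup_minus lookup_single when_def split: if_splits)
          have "m - pvar j \<in> mons (h 1) t" using shadow[OF m ij(2)] Suc.IH by blast
          then show ?thesis using ij(1) unfolding mons_def by blast
        qed
        then show "m \<in> mons (h 1) (Suc t)" using deg[OF m] by (auto simp: mons_def)
      qed
    qed
  qed
  define N where "N = (\<Union>t. S t)"
  have NS: "{m \<in> N. mon_deg m = t} = S t" for t using deg by (auto simp: N_def)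
  show ?thesis
  proof (rule that)
    show "card {m \<in> N. mon_deg m = t} = h t" for t unfolding NS by (rule cardS)
    show "Poly_Mapping.keys m \<subseteq> {1..h 1}" if "m \<in> N" for m
      using that keysS by (auto simp: N_def mons_def)
    show "m - pvar i \<in> N" if m: "m \<in> N" "i \<in> Poly_Mapping.keys m" for m i
    proof -
      obtain t where t: "m \<in> S t" using m by (auto simp: N_def)
      show ?thesis
      proof (cases t)
        case 0
        then show ?thesis using t m by (simp add: S_def)
      next
        case (Suc s)
        then show ?thesis using shadow[of m s i] t m by (auto simp: N_def)
      qed
    qed
  qed
qed

theorem scheme_exists:
  assumes "mono H" "o_seq (first_diff H)"
  shows "\<exists>n (I :: 'a::field mpol set). is_scheme n I \<and> hilbert_fun n I = H"
proof -
  obtain N where N: "\<And>m i. m \<in> N \<Longrightarrow> i \<in> Poly_Mapping.keys m \<Longrightarrow> m - pvar i \<in> N"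
    "\<And>m. m \<in> N \<Longrightarrow> Poly_Mapping.keys m \<subseteq> {1..first_diff H 1}"
    "\<And>t. card {m \<in> N. mon_deg m = t} = first_diff H t"
    by (rule o_seq_order_ideal[OF assms(2)]) blast
  have "(\<Sum>s\<le>t. first_diff H s) = H t" for t
    using monoD[OF assms(1) le_SucI[OF order_refl]] by (induction t) simp_all
  then have "hilbert_fun (first_diff H 1) (mon_ideal (first_diff H 1) N :: 'a mpol set) t = H t" for t
    using hilbert_fun_mon_ideal[OF N(1,2)] N(3) by simp
  then show ?thesis
    using is_scheme_mon_ideal[OF N(1)] by (intro exI conjI ext)
qed

subsection \<open>Values of Gotzmann polynomials\<close>

lemma gbinomial_of_int_Ints: "(of_int a :: rat) gchoose k \<in> \<int>"
proof (cases "0 \<le> a")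
  case True
  then have "(of_int a :: rat) gchoose k = of_nat (nat a choose k)"
    by (simp add: binomial_gbinomial)
  then show ?thesis by simp
next
  case False
  then have "(of_int a :: rat) gchoose k = (-1) ^ k * of_nat (nat (int k - a - 1) choose k)"
    using gbinomial_negated_upper[of "of_int a :: rat" k] by (simp add: binomial_gbinomial)
  then show ?thesis by simp
qed

text \<open>The summands are integers also at negative arguments, so rounding changes nothing, and a
  value of at least 1 excludes truncation at 0.\<close>

lemma pval_eq:
  assumes "gotzmann_rep p ks" "1 \<le> pval p t"
  shows "poly p (of_nat t) = of_nat (pval p t)"
proof -
  have "(of_nat t :: rat) + of_nat k - of_nat i gchoose k \<in> \<int>" for k i
    using gbinomial_of_int_Ints[of "int t + int k - int i" k] by simp
  then have "poly p (of_nat t) \<in> \<int>"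
    using assms(1) by (auto simp: gotzmann_rep_def intro!: Ints_sum)
  then show ?thesis using assms(2) by (auto simp: pval_def elim!: Ints_cases)
qed

lemma pval_of_nat: "poly p (of_nat t) = of_nat a \<Longrightarrow> pval p t = a"
  by (simp add: pval_def)

lemma poly_poly_diff: "poly (poly_diff p) (of_nat (Suc t)) = poly p (of_nat (Suc t)) - poly p (of_nat t)"
  by (simp add: poly_diff_def poly_pcompose)

text \<open>The condition of \<open>Pi_set\<close> without the bound by the Gotzmann number. As
  degree 0 is exempt, \<open>mac_from q 0\<close> agrees with \<open>mac_from q 1\<close>, which
  suits the exceptional value 0 of \<open>rho\<close>.\<close>

definition mac_from :: "rat poly \<Rightarrow> nat \<Rightarrow> bool" where
  "mac_from q s \<longleftrightarrow> (\<forall>t\<ge>s. 1 \<le> t \<longrightarrow> 1 \<le> pval q t \<and> pval q (Suc t) \<le> mac_up t (pval q t))"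

lemma mem_Pi_set_iff: "t \<in> Pi_set q \<longleftrightarrow> 1 \<le> t \<and> t \<le> gotzmann_number q \<and> mac_from q t"
proof -
  have "(\<forall>h. 1 \<le> pval q (t + h) \<and> pval q (t + h + 1) \<le> binexp_up (t + h) (pval q (t + h)) \<and> 1 \<le> pval q (t + h + 1))
      \<longleftrightarrow> mac_from q t" if t: "1 \<le> t"
  proof
    assume *: "\<forall>h. 1 \<le> pval q (t + h) \<and> pval q (t + h + 1) \<le> binexp_up (t + h) (pval q (t + h)) \<and> 1 \<le> pval q (t + h + 1)"
    show "mac_from q t"
      unfolding mac_from_def
    proof (intro allI impI)
      fix s assume "t \<le> s" "1 \<le> s"
      then show "1 \<le> pval q s \<and> pval q (Suc s) \<le> mac_up s (pval q s)"
        using *[rule_format, of "s - t"] binexp_up_eq[of "pval q s" s] by simp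
    qed
  next
    assume *: "mac_from q t"
    show "\<forall>h. 1 \<le> pval q (t + h) \<and> pval q (t + h + 1) \<le> binexp_up (t + h) (pval q (t + h)) \<and> 1 \<le> pval q (t + h + 1)"
    proof
      fix h
      show "1 \<le> pval q (t + h) \<and> pval q (t + h + 1) \<le> binexp_up (t + h) (pval q (t + h)) \<and> 1 \<le> pval q (t + h + 1)"
        using *[unfolded mac_from_def, rule_format, of "t + h"] *[unfolded mac_from_def, rule_format, of "t + h + 1"]
          binexp_up_eq[of "pval q (t + h)" "t + h"] t by simp
    qed
  qed
  then show ?thesis by (auto simp: Pi_set_def)
qed

text \<open>From \<open>length ks\<close> on, \<open>ks\<close> is itself the expansion of the
  values, and Macaulay's bound holds with equality.\<close>

lemma Min_Pi_set:
  assumes "gotzmann_rep q ks" "ks \<noteq> []"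
  shows "Min (Pi_set q) \<in> Pi_set q" "s \<in> Pi_set q \<Longrightarrow> Min (Pi_set q) \<le> s"
    "Min (Pi_set q) \<le> length ks"
proof -
  have r: "gotzmann_number q = length ks" by (rule gotzmann_number_eq[OF assms(1)])
  have srt: "sorted_wrt (\<ge>) ks" using assms(1) by (simp add: gotzmann_rep_def)
  have pv: "pval q t = mac_val t ks" if "length ks \<le> t" for t
    by (rule pval_of_nat[OF gotzmann_rep_poly[OF assms(1) that]])
  have "mac_from q (length ks)"
    unfolding mac_from_def
  proof (intro allI impI)
    fix t assume t: "length ks \<le> t"
    then have "mac_list t ks" using srt by (simp add: mac_list_def)
    then show "1 \<le> pval q t \<and> pval q (Suc t) \<le> mac_up t (pval q t)"
      using t pv mac_val_pos[OF assms(2)] mac_up_val by (simp add: Suc_le_eq)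
  qed
  then have mem: "length ks \<in> Pi_set q"
    using assms(2) r by (simp add: mem_Pi_set_iff Suc_le_eq)
  have fin: "finite (Pi_set q)" by (rule finite_subset[of _ "{..gotzmann_number q}"]) (auto simp: mem_Pi_set_iff)
  show "Min (Pi_set q) \<in> Pi_set q" using Min_in[OF fin] mem by auto
  show "s \<in> Pi_set q \<Longrightarrow> Min (Pi_set q) \<le> s" using Min_le[OF fin] .
  show "Min (Pi_set q) \<le> length ks" using Min_le[OF fin mem] .
qed

lemma mac_from_rho:
  assumes "gotzmann_rep q ks" "ks \<noteq> []" "rho q \<le> s"
  shows "mac_from q s"
proof -
  have "1 \<le> Min (Pi_set q)" "mac_from q (Min (Pi_set q))"
    using Min_Pi_set(1)[OF assms(1,2)] by (simp_all add: mem_Pi_set_iff)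
  moreover have "Min (Pi_set q) \<le> t" if "s \<le> t" "1 \<le> t" for t
    using assms(3) that by (auto simp: rho_def split: if_splits)
  ultimately show ?thesis by (auto simp: mac_from_def)
qed

text \<open>Together with \<open>mac_from_rho\<close> and \<open>rho_0\<close> this characterises
  \<open>rho q\<close> as the least admissible start of Macaulay's bound; the start 0 requires in
  addition the value 1 there.\<close>

lemma rho_le:
  assumes "gotzmann_rep q ks" "ks \<noteq> []" "mac_from q s" "1 \<le> s \<or> poly q 0 = 1"
  shows "rho q \<le> s"
proof -
  have r: "gotzmann_number q = length ks" by (rule gotzmann_number_eq[OF assms(1)])
  show ?thesis
  proof (cases "1 \<le> s")
    case True
    then have "Min (Pi_set q) \<le> s"
      using Min_Pi_set(2)[OF assms(1,2), of s] Min_Pi_set(3)[OF assms(1,2)] assms(3) r by (cases "s \<le> length ks") (auto simp: mem_Pi_set_iff)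
    then show ?thesis by (simp add: rho_def)
  next
    case False
    then have "1 \<in> Pi_set q"
      using assms r by (auto simp: mem_Pi_set_iff mac_from_def Suc_le_eq)
    then have "Min (Pi_set q) \<le> 1" by (rule Min_Pi_set(2)[OF assms(1,2)])
    moreover have "1 \<le> Min (Pi_set q)" using Min_Pi_set(1)[OF assms(1,2)] by (simp add: mem_Pi_set_iff)
    ultimately show ?thesis using assms(4) False by (simp add: rho_def)
  qed
qed

lemma rho_0: "gotzmann_rep q ks \<Longrightarrow> ks \<noteq> [] \<Longrightarrow> rho q = 0 \<Longrightarrow> poly q 0 = 1"
  using Min_Pi_set(1)[of q ks] by (auto simp: rho_def mem_Pi_set_iff split: if_splits)

subsection \<open>Regularity\<close>

lemma regularityD:
  assumes "eventually_poly H p" "regularity H p \<le> t"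
  shows "of_nat (H t) = poly p (of_nat t)"
proof -
  have "\<forall>t'\<ge>regularity H p. of_nat (H t') = poly p (of_nat t')"
    unfolding regularity_def by (rule LeastI_ex) (use assms(1) in \<open>simp add: eventually_poly_def\<close>)
  then show ?thesis using assms(2) by blast
qed

lemma regularity_le: "(\<And>t. s \<le> t \<Longrightarrow> of_nat (H t) = poly p (of_nat t)) \<Longrightarrow> regularity H p \<le> s"
  unfolding regularity_def by (rule Least_le) simp

lemma eventually_polyI: "(\<And>t. s \<le> t \<Longrightarrow> of_nat (H t) = poly p (of_nat t)) \<Longrightarrow> eventually_poly H p"
  by (auto simp: eventually_poly_def)

text \<open>A nonzero \<open>p\<close> excludes the unit ideal, whose Hilbert function
  vanishes.\<close>

lemma hilbert_funsD:
  fixes K :: "'a::field itself"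
  assumes inf: "infinite (UNIV :: 'a set)" and p: "p \<noteq> 0" and H: "H \<in> hilbert_funs K p \<rho>"
  shows "mono H" "o_seq H" "o_seq (first_diff H)" "eventually_poly H p" "regularity H p = \<rho>"
proof -
  obtain n and I :: "'a mpol set" where I: "is_scheme n I" "H = hilbert_fun n I"
    and ev: "eventually_poly H p" "regularity H p = \<rho>"
    using H by (auto simp: hilbert_funs_def)
  have "1 \<notin> I"
  proof
    assume "1 \<in> I"
    then have "H t = 0" for t using I hilbert_fun_0(2)[of n I t] by (simp add: is_scheme_def)
    then have "poly p (of_nat t) = poly 0 (of_nat t)" if "\<rho> \<le> t" for t
      using regularityD[OF ev(1), of t] ev(2) that by simp
    then have "p = 0" by (rule poly_eq_if_eventually)
    then show False using p by simp
  qed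
  then show "mono H" "o_seq H" "o_seq (first_diff H)"
    using scheme_o_seq[OF inf I(1)] I(2) by auto
  show "eventually_poly H p" "regularity H p = \<rho>" by fact+
qed

lemma hilbert_funsI:
  fixes K :: "'a::field itself"
  assumes "mono H" "o_seq (first_diff H)" "eventually_poly H p" "regularity H p = \<rho>"
  shows "H \<in> hilbert_funs K p \<rho>"
  using scheme_exists[OF assms(1,2), where 'a = 'a] assms(3,4) by (auto simp: hilbert_funs_def)

subsection \<open>Descending extensions\<close>

lemma mac_down_pos: "1 \<le> t \<Longrightarrow> 1 \<le> a \<Longrightarrow> 1 \<le> mac_down t a"
proof -
  assume "1 \<le> t" "1 \<le> a"
  then have "mac_seq t a \<noteq> []" using mac_seq(2)[of t a] by auto
  then show ?thesis using mac_val_pos by (simp add: mac_down_def Suc_le_eq)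
qed

text \<open>
  Below \<open>s\<close> the differences of \<open>H\<close> are \<open>mac_green t (H t)\<close>, whose image under \<open>mac_up\<close> is
  \<open>mac_up t (H t) - H t\<close>.
\<close>

lemma o_seq_descending:
  assumes pos: "\<And>t. 1 \<le> H t"
    and down: "\<And>t. t < s \<Longrightarrow> H t = mac_down (Suc t) (H (Suc t))"
    and H0: "s = 0 \<Longrightarrow> H 0 = 1"
    and up: "\<And>t. s \<le> t \<Longrightarrow> 1 \<le> t \<Longrightarrow> H (Suc t) \<le> mac_up t (H t)"
    and incr: "\<And>t. s \<le> t \<Longrightarrow> H t \<le> H (Suc t)"
    and diff: "\<And>t. Suc s \<le> t \<Longrightarrow> H (Suc t) - H t \<le> mac_up t (H t - H (t - 1))"
  shows "mono H" "o_seq (first_diff H)"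
proof -
  have green: "H (Suc t) = H t + mac_green (Suc t) (H (Suc t))" if "t < s" for t
    using down[OF that] mac_down_add_green[of "Suc t" "H (Suc t)"] by simp
  have le: "H t \<le> H (Suc t)" for t
    using green[of t] incr[of t] by (cases "t < s") linarith+
  then show "mono H" by (simp add: mono_iff_le_Suc)
  \<comment> \<open>\<open>mac_green 1 c\<close> is \<open>c - 1\<close>, so a descending step into
    degree 0 always ends at 1.\<close>
  have H0: "H 0 = 1"
  proof (cases "s = 0")
    case False
    then have "H 0 + mac_green 1 (H 1) = H 1" using green[of 0] by simp
    then show ?thesis using mac_green_1[of "H 1"] pos[of 1] by simp
  qed (rule H0)
  have up: "H (Suc t) \<le> mac_up t (H t)" if "1 \<le> t" for t
    using up[of t] down[of t] mac_down_le_iff[OF that, of "H (Suc t)" "H t"] that by (cases "s \<le> t") auto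
  have "first_diff H (Suc t) \<le> mac_up t (first_diff H t)" if t: "1 \<le> t" for t
  proof -
    obtain r where r: "t = Suc r" using t by (cases t) auto
    show ?thesis
    proof (cases "t \<le> s")
      case True
      then have "first_diff H t = mac_green t (H t)" using green[of r] r by simp
      then have "mac_up t (first_diff H t) = mac_up t (H t) - H t" using mac_up_green[OF t] by simp
      then show ?thesis using up[OF t] by simp
    next
      case False
      then show ?thesis using diff[of t] r by simp
    qed
  qed
  then show "o_seq (first_diff H)" using H0 by (simp add: o_seq_def)
qed

section \<open>Descending functions of a fixed Gotzmann polynomial\<close>

locale gotzmann_poly =
  fixes p :: "rat poly" and ks :: "nat list"
  assumes rep: "gotzmann_rep p ks" and ne: "ks \<noteq> []"
begin

text \<open>Truncation of the subtraction is harmless under the maximum with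
  \<open>rho p\<close>.\<close>

definition min_reg :: nat where
  "min_reg = (if degree p = 0 then rho p else max (rho p) (rho (poly_diff p) - 1))"

lemma p_nonzero: "p \<noteq> 0"
  using gotzmann_rep_poly[OF rep order_refl] mac_val_pos[OF ne, of "length ks"] by auto

lemma rep_diff: "gotzmann_rep (poly_diff p) (dec_list ks)"
  by (rule gotzmann_rep_poly_diff[OF rep])

lemma dec_list_nonempty:
  assumes "degree p \<noteq> 0"
  shows "dec_list ks \<noteq> []"
proof
  assume "dec_list ks = []"
  then have "poly (poly_diff p) z = 0" for z using rep_diff by (simp add: gotzmann_rep_def)
  then have step: "poly p (of_nat (Suc t)) = poly p (of_nat t)" for t
    using poly_poly_diff[of p t] by simp
  have "poly p (of_nat t) = poly p 0" for t
  proof (induction t)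
    case (Suc t)
    then show ?case using step[of t] by simp
  qed simp
  then have "p = [:poly p 0:]" by (intro poly_eq_if_eventually[of 0]) simp
  then have "degree p = degree [:poly p 0:]" by (rule arg_cong)
  then show False using assms by simp
qed

lemma pval_diff:
  assumes d: "degree p \<noteq> 0" "rho (poly_diff p) \<le> Suc t" and t: "1 \<le> pval p t" "1 \<le> pval p (Suc t)"
  shows "pval p (Suc t) = pval p t + pval (poly_diff p) (Suc t)" "1 \<le> pval (poly_diff p) (Suc t)"
proof -
  show 1: "1 \<le> pval (poly_diff p) (Suc t)"
    using mac_from_rho[OF rep_diff dec_list_nonempty[OF d(1)] d(2)] by (simp add: mac_from_def)
  have "(of_nat (pval p (Suc t)) :: rat) = of_nat (pval p t + pval (poly_diff p) (Suc t))"
    using pval_eq[OF rep_diff 1] pval_eq[OF rep t(1)] pval_eq[OF rep t(2)] poly_poly_diff[of p t] by simp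
  then show "pval p (Suc t) = pval p t + pval (poly_diff p) (Suc t)" by (simp only: of_nat_eq_iff)
qed

lemma pval_from:
  assumes "rho p \<le> \<rho>" "\<rho> \<le> t"
  shows "1 \<le> pval p t" "poly p (of_nat t) = of_nat (pval p t)"
    "1 \<le> t \<Longrightarrow> pval p (Suc t) \<le> mac_up t (pval p t)"
proof -
  have mf: "mac_from p \<rho>" by (rule mac_from_rho[OF rep ne assms(1)])
  show 1: "1 \<le> pval p t"
  proof (cases "1 \<le> t")
    case False
    then have "t = 0" "rho p = 0" using assms by simp_all
    then show ?thesis using rho_0[OF rep ne] by (simp add: pval_def)
  qed (use mf assms in \<open>auto simp: mac_from_def\<close>)
  show "poly p (of_nat t) = of_nat (pval p t)" by (rule pval_eq[OF rep 1])
  show "1 \<le> t \<Longrightarrow> pval p (Suc t) \<le> mac_up t (pval p t)" using mf assms by (auto simp: mac_from_def)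
qed

text \<open>The first difference formed from values of \<open>p\<close> alone is the one at
  \<open>Suc \<rho>\<close>, so the bound for \<open>poly_diff p\<close> is used from there on; this
  is the shift by one in \<open>min_reg\<close>. For constant \<open>p\<close> all differences
  vanish.\<close>

lemma pval_incr:
  assumes "min_reg \<le> \<rho>" "\<rho> \<le> t"
  shows "pval p t \<le> pval p (Suc t)"
    and "Suc \<rho> \<le> t \<Longrightarrow> pval p (Suc t) - pval p t \<le> mac_up t (pval p t - pval p (t - 1))"
proof -
  have rp: "rho p \<le> \<rho>" using assms by (auto simp: min_reg_def split: if_splits)
  note pos = pval_from(1)[OF rp]
  have "pval p t \<le> pval p (Suc t) \<and>
    (Suc \<rho> \<le> t \<longrightarrow> pval p (Suc t) - pval p t \<le> mac_up t (pval p t - pval p (t - 1)))"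
  proof (cases "degree p = 0")
    case True
    then obtain c where "p = [:c:]" by (rule degree_eq_zeroE)
    then have "pval p s = pval p t" for s by (simp add: pval_def)
    from this[of "Suc t"] this[of "t - 1"] show ?thesis by simp
  next
    case False
    then have rd: "rho (poly_diff p) \<le> Suc \<rho>" using assms by (simp add: min_reg_def le_diff_conv)
    have 1: "pval p (Suc t) = pval p t + pval (poly_diff p) (Suc t)"
      using rd assms pos by (intro pval_diff(1) False) auto
    have "pval p (Suc t) - pval p t \<le> mac_up t (pval p t - pval p (t - 1))" if t: "Suc \<rho> \<le> t"
    proof -
      obtain s where s: "t = Suc s" using t by (cases t) auto
      have "pval p t = pval p s + pval (poly_diff p) t"
        unfolding s using rd assms pos t s by (intro pval_diff(1) False) auto
      moreover have "pval (poly_diff p) (Suc t) \<le> mac_up t (pval (poly_diff p) t)"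
        using mac_from_rho[OF rep_diff dec_list_nonempty[OF False] rd] t by (auto simp: mac_from_def)
      ultimately show ?thesis using 1 s by simp
    qed
    then show ?thesis using 1 by simp
  qed
  then show "pval p t \<le> pval p (Suc t)"
    "Suc \<rho> \<le> t \<Longrightarrow> pval p (Suc t) - pval p t \<le> mac_up t (pval p t - pval p (t - 1))" by auto
qed

lemma f_fun_ge: "\<rho> \<le> t \<Longrightarrow> f_fun p \<rho> t = pval p t"
  by (simp add: f_fun.simps[of p \<rho> t])

lemma f_fun_pos:
  assumes "rho p \<le> \<rho>"
  shows "1 \<le> f_fun p \<rho> t"
proof (induction "\<rho> - t" arbitrary: t)
  case 0
  then show ?case using pval_from(1)[OF assms] by (simp add: f_fun_ge)
next
  case (Suc d)
  then have "1 \<le> f_fun p \<rho> (Suc t)" by simp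
  then have "1 \<le> binexp_down (Suc t) (f_fun p \<rho> (Suc t))"
    using mac_down_pos by (simp add: binexp_down_eq)
  moreover have "\<not> \<rho> \<le> t" using Suc.hyps(2) by simp
  ultimately show ?case by (simp add: f_fun.simps[of p \<rho> t])
qed

lemma f_fun_down: "rho p \<le> \<rho> \<Longrightarrow> t < \<rho> \<Longrightarrow> f_fun p \<rho> t = mac_down (Suc t) (f_fun p \<rho> (Suc t))"
  using f_fun_pos[of \<rho> "Suc t"] by (simp add: f_fun.simps[of p \<rho> t] binexp_down_eq)

lemma f_fun_o_seq:
  assumes "min_reg \<le> \<rho>"
  shows "mono (f_fun p \<rho>)" "o_seq (first_diff (f_fun p \<rho>))"
    "\<rho> \<le> t \<Longrightarrow> of_nat (f_fun p \<rho> t) = poly p (of_nat t)"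
proof -
  have rp: "rho p \<le> \<rho>" using assms by (auto simp: min_reg_def split: if_splits)
  let ?f = "f_fun p \<rho>"
  have f0: "?f 0 = 1" if "\<rho> = 0"
    using rho_0[OF rep ne] rp that by (simp add: f_fun_ge pval_def)
  have up: "?f (Suc t) \<le> mac_up t (?f t)" if "\<rho> \<le> t" "1 \<le> t" for t
    using pval_from(3)[OF rp that] that by (simp add: f_fun_ge)
  have incr: "?f t \<le> ?f (Suc t)" if "\<rho> \<le> t" for t
    using pval_incr(1)[OF assms that] that by (simp add: f_fun_ge)
  have diff: "?f (Suc t) - ?f t \<le> mac_up t (?f t - ?f (t - 1))" if "Suc \<rho> \<le> t" for t
    using pval_incr(2)[OF assms _ that] that by (simp add: f_fun_ge)
  note od = o_seq_descending[of ?f \<rho>, OF f_fun_pos[OF rp] f_fun_down[OF rp] f0 up incr diff]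
  show "mono ?f" "o_seq (first_diff ?f)" by (rule od; assumption)+
  show "\<rho> \<le> t \<Longrightarrow> of_nat (f_fun p \<rho> t) = poly p (of_nat t)"
    using pval_from(2)[OF rp] by (simp add: f_fun_ge)
qed

text \<open>The regularity can fall below \<open>\<rho>\<close> when the descending extension
  happens to agree with \<open>p\<close> just below \<open>\<rho>\<close>.\<close>

lemma f_fun_hilbert:
  fixes K :: "'a::field itself"
  assumes "min_reg \<le> \<rho>"
  shows "f_fun p \<rho> \<in> hilbert_funs K p (regularity (f_fun p \<rho>) p)" "regularity (f_fun p \<rho>) p \<le> \<rho>"
proof -
  show "f_fun p \<rho> \<in> hilbert_funs K p (regularity (f_fun p \<rho>) p)"
    by (intro hilbert_funsI f_fun_o_seq assms eventually_polyI[of \<rho>]) simp_all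
  show "regularity (f_fun p \<rho>) p \<le> \<rho>"
    by (intro regularity_le f_fun_o_seq assms)
qed

text \<open>From \<open>\<rho>\<close> on, \<open>H\<close> equals \<open>p\<close>, and from
  \<open>Suc \<rho>\<close> on its difference equals \<open>poly_diff p\<close>. The O-sequence
  conditions become those that define the two values of \<open>rho\<close>, with
  \<open>H 0 = 1\<close> for the exceptional case.\<close>

lemma min_reg_le:
  fixes K :: "'a::field itself"
  assumes inf: "infinite (UNIV :: 'a set)" and H: "H \<in> hilbert_funs K p \<rho>"
  shows "min_reg \<le> \<rho>"
proof -
  note h = hilbert_funsD[OF inf p_nonzero H]
  have eq: "poly p (of_nat t) = of_nat (H t)" if "\<rho> \<le> t" for t
    using regularityD[OF h(4), of t] h(5) that by simp
  have pv: "pval p t = H t" if "\<rho> \<le> t" for t by (rule pval_of_nat[OF eq[OF that]])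
  have H0: "H 0 = 1" using h(2) by (simp add: o_seq_def)
  have Hpos: "1 \<le> H t" for t using monoD[OF h(1), of 0 t] H0 by simp
  have "mac_from p \<rho>" using h(2) pv Hpos by (auto simp: mac_from_def o_seq_def)
  moreover have "1 \<le> \<rho> \<or> poly p 0 = 1" using eq[of 0] H0 by (cases \<rho>) auto
  ultimately have 1: "rho p \<le> \<rho>" by (intro rho_le[OF rep ne])
  have "rho (poly_diff p) \<le> Suc \<rho>" if d: "degree p \<noteq> 0"
  proof (rule rho_le[OF rep_diff dec_list_nonempty[OF d]])
    let ?h = "first_diff H"
    have hu: "?h (Suc t) \<le> mac_up t (?h t)" if "1 \<le> t" for t using h(3) that by (simp add: o_seq_def)
    have dq: "poly (poly_diff p) (of_nat t) = of_nat (?h t)" if t: "Suc \<rho> \<le> t" for t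
    proof -
      obtain s where s: "t = Suc s" using t by (cases t) auto
      then have "poly (poly_diff p) (of_nat t) = of_nat (H (Suc s)) - of_nat (H s)"
        using eq[of s] eq[of "Suc s"] t poly_poly_diff[of p s] by simp
      then show ?thesis using s monoD[OF h(1), of s "Suc s"] by (simp add: of_nat_diff)
    qed
    \<comment> \<open>A zero difference would persist by Macaulay's bound, and
      \<open>poly_diff p\<close> would vanish.\<close>
    have "1 \<le> ?h t" if t: "Suc \<rho> \<le> t" for t
    proof (rule ccontr)
      assume "\<not> 1 \<le> ?h t"
      then have z: "?h t = 0" by simp
      have "?h s = 0" if "t \<le> s" for s
        using that
      proof (induction s rule: dec_induct)
        case (step s)
        then show ?case using hu[of s] t by simp
      qed (rule z)
      then have "poly (poly_diff p) (of_nat s) = poly 0 (of_nat s)" if "t \<le> s" for s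
        using dq[of s] t that by simp
      then have "poly_diff p = 0" by (rule poly_eq_if_eventually)
      then have "gotzmann_rep (poly_diff p) []" by (simp add: gotzmann_rep_def)
      then show False using gotzmann_rep_unique[OF rep_diff] dec_list_nonempty[OF d] by blast
    qed
    moreover have "pval (poly_diff p) t = ?h t" if "Suc \<rho> \<le> t" for t
      by (rule pval_of_nat[OF dq[OF that]])
    ultimately show "mac_from (poly_diff p) (Suc \<rho>)"
      using hu by (simp add: mac_from_def)
  qed simp
  then show ?thesis using 1 by (auto simp: min_reg_def)
qed

text \<open>At \<open>min_reg\<close> itself the regularity of \<open>f\<close> cannot be smaller,
  because \<open>min_reg\<close> bounds every regularity that occurs.\<close>

lemma min_regularity_eq:
  fixes K :: "'a::field itself"
  assumes inf: "infinite (UNIV :: 'a set)"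
  shows "min_regularity K p = min_reg" "f_fun p min_reg \<in> hilbert_funs K p min_reg"
proof -
  have "regularity (f_fun p min_reg) p = min_reg"
    using min_reg_le[OF inf f_fun_hilbert(1)[OF order_refl]] f_fun_hilbert(2)[OF order_refl] by simp
  then show mem: "f_fun p min_reg \<in> hilbert_funs K p min_reg"
    using f_fun_hilbert(1)[OF order_refl, of K] by simp
  show "min_regularity K p = min_reg"
    unfolding min_regularity_def
  proof (rule Least_equality)
    show "hilbert_funs K p min_reg \<noteq> {}" using mem by blast
    show "min_reg \<le> \<rho>" if "hilbert_funs K p \<rho> \<noteq> {}" for \<rho>
      using that min_reg_le[OF inf] by blast
  qed
qed

text \<open>With \<open>s = \<rho> - 1\<close>, the value of \<open>p\<close> at \<open>s\<close> is
  the least one that Macaulay's bound allows before that of \<open>p\<close> at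
  \<open>\<rho>\<close>. Now \<open>H\<close> must differ from \<open>p\<close> at \<open>s\<close>,
  so it is at least one larger, and the remaining conditions on \<open>g\<close> near
  \<open>s\<close> are inherited from \<open>H\<close>.\<close>

lemma g_fun_hilbert:
  fixes K :: "'a::field itself"
  assumes inf: "infinite (UNIV :: 'a set)" and \<rho>: "min_reg < \<rho>" "regularity (f_fun p \<rho>) p \<noteq> \<rho>"
    and H: "H \<in> hilbert_funs K p \<rho>"
  shows "g_fun p \<rho> \<in> hilbert_funs K p \<rho>"
proof -
  have m: "min_reg \<le> \<rho>" using \<rho> by simp
  have rp: "rho p \<le> \<rho>" using m by (auto simp: min_reg_def split: if_splits)
  obtain s where s: "\<rho> = Suc s" using \<rho> by (cases \<rho>) auto
  have "regularity (f_fun p \<rho>) p \<le> s"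
    using f_fun_hilbert(2)[OF m] \<rho>(2) s by simp
  then have fs: "poly p (of_nat s) = of_nat (f_fun p \<rho> s)"
    using regularityD[OF eventually_polyI[of \<rho>, OF f_fun_o_seq(3)[OF m]], of s] by simp
  have ps: "pval p s = f_fun p \<rho> s" by (rule pval_of_nat[OF fs])
  have fdown: "f_fun p \<rho> s = mac_down \<rho> (pval p \<rho>)"
    using f_fun_down[OF rp, of s] s by (simp add: f_fun_ge)
  note h = hilbert_funsD[OF inf p_nonzero H]
  have eq: "poly p (of_nat t) = of_nat (H t)" if "\<rho> \<le> t" for t
    using regularityD[OF h(4), of t] h(5) that by simp
  have pv: "pval p t = H t" if "\<rho> \<le> t" for t by (rule pval_of_nat[OF eq[OF that]])
  have H0: "H 0 = 1" using h(2) by (simp add: o_seq_def)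
  have ne: "H s \<noteq> pval p s"
  proof
    assume *: "H s = pval p s"
    have "regularity H p \<le> s"
    proof (rule regularity_le)
      fix t assume "s \<le> t"
      then show "of_nat (H t) = poly p (of_nat t)"
        using eq[of t] fs ps * s by (cases "t = s") auto
    qed
    then show False using h(5) s by simp
  qed
  \<comment> \<open>In degree 0 there is no freedom: \<open>H\<close> and \<open>f\<close> both take
    the value 1, which contradicts \<open>ne\<close>.\<close>
  have s1: "1 \<le> s"
  proof (rule ccontr)
    assume "\<not> 1 \<le> s"
    then have "s = 0" by simp
    moreover have "f_fun p \<rho> 0 = 1" using f_fun_o_seq(2)[OF m] by (simp add: o_seq_def)
    ultimately show False using ne H0 ps by simp
  qed
  have "mac_down \<rho> (H \<rho>) \<le> H s"
    using h(2) s1 mac_down_le_iff[OF s1, of "H \<rho>" "H s"] s by (simp add: o_seq_def)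
  then have Hs: "Suc (pval p s) \<le> H s"
    using ne ps fdown pv[of \<rho>] by simp
  let ?g = "g_fun p \<rho>"
  have gge: "?g t = pval p t" if "\<rho> \<le> t" for t using that by (simp add: g_fun.simps[of p \<rho> t])
  have gs: "?g s = Suc (pval p s)" by (subst g_fun.simps) (simp add: s)
  have gless: "?g t = binexp_down (Suc t) (?g (Suc t))" if "t < s" for t
    using that by (subst g_fun.simps) (simp add: s)
  have gpos: "1 \<le> ?g t" for t
  proof (induction "s - t" arbitrary: t)
    case 0
    then show ?case using gs gge[of t] pval_from(1)[OF rp, of t] s by (cases "t = s") auto
  next
    case (Suc d)
    then have "1 \<le> ?g (Suc t)" by simp
    then show ?case using Suc.hyps(2) mac_down_pos[of "Suc t" "?g (Suc t)"] gless[of t]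
      by (simp add: binexp_down_eq)
  qed
  have mono_s: "?g s \<le> ?g \<rho>"
    using Hs gs gge[of \<rho>] pv[of \<rho>] monoD[OF h(1), of s \<rho>] s by simp
  \<comment> \<open>The minimal value at \<open>s\<close> already satisfies the bound, and raising
    it only relaxes the bound.\<close>
  have up_s: "?g \<rho> \<le> mac_up s (?g s)"
  proof -
    have "mac_down (Suc s) (pval p \<rho>) \<le> ?g s" using gs ps fdown s by simp
    then show ?thesis using mac_down_le_iff[OF s1] gge[of \<rho>] by simp
  qed
  \<comment> \<open>As \<open>g\<close> is at most \<open>H\<close> at \<open>s\<close>, its jump to
    \<open>\<rho>\<close> is at least that of \<open>H\<close>, which weakens the condition on the
    next difference.\<close>
  have diff_s: "?g (Suc \<rho>) - ?g \<rho> \<le> mac_up \<rho> (?g \<rho> - ?g s)"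
  proof -
    have "H (Suc \<rho>) - H \<rho> \<le> mac_up \<rho> (H \<rho> - H s)"
      using h(3) s by (auto simp: o_seq_def dest!: spec[of _ \<rho>])
    also have "\<dots> \<le> mac_up \<rho> (?g \<rho> - ?g s)"
      using Hs gs gge[of \<rho>] pv[of \<rho>] s by (intro mac_up_mono) auto
    finally show ?thesis using gge pv by simp
  qed
  have up: "?g (Suc t) \<le> mac_up t (?g t)" if "s \<le> t" "1 \<le> t" for t
    using up_s pval_from(3)[OF rp, of t] gge[of t] gge[of "Suc t"] that s
    by (cases "t = s") auto
  have incr: "?g t \<le> ?g (Suc t)" if "s \<le> t" for t
    using mono_s pval_incr(1)[OF m, of t] gge[of t] gge[of "Suc t"] that s
    by (cases "t = s") auto
  have diff: "?g (Suc t) - ?g t \<le> mac_up t (?g t - ?g (t - 1))" if t: "Suc s \<le> t" for t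
  proof (cases "t = \<rho>")
    case True
    then show ?thesis using diff_s s by simp
  next
    case False
    then have "Suc \<rho> \<le> t" using t s by simp
    then show ?thesis
      using pval_incr(2)[OF m, of t] gge[of t] gge[of "Suc t"] gge[of "t - 1"] by simp
  qed
  have down: "?g t = mac_down (Suc t) (?g (Suc t))" if "t < s" for t
    using gless[OF that] gpos[of "Suc t"] by (simp add: binexp_down_eq)
  have ev: "of_nat (?g t) = poly p (of_nat t)" if "\<rho> \<le> t" for t
    using pval_from(2)[OF rp that] gge[OF that] by simp
  have reg: "regularity ?g p = \<rho>"
  proof (rule antisym)
    show "regularity ?g p \<le> \<rho>" by (rule regularity_le[OF ev])
    show "\<rho> \<le> regularity ?g p"
    proof (rule ccontr)
      assume "\<not> \<rho> \<le> regularity ?g p"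
      then have "of_nat (?g s) = poly p (of_nat s)"
        using regularityD[OF eventually_polyI[of \<rho>, OF ev]] s by simp
      then show False using gs fs ps by simp
    qed
  qed
  have g0: "?g 0 = 1" if "s = 0" using that s1 by simp
  note od = o_seq_descending[of ?g s, OF gpos down g0 up incr diff]
  show ?thesis
    by (rule hilbert_funsI[OF od eventually_polyI[of \<rho>, OF ev] reg])
qed

end

lemma admissible_gotzmann_rep:
  assumes inf: "infinite (UNIV :: 'a::field set)" and "admissible TYPE('a) p"
  shows "\<exists>ks. gotzmann_rep p ks"
proof -
  obtain n and I :: "'a mpol set" where I: "is_scheme n I" "eventually_poly (hilbert_fun n I) p"
    using assms by (auto simp: admissible_def)
  have ev: "poly p (of_nat t) = of_nat (hilbert_fun n I t)" if "regularity (hilbert_fun n I) p \<le> t" for t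
    using regularityD[OF I(2) that] by simp
  show ?thesis
  proof (rule gotzmann_rep_exists[OF _ ev])
    show "hilbert_fun n I (Suc t) \<le> mac_up t (hilbert_fun n I t)" if "1 \<le> t" for t
      by (rule scheme_mono_macaulay(2)[OF inf I(1) that])
  qed
qed

theorem theorem3p9:
  fixes p :: "rat poly"
  assumes "admissible TYPE('a::{alg_closed_field, field_char_0}) p"
    and "gotzmann_number p > 1"
  shows "(int (min_regularity TYPE('a) p) =
            (if degree p = 0 then int (rho p)
             else max (int (rho p)) (int (rho (poly_diff p)) - 1)) \<and>
          f_fun p (min_regularity TYPE('a) p) \<in> hilbert_funs TYPE('a) p (min_regularity TYPE('a) p)) \<and>
         (\<forall>\<rho>>min_regularity TYPE('a) p.
            hilbert_funs TYPE('a) p \<rho> \<noteq> {} \<longleftrightarrow>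
              (if regularity (f_fun p \<rho>) p = \<rho> then f_fun p \<rho> \<in> hilbert_funs TYPE('a) p \<rho>
               else g_fun p \<rho> \<in> hilbert_funs TYPE('a) p \<rho>))"
proof -
  have inf: "infinite (UNIV :: 'a set)" by (rule infinite_UNIV_char_0)
  obtain ks where ks: "gotzmann_rep p ks"
    using admissible_gotzmann_rep[OF inf assms(1)] by blast
  interpret gotzmann_poly p ks
    by unfold_locales (use ks gotzmann_number_eq[OF ks] assms(2) in auto)
  note min = min_regularity_eq[OF inf, of "TYPE('a)"]
  have "hilbert_funs TYPE('a) p \<rho> \<noteq> {} \<longleftrightarrow>
        (if regularity (f_fun p \<rho>) p = \<rho> then f_fun p \<rho> \<in> hilbert_funs TYPE('a) p \<rho>
         else g_fun p \<rho> \<in> hilbert_funs TYPE('a) p \<rho>)" if \<rho>: "min_reg < \<rho>" for \<rho>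
  proof (cases "regularity (f_fun p \<rho>) p = \<rho>")
    case True
    then show ?thesis using f_fun_hilbert(1)[of \<rho> "TYPE('a)"] \<rho> by auto
  next
    case False
    then show ?thesis using g_fun_hilbert[OF inf \<rho> False, of _ "TYPE('a)"] by auto
  qed
  moreover have "int min_reg = (if degree p = 0 then int (rho p)
             else max (int (rho p)) (int (rho (poly_diff p)) - 1))"
    by (auto simp: min_reg_def)
  ultimately show ?thesis using min by simp
qed

end
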